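(* There is an algorithm, running in time polynomial in $m$ and $n$, which, given a matrix $S\in\mathbb{R}^{m\times n}$, determines whether $S$ is a $2$-product and, in case it is, outputs two matrices $S_1,S_2$ and special rows $x_1$ of $S_1$, $y_1$ of $S_2$, such that $S=(S_1,x_1)\otimes_2(S_2,y_1)$ up to permutation of rows and columns.
   Context: The $1$-product of $A\in\mathbb{R}^{m_1\times n_1}$ and $B\in\mathbb{R}^{m_2\times n_2}$ is the matrix $A\otimes B\in\mathbb{R}^{(m_1+m_2)\times(n_1n_2)}$ whose column with index $j=(k-1)n_2+\ell$ ($1\le k\le n_1$, $1\le \ell\le n_2$) is the concatenation of the $k$th column of $A$ on top of the $\ell$th column of $B$. Let $S_1,S_2$ be real matrices, and let $x_1$ be a row of $S_1$ and $y_1$ a row of $S_2$, each with all entries in $\{0,1\}$ and containing both $0$'s and $1$'s; these are called special rows. For $a\in\{0,1\}$, let $S_1^a$ be the matrix obtained from $S_1$ by deleting the row $x_1$ and keeping exactly the columns whose $x_1$-entry is $a$; define $S_2^a$ analogously from $S_2$ and $y_1$. All of $S_1^0,S_1^1,S_2^0,S_2^1$ are assumed non-empty. The $2$-product of $S_1$ with special row $x_1$ and $S_2$ with special row $y_1$ is $$(S_1,x_1)\otimes_2(S_2,y_1):=\left(\begin{array}{c|c}S_1^0\otimes S_2^0 & S_1^1\otimes S_2^1\\ 0\cdots 0 & 1\cdots 1\end{array}\right).$$ Two matrices are isomorphic if one is obtained from the other by permuting rows and columns. $S$ is a $2$-product if there exist matrices $S_1,S_2$ and special rows $x_1$ of $S_1$,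 $y_1$ of $S_2$ such that $S$ is isomorphic to $(S_1,x_1)\otimes_2(S_2,y_1)$. *)

theory Defs
  imports "Jordan_Normal_Form.DL_Submatrix" "HOL-Combinatorics.Permutations"
begin

section \<open>Products of matrices\<close>

text \<open>Rows and columns are indexed from 0, so column \<open>j\<close> of the 1-product stacks column
  \<open>j div n\<^sub>2\<close> of the first matrix on top of column \<open>j mod n\<^sub>2\<close> of the second one.\<close>

definition one_product :: "real mat \<Rightarrow> real mat \<Rightarrow> real mat" where
  "one_product A B = mat (dim_row A + dim_row B) (dim_col A * dim_col B)
     (\<lambda>(i, j). if i < dim_row A then A $$ (i, j div dim_col B)
               else B $$ (i - dim_row A, j mod dim_col B))"

text \<open>A special row is given by its index.\<close>

definition special_row :: "real mat \<Rightarrow> nat \<Rightarrow> bool" where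
  "special_row S x \<longleftrightarrow> x < dim_row S
     \<and> (\<forall>j < dim_col S. S $$ (x, j) \<in> {0, 1})
     \<and> (\<exists>j < dim_col S. S $$ (x, j) = 0)
     \<and> (\<exists>j < dim_col S. S $$ (x, j) = 1)"

definition special_part :: "real mat \<Rightarrow> nat \<Rightarrow> real \<Rightarrow> real mat" where
  "special_part S x a = submatrix S (- {x}) {j. j < dim_col S \<and> S $$ (x, j) = a}"

definition nonempty_mat :: "real mat \<Rightarrow> bool" where
  "nonempty_mat A \<longleftrightarrow> 0 < dim_row A \<and> 0 < dim_col A"

definition two_product :: "real mat \<Rightarrow> nat \<Rightarrow> real mat \<Rightarrow> nat \<Rightarrow> real mat" where
  "two_product S1 x1 S2 y1 =
     (let P0 = one_product (special_part S1 x1 0) (special_part S2 y1 0);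
          P1 = one_product (special_part S1 x1 1) (special_part S2 y1 1)
      in four_block_mat P0 P1
           (mat 1 (dim_col P0) (\<lambda>_. 0)) (mat 1 (dim_col P1) (\<lambda>_. 1)))"

definition isomorphic_mat :: "real mat \<Rightarrow> real mat \<Rightarrow> bool" where
  "isomorphic_mat A B \<longleftrightarrow> (\<exists>p q. p permutes {..<dim_row B} \<and> q permutes {..<dim_col B}
     \<and> A = mat (dim_row B) (dim_col B) (\<lambda>(i, j). B $$ (p i, q j)))"

definition two_product_witness ::
    "real mat \<Rightarrow> real mat \<Rightarrow> nat \<Rightarrow> real mat \<Rightarrow> nat \<Rightarrow> bool" where
  "two_product_witness S S1 x1 S2 y1 \<longleftrightarrow>
     special_row S1 x1 \<and> special_row S2 y1
     \<and> nonempty_mat (special_part S1 x1 0) \<and> nonempty_mat (special_part S1 x1 1)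
     \<and> nonempty_mat (special_part S2 y1 0) \<and> nonempty_mat (special_part S2 y1 1)
     \<and> isomorphic_mat S (two_product S1 x1 S2 y1)"

definition is_two_product :: "real mat \<Rightarrow> bool" where
  "is_two_product S \<longleftrightarrow> (\<exists>S1 x1 S2 y1. two_product_witness S S1 x1 S2 y1)"


section \<open>Real RAM\<close>

text \<open>
  Algorithms on real matrices are programs of a real RAM, presented as a while language. A state
  consists of arrays of natural numbers (used for indices and counters) and of real numbers. A
  program uses finitely many arrays, since the array names are part of its text, but it computes
  array indices at run time. Scalars are the entries at index 0.

  Real entries have unit size, with exact field operations and comparisons at unit cost. There
  are no real constants apart from natural numbers, and no conversion from reals to naturals (no
  rounding). On naturals only addition, truncated subtraction and comparison are available, so
  that a run of length \<open>t\<close> only creates naturals with \<open>O(t)\<close> more bits than the constants and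
  inputs; unit-cost multiplication would not have this property.
\<close>

datatype nexp =
    NConst nat
  | NGet string nexp
  | NAdd nexp nexp
  | NSub nexp nexp

text \<open>\<open>RDiv\<close> inherits the convention that division by zero yields zero.\<close>

datatype rexp =
    ROfNat nexp
  | RGet string nexp
  | RAdd rexp rexp
  | RSub rexp rexp
  | RMul rexp rexp
  | RDiv rexp rexp

datatype bexp =
    NLess nexp nexp
  | NEq nexp nexp
  | RLess rexp rexp
  | REq rexp rexp
  | BNot bexp
  | BAnd bexp bexp

datatype com =
    Skip
  | NSet string nexp nexp
  | RSet string nexp rexp
  | Seq com com
  | Cond bexp com com
  | Loop bexp com

record state =
  nats :: "string \<Rightarrow> nat \<Rightarrow> nat"
  reals :: "string \<Rightarrow> nat \<Rightarrow> real"

primrec nval :: "nexp \<Rightarrow> state \<Rightarrow> nat" where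
  "nval (NConst k) s = k"
| "nval (NGet a e) s = nats s a (nval e s)"
| "nval (NAdd e f) s = nval e s + nval f s"
| "nval (NSub e f) s = nval e s - nval f s"

primrec rval :: "rexp \<Rightarrow> state \<Rightarrow> real" where
  "rval (ROfNat e) s = real (nval e s)"
| "rval (RGet a e) s = reals s a (nval e s)"
| "rval (RAdd e f) s = rval e s + rval f s"
| "rval (RSub e f) s = rval e s - rval f s"
| "rval (RMul e f) s = rval e s * rval f s"
| "rval (RDiv e f) s = rval e s / rval f s"

primrec bval :: "bexp \<Rightarrow> state \<Rightarrow> bool" where
  "bval (NLess e f) s \<longleftrightarrow> nval e s < nval f s"
| "bval (NEq e f) s \<longleftrightarrow> nval e s = nval f s"
| "bval (RLess e f) s \<longleftrightarrow> rval e s < rval f s"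
| "bval (REq e f) s \<longleftrightarrow> rval e s = rval f s"
| "bval (BNot b) s \<longleftrightarrow> \<not> bval b s"
| "bval (BAnd b c) s \<longleftrightarrow> bval b s \<and> bval c s"

definition nats_upd :: "string \<Rightarrow> nat \<Rightarrow> nat \<Rightarrow> state \<Rightarrow> state" where
  "nats_upd a i v s = s\<lparr>nats := (nats s)(a := (nats s a)(i := v))\<rparr>"

definition reals_upd :: "string \<Rightarrow> nat \<Rightarrow> real \<Rightarrow> state \<Rightarrow> state" where
  "reals_upd a i v s = s\<lparr>reals := (reals s)(a := (reals s a)(i := v))\<rparr>"

text \<open>\<open>exec c s t s'\<close>: started in \<open>s\<close>, the program \<open>c\<close> halts in \<open>s'\<close> after \<open>t\<close> steps. Every
  executed assignment, skip and test counts as one step. Counting instead the operations in the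
  expressions would change \<open>t\<close> by at most a factor depending only on the program.\<close>

inductive exec :: "com \<Rightarrow> state \<Rightarrow> nat \<Rightarrow> state \<Rightarrow> bool" where
  Skip: "exec Skip s 1 s"
| NSet: "exec (NSet a e f) s 1 (nats_upd a (nval e s) (nval f s) s)"
| RSet: "exec (RSet a e f) s 1 (reals_upd a (nval e s) (rval f s) s)"
| Seq: "exec c s t s' \<Longrightarrow> exec d s' u s'' \<Longrightarrow> exec (Seq c d) s (t + u) s''"
| CondTrue: "bval b s \<Longrightarrow> exec c s t s' \<Longrightarrow> exec (Cond b c d) s (t + 1) s'"
| CondFalse: "\<not> bval b s \<Longrightarrow> exec d s t s' \<Longrightarrow> exec (Cond b c d) s (t + 1) s'"
| LoopFalse: "\<not> bval b s \<Longrightarrow> exec (Loop b c) s 1 s"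
| LoopTrue: "bval b s \<Longrightarrow> exec c s t s' \<Longrightarrow> exec (Loop b c) s' u s''
    \<Longrightarrow> exec (Loop b c) s (t + u + 1) s''"

inductive_cases exec_SkipE: "exec Skip s t s'"
inductive_cases exec_NSetE: "exec (NSet a e f) s t s'"
inductive_cases exec_RSetE: "exec (RSet a e f) s t s'"
inductive_cases exec_SeqE: "exec (Seq c d) s t s'"
inductive_cases exec_CondE: "exec (Cond b c d) s t s'"
inductive_cases exec_LoopE: "exec (Loop b c) s t s'"

lemma exec_deterministic:
  "exec c s t s' \<Longrightarrow> exec c s u s'' \<Longrightarrow> t = u \<and> s' = s''"
proof (induction arbitrary: u s'' rule: exec.induct)
  case Skip
  then show ?case by (elim exec_SkipE) simp
next
  case NSet
  then show ?case by (elim exec_NSetE) simp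
next
  case RSet
  then show ?case by (elim exec_RSetE) simp
next
  case (Seq c s t s' d v s2)
  from Seq.prems obtain t1 r v1 where "exec c s t1 r" "exec d r v1 s''" "u = t1 + v1"
    by (rule exec_SeqE)
  with Seq.IH(1)[of t1 r] Seq.IH(2)[of v1 s''] show ?case by simp
next
  case (CondTrue b s c t s' d)
  from CondTrue.prems CondTrue.hyps(1) obtain t1 where "exec c s t1 s''" "u = t1 + 1"
    by (elim exec_CondE) simp_all
  with CondTrue.IH[of t1 s''] show ?case by simp
next
  case (CondFalse b s d t s' c)
  from CondFalse.prems CondFalse.hyps(1) obtain t1 where "exec d s t1 s''" "u = t1 + 1"
    by (elim exec_CondE) simp_all
  with CondFalse.IH[of t1 s''] show ?case by simp
next
  case (LoopFalse b s c)
  from LoopFalse.prems show ?case by (rule exec_LoopE) (use LoopFalse.hyps in simp_all)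
next
  case (LoopTrue b s c t s' v s2)
  from LoopTrue.prems obtain t1 r v1
    where "exec c s t1 r" "exec (Loop b c) r v1 s''" "u = t1 + v1 + 1"
    by (rule exec_LoopE) (use LoopTrue.hyps(1) in simp_all)
  with LoopTrue.IH(1)[of t1 r] LoopTrue.IH(2)[of v1 s''] show ?case by simp
qed


section \<open>Input and output\<close>

text \<open>Matrices are stored row by row; all cells not used by the input are 0 initially.\<close>

definition input_state :: "real mat \<Rightarrow> state" where
  "input_state S = \<lparr>
     nats = (\<lambda>a i. if i = 0 \<and> a = ''m'' then dim_row S
                   else if i = 0 \<and> a = ''n'' then dim_col S else 0),
     reals = (\<lambda>a i. if a = ''S'' \<and> i < dim_row S * dim_col S
                    then S $$ (i div dim_col S, i mod dim_col S) else 0)\<rparr>"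

definition read_mat :: "string \<Rightarrow> nat \<Rightarrow> nat \<Rightarrow> state \<Rightarrow> real mat" where
  "read_mat a r c s = mat r c (\<lambda>(i, j). reals s a (i * c + j))"

text \<open>The program answers through the cell \<open>found\<close>: 0 means that the input is not a
  2-product, anything else that \<open>S\<^sub>1\<close>, \<open>x\<^sub>1\<close>, \<open>S\<^sub>2\<close>, \<open>y\<^sub>1\<close> can be read off.\<close>

definition answer :: "state \<Rightarrow> (real mat \<times> nat \<times> real mat \<times> nat) option" where
  "answer s = (if nats s ''found'' 0 = 0 then None
     else Some (read_mat ''S1'' (nats s ''m1'' 0) (nats s ''n1'' 0) s, nats s ''x1'' 0,
                read_mat ''S2'' (nats s ''m2'' 0) (nats s ''n2'' 0) s, nats s ''y1'' 0))"

end

theory Submission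
  imports Defs
begin

text \<open>
  Fix the row \<open>r\<close> of \<open>S\<close> that is to become the special row, and let a column be drawn uniformly at random.
  Then \<open>S\<close> is a 2-product with special row \<open>r\<close> iff the other rows split into nonempty sets \<open>X\<close> and \<open>Y\<close> that
  are independent given the entry in row \<open>r\<close>. Such a split is found greedily. Start with \<open>A = {p}\<close> for some
  row \<open>p\<close>. If \<open>A\<close> is independent of a set \<open>P\<close> of rows, but not of \<open>P \<union> {j}\<close>, then \<open>j\<close> lies on the side of \<open>A\<close> in
  every split: otherwise \<open>P\<close> consists of a part \<open>U\<close> on the side of \<open>A\<close> and a part \<open>V\<close> on the other side,
  \<open>A \<union> U\<close> is independent of \<open>V \<union> {j}\<close>, and together with the independence of \<open>A\<close> and \<open>U\<close> this makes \<open>A\<close>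
  independent of \<open>P \<union> {j}\<close>. Hence adding such rows \<open>j\<close> to \<open>A\<close> yields the least side containing \<open>p\<close>.

  Given the split, the numbers of occurrences of the pairs of partial columns form an integer matrix of
  rank one for each value of row \<open>r\<close>. Such a matrix is an outer product of integer vectors, which are the
  column multiplicities of the two factors.

  Everything that has to be tested is a counting problem, so bounded sums over rows and columns suffice
  to express it, and programs built from such expressions and bounded loops run in polynomial time.
\<close>

section \<open>Conditional independence of sets of rows\<close>

text \<open>The greedy step rests on the semigraphoid laws of conditional independence: symmetry,
  decomposition (\<open>cond_indep_mono\<close>) and contraction. A start row needs no guessing: the
  complement of a side, without \<open>r\<close>, is again a side, so any row other than
  \<open>r\<close> lies on some side. Only \<open>r\<close> is enumerated, and one test of the grown
  set settles it. The point that needs arithmetic is integrality: independence by itself gives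
  rational weights, while columns come in whole numbers. Among the N columns with a given entry in
  row \<open>r\<close>, the row sums divided by their gcd g add up to N / g, and independence forces
  N / g to divide every column sum. Both factors are then submatrices of \<open>S\<close> in which
  repeated columns are thinned out, so real numbers are only compared and copied. The machine cannot
  multiply or divide naturals. This is why independence is an equation between products of
  cardinalities, and why products, divisibility and gcd are all recovered by counting.\<close>

locale table =
  fixes M :: "'i \<Rightarrow> 'c \<Rightarrow> 'v" and C :: "'c set" and r :: 'i
  assumes finite_C [simp]: "finite C"
begin

text \<open>Row \<open>r\<close> is always compared, so the conditioning is built in:
  \<open>cls {} k\<close> is the conditioning event, and putting \<open>r\<close> into
  \<open>X\<close> or leaving it out changes nothing.\<close>

definition cls :: "'i set \<Rightarrow> 'c \<Rightarrow> 'c set" where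
  "cls X k = {c \<in> C. \<forall>i\<in>insert r X. M i c = M i k}"

text \<open>The rows in \<open>X\<close> and the rows in \<open>Y\<close> of a uniformly random column are independent given its entry in row \<open>r\<close>.\<close>

definition cond_indep :: "'i set \<Rightarrow> 'i set \<Rightarrow> bool" where
  "cond_indep X Y \<longleftrightarrow> (\<forall>k\<in>C. \<forall>l\<in>cls {} k.
     card (cls X k \<inter> cls Y l) * card (cls {} k) = card (cls X k) * card (cls Y l))"

lemma finite_cls [simp]: "finite (cls X k)"
  by (simp add: cls_def)

lemma cls_self: "k \<in> C \<Longrightarrow> k \<in> cls X k"
  by (simp add: cls_def)

lemma cls_subset: "cls X k \<subseteq> C"
  by (auto simp: cls_def)

lemma cls_eq: "c \<in> cls X k \<Longrightarrow> cls X c = cls X k"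
  by (auto simp: cls_def)

lemma cls_mono: "X \<subseteq> Y \<Longrightarrow> cls Y k \<subseteq> cls X k"
  by (auto simp: cls_def)

lemma cls_Un: "cls (X \<union> Y) k = cls X k \<inter> cls Y k"
  by (auto simp: cls_def)

lemma card_cls_pos: "k \<in> C \<Longrightarrow> 0 < card (cls X k)"
  using cls_self card_gt_0_iff finite_cls by blast

lemma cls_cong: "insert r X = insert r Y \<Longrightarrow> cls X = cls Y"
  by (intro ext) (simp only: cls_def)

lemma cond_indep_cong:
  "insert r X = insert r X' \<Longrightarrow> insert r Y = insert r Y' \<Longrightarrow> cond_indep X Y = cond_indep X' Y'"
  using cls_cong[of X X'] cls_cong[of Y Y'] by (simp add: cond_indep_def del: insert_iff)

lemma cond_indep_sym: "cond_indep X Y \<Longrightarrow> cond_indep Y X"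
  unfolding cond_indep_def
proof (intro ballI)
  fix k l assume *: "\<forall>k\<in>C. \<forall>l\<in>cls {} k. card (cls X k \<inter> cls Y l) * card (cls {} k) = card (cls X k) * card (cls Y l)"
    and k: "k \<in> C" "l \<in> cls {} k"
  then have "l \<in> C" "k \<in> cls {} l" "cls {} l = cls {} k"
    by (auto simp: cls_def)
  with * show "card (cls Y k \<inter> cls X l) * card (cls {} k) = card (cls Y k) * card (cls X l)"
    by (metis inf_commute mult.commute)
qed

lemma cond_indep_empty: "cond_indep X {}"
  unfolding cond_indep_def
proof (intro ballI)
  fix k l assume "k \<in> C" "l \<in> cls {} k"
  then have "cls {} l = cls {} k" by (simp add: cls_eq)
  moreover have "cls X k \<inter> cls {} k = cls X k" using cls_mono[of "{}" X k] by auto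
  ultimately show "card (cls X k \<inter> cls {} l) * card (cls {} k) = card (cls X k) * card (cls {} l)"
    by simp
qed

text \<open>Agreement on more rows is a finer equivalence, so each class of \<open>X'\<close> is a
  disjoint union of classes of \<open>X\<close>. Taking \<open>UNIV\<close> for \<open>F\<close>
  gives plain sizes.\<close>

lemma card_cls_partition:
  assumes "X' \<subseteq> X"
  shows "card (cls X' k \<inter> F) = (\<Sum>E\<in>cls X ` cls X' k. card (E \<inter> F))"
proof -
  have "cls X' k \<inter> F = (\<Union>E\<in>cls X ` cls X' k. E \<inter> F)"
  proof (intro equalityI subsetI)
    fix x assume "x \<in> cls X' k \<inter> F"
    then show "x \<in> (\<Union>E\<in>cls X ` cls X' k. E \<inter> F)"
      using cls_self[of x X] cls_subset[of X' k] by auto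
  next
    fix x assume "x \<in> (\<Union>E\<in>cls X ` cls X' k. E \<inter> F)"
    then obtain c where "c \<in> cls X' k" "x \<in> cls X c" "x \<in> F" by auto
    then show "x \<in> cls X' k \<inter> F"
      using cls_mono[OF assms, of c] cls_eq[of c X' k] by auto
  qed
  moreover have "card (\<Union>E\<in>cls X ` cls X' k. E \<inter> F) = (\<Sum>E\<in>cls X ` cls X' k. card (E \<inter> F))"
  proof (rule card_UN_disjoint)
    show "\<forall>E\<in>cls X ` cls X' k. finite (E \<inter> F)" by auto
    show "\<forall>E\<in>cls X ` cls X' k. \<forall>E'\<in>cls X ` cls X' k. E \<noteq> E' \<longrightarrow> E \<inter> F \<inter> (E' \<inter> F) = {}"
    proof (intro ballI impI)
      fix E E' assume "E \<in> cls X ` cls X' k" "E' \<in> cls X ` cls X' k" "E \<noteq> E'"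
      then show "E \<inter> F \<inter> (E' \<inter> F) = {}" using cls_eq by blast
    qed
  qed simp
  ultimately show ?thesis by simp
qed

text \<open>Marginalisation: the product equations for the \<open>X\<close>-classes inside one
  \<open>X'\<close>-class share all other quantities and can be added up.\<close>

lemma cond_indep_mono_left:
  assumes "cond_indep X Y" "X' \<subseteq> X"
  shows "cond_indep X' Y"
  unfolding cond_indep_def
proof (intro ballI)
  fix k l assume k: "k \<in> C" "l \<in> cls {} k"
  have E: "card (E \<inter> cls Y l) * card (cls {} k) = card E * card (cls Y l)" if "E \<in> cls X ` cls X' k" for E
  proof -
    from that obtain c where c: "c \<in> cls X' k" "E = cls X c" by auto
    then have "c \<in> cls {} k" using cls_mono[of "{}" X' k] by auto
    then have "cls {} c = cls {} k" "c \<in> C" using cls_eq cls_subset by blast+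
    with assms(1) k c(2) show ?thesis unfolding cond_indep_def by metis
  qed
  have "card (cls X' k \<inter> cls Y l) * card (cls {} k) =
      (\<Sum>E\<in>cls X ` cls X' k. card (E \<inter> cls Y l) * card (cls {} k))"
    by (simp add: card_cls_partition[OF assms(2)] sum_distrib_right)
  also have "\<dots> = (\<Sum>E\<in>cls X ` cls X' k. card E * card (cls Y l))"
    by (intro sum.cong refl E)
  also have "\<dots> = card (cls X' k) * card (cls Y l)"
    using card_cls_partition[OF assms(2), of k UNIV] by (simp add: sum_distrib_right)
  finally show "card (cls X' k \<inter> cls Y l) * card (cls {} k) = card (cls X' k) * card (cls Y l)" .
qed

lemma cond_indep_mono:
  assumes "cond_indep X Y" "X' \<subseteq> X" "Y' \<subseteq> Y"
  shows "cond_indep X' Y'"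
  using cond_indep_mono_left[OF cond_indep_sym[OF cond_indep_mono_left[OF assms(1,2)]] assms(3)]
  by (rule cond_indep_sym)

text \<open>Given row \<open>r\<close>, P(A,U,W) = P(A,U) P(W) = P(A) P(U) P(W) = P(A) P(U,W); the
  last step needs \<open>U\<close> independent of \<open>W\<close>, which is decomposition applied
  to the first premise.\<close>

lemma cond_indep_contraction:
  assumes AU_W: "cond_indep (A \<union> U) W" and A_U: "cond_indep A U"
  shows "cond_indep A (U \<union> W)"
  unfolding cond_indep_def
proof (intro ballI)
  fix k l assume k: "k \<in> C" "l \<in> cls {} k"
  let ?N = "card (cls {} k)"
  have N: "?N > 0" and l: "l \<in> C" and kl: "cls {} l = cls {} k"
    using k cls_subset card_cls_pos cls_eq by blast+
  have 1: "card (cls A k \<inter> cls U l) * ?N = card (cls A k) * card (cls U l)"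
    using A_U k unfolding cond_indep_def by blast
  moreover have "card (cls A k) > 0" "card (cls U l) > 0" using k l card_cls_pos by blast+
  ultimately have "card (cls A k \<inter> cls U l) \<noteq> 0" by (metis mult_is_0 neq0_conv)
  \<comment> \<open>\<open>cond_indep\<close> speaks only about patterns of actual columns, so a
    column with the \<open>A\<close>-pattern of \<open>k\<close> and the \<open>U\<close>-pattern of
    \<open>l\<close> is needed; it exists because the product in fact \<open>1\<close> is
    positive.\<close>
  then obtain c where c: "c \<in> cls A k" "c \<in> cls U l"
    by (metis IntD1 IntD2 card.empty ex_in_conv)
  then have cAU: "cls (A \<union> U) c = cls A k \<inter> cls U l" by (simp add: cls_Un cls_eq)
  have ck: "c \<in> C" "cls {} c = cls {} k"
    using c(1) cls_subset cls_mono[of "{}" A k] cls_eq by blast+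
  have 2: "card (cls A k \<inter> cls U l \<inter> cls W l) * ?N = card (cls A k \<inter> cls U l) * card (cls W l)"
    using AU_W ck k(2) unfolding cond_indep_def cAU[symmetric] by metis
  have "cond_indep U W" by (rule cond_indep_mono_left[OF AU_W]) simp
  then have 3: "card (cls U l \<inter> cls W l) * ?N = card (cls U l) * card (cls W l)"
    using l kl cls_self[OF l, of "{}"] unfolding cond_indep_def by metis
  have "card (cls A k \<inter> cls (U \<union> W) l) * ?N * ?N = card (cls A k \<inter> cls U l) * ?N * card (cls W l)"
    using 2 by (simp add: cls_Un inf_assoc mult.commute mult.left_commute)
  also have "\<dots> = card (cls A k) * (card (cls U l) * card (cls W l))"
    by (simp add: 1)
  also have "\<dots> = card (cls A k) * card (cls (U \<union> W) l) * ?N"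
    by (simp add: 3[symmetric] cls_Un)
  finally show "card (cls A k \<inter> cls (U \<union> W) l) * ?N = card (cls A k) * card (cls (U \<union> W) l)"
    using N by (metis mult_cancel2 less_not_refl)
qed

end

section \<open>Greedy growth of one side of a split\<close>

locale nat_table = table M "{..<n}" r for M :: "nat \<Rightarrow> nat \<Rightarrow> 'v" and n r +
  fixes m :: nat
begin

text \<open>The first row whose addition destroys independence, or \<open>m\<close> if there is
  none. It is written as a cardinality because a bounded count is an expression of the loop
  language.\<close>

definition obstacle :: "nat set \<Rightarrow> nat" where
  "obstacle A = card {j. j < m \<and> cond_indep A {i. i \<le> j \<and> i \<notin> A}}"

text \<open>An obstacle of \<open>m\<close> means that nothing is left to add; the intersection then
  makes \<open>A\<close> a fixed point.\<close>

definition grow :: "nat set \<Rightarrow> nat set" where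
  "grow A = A \<union> ({obstacle A} \<inter> {..<m})"

lemma obstacle_le: "obstacle A \<le> m"
  unfolding obstacle_def using card_mono[of "{..<m}" "{j. j < m \<and> cond_indep A {i. i \<le> j \<and> i \<notin> A}}"]
  by auto

text \<open>By decomposition the counted rows form an initial segment, and the size of an initial
  segment is its first missing element.\<close>

lemma cond_indep_iff_less_obstacle:
  assumes "j < m"
  shows "cond_indep A {i. i \<le> j \<and> i \<notin> A} \<longleftrightarrow> j < obstacle A"
proof -
  let ?J = "{j. j < m \<and> cond_indep A {i. i \<le> j \<and> i \<notin> A}}"
  have down: "j' \<in> ?J" if "j \<in> ?J" "j' \<le> j" for j j'
  proof -
    from that have "cond_indep A {i. i \<le> j \<and> i \<notin> A}" by simp
    then have "cond_indep A {i. i \<le> j' \<and> i \<notin> A}"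
      by (rule cond_indep_mono) (use that in auto)
    with that show ?thesis by simp
  qed
  have fin: "finite ?J" by simp
  show ?thesis
  proof
    assume "cond_indep A {i. i \<le> j \<and> i \<notin> A}"
    then have "{..j} \<subseteq> ?J" using down assms by blast
    from card_mono[OF fin this] show "j < obstacle A" by (simp add: obstacle_def)
  next
    assume "j < obstacle A"
    then have "\<not> ?J \<subseteq> {..<j}"
      using card_mono[of "{..<j}" ?J] by (auto simp: obstacle_def)
    then have "\<exists>j'\<in>?J. j \<le> j'" by (simp add: subset_iff not_less Bex_def)
    then obtain j' where "j' \<in> ?J" "j \<le> j'" ..
    from down[OF this] show "cond_indep A {i. i \<le> j \<and> i \<notin> A}" by simp
  qed
qed

lemma cond_indep_before_obstacle: "cond_indep A {i. i < obstacle A \<and> i \<notin> A}"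
proof (cases "obstacle A")
  case 0
  then show ?thesis by (simp add: cond_indep_empty)
next
  case (Suc j)
  then have "cond_indep A {i. i \<le> j \<and> i \<notin> A}"
    using obstacle_le[of A] cond_indep_iff_less_obstacle[of j A] by auto
  then show ?thesis by (simp add: Suc less_Suc_eq_le)
qed

lemma obstacle_notin:
  assumes "obstacle A < m"
  shows "obstacle A \<notin> A"
proof
  assume "obstacle A \<in> A"
  \<comment> \<open>A row of \<open>A\<close> leaves the prefix unchanged, so independence cannot
    break there.\<close>
  then have "{i. i \<le> obstacle A \<and> i \<notin> A} = {i. i < obstacle A \<and> i \<notin> A}"
    by (auto simp: order_le_less)
  with cond_indep_before_obstacle[of A] cond_indep_iff_less_obstacle[OF assms, of A] show False
    by simp
qed

lemma obstacle_in:
  assumes X: "cond_indep X ({..<m} - X)" and AX: "A \<subseteq> X" and less: "obstacle A < m"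
  shows "obstacle A \<in> X"
proof (rule ccontr)
  assume nX: "obstacle A \<notin> X"
  define P where "P = {i. i < obstacle A \<and> i \<notin> A}"
  define U where "U = P \<inter> X"
  define W where "W = insert (obstacle A) (P - X)"
  have "cond_indep A U"
    using cond_indep_before_obstacle[of A] by (rule cond_indep_mono) (auto simp: U_def P_def)
  moreover have "cond_indep (A \<union> U) W"
    using X by (rule cond_indep_mono) (use AX nX less in \<open>auto simp: U_def W_def P_def\<close>)
  ultimately have "cond_indep A (U \<union> W)" by (rule cond_indep_contraction[rotated])
  moreover have "U \<union> W = {i. i \<le> obstacle A \<and> i \<notin> A}"
    using nX AX by (auto simp: U_def W_def P_def)
  ultimately show False using cond_indep_iff_less_obstacle[OF less, of A] by simp
qed

lemma grow_subset:
  assumes "cond_indep X ({..<m} - X)" and "A \<subseteq> X"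
  shows "grow A \<subseteq> X"
  using obstacle_in[OF assms] assms(2) by (auto simp: grow_def)

lemma cond_indep_if_obstacle_eq:
  assumes "obstacle A = m"
  shows "cond_indep A ({..<m} - A)"
proof -
  have "{..<m} - A = {i. i < m \<and> i \<notin> A}" by auto
  with cond_indep_before_obstacle[of A] assms show ?thesis by simp
qed

lemma grow_iterate_subset:
  assumes "cond_indep X ({..<m} - X)" and "A \<subseteq> X"
  shows "(grow ^^ t) A \<subseteq> X"
  using assms by (induction t) (auto dest: grow_subset)

text \<open>Every step with an obstacle below \<open>m\<close> adds a new row, so \<open>m\<close>
  such steps from a nonempty set would give more than \<open>m\<close> rows.\<close>

lemma grow_iterate_obstacle:
  assumes A: "A \<subseteq> {..<m}" "A \<noteq> {}"
  shows "obstacle ((grow ^^ m) A) = m"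
proof (rule ccontr)
  assume contra: "obstacle ((grow ^^ m) A) \<noteq> m"
  have sub: "(grow ^^ t) A \<subseteq> {..<m}" for t
    using A by (induction t) (auto simp: grow_def)
  \<comment> \<open>Fixed points persist, so a failure after \<open>m\<close> steps means that no
    earlier step had reached \<open>m\<close>.\<close>
  have fixed: "obstacle ((grow ^^ (t + u)) A) = m" if "obstacle ((grow ^^ t) A) = m" for t u
  proof (induction u)
    case (Suc u)
    then have "grow ((grow ^^ (t + u)) A) = (grow ^^ (t + u)) A"
      by (subst grow_def) auto
    with Suc show ?case by simp
  qed (use that in simp)
  have "t + 1 \<le> card ((grow ^^ t) A)" if "t \<le> m" for t
    using that
  proof (induction t)
    case 0
    have "finite A" using A finite_subset by blast
    with A show ?case by (simp add: Suc_le_eq card_gt_0_iff)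
  next
    case (Suc t)
    let ?B = "(grow ^^ t) A"
    have "obstacle ?B \<noteq> m"
      using fixed[of t "m - t"] contra Suc.prems by auto
    with obstacle_le[of ?B] have "obstacle ?B < m" by simp
    with obstacle_notin[OF this] have "card (grow ?B) = Suc (card ?B)"
      using finite_subset[OF sub[of t]] by (simp add: grow_def)
    with Suc show ?case by simp
  qed
  from this[of m] have "m + 1 \<le> card ((grow ^^ m) A)" by simp
  moreover have "card ((grow ^^ m) A) \<le> m" using card_mono[OF _ sub[of m]] by simp
  ultimately show False by simp
qed

lemma grow_iterate_cond_indep:
  assumes "A \<subseteq> {..<m}" "A \<noteq> {}"
  shows "cond_indep ((grow ^^ m) A) ({..<m} - (grow ^^ m) A)"
  using cond_indep_if_obstacle_eq grow_iterate_obstacle[OF assms] by blast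

end

section \<open>Columns of a 2-product\<close>

text \<open>Inverse of the library function \<open>pick\<close> on \<open>I\<close>: the index that
  a row or column of \<open>I\<close> receives in \<open>submatrix\<close>.\<close>

definition rank :: "nat set \<Rightarrow> nat \<Rightarrow> nat" where
  "rank I i = card {a \<in> I. a < i}"

lemma pick_rank: "i \<in> I \<Longrightarrow> pick I (rank I i) = i"
  by (simp add: rank_def pick_card_in_set)

text \<open>Injectivity comes from \<open>pick\<close> as left inverse, surjectivity from equal
  cardinalities. The bound \<open>N\<close> is there because \<open>I\<close> may be infinite, like
  the set \<open>- {x}\<close> in \<open>special_part\<close>.\<close>

lemma bij_betw_rank:
  "bij_betw (rank I) {i. i < N \<and> i \<in> I} {..<card {i. i < N \<and> i \<in> I}}"
proof -
  let ?I = "{i. i < N \<and> i \<in> I}"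
  have inj: "inj_on (rank I) ?I"
    by (rule inj_on_inverseI[of _ "pick I"]) (simp add: pick_rank)
  have "rank I i < card ?I" if "i \<in> ?I" for i
    unfolding rank_def using that by (intro psubset_card_mono) auto
  then have "rank I ` ?I \<subseteq> {..<card ?I}" by auto
  moreover have "card (rank I ` ?I) = card {..<card ?I}" using inj by (simp add: card_image)
  ultimately have "rank I ` ?I = {..<card ?I}" by (intro card_subset_eq) auto
  with inj show ?thesis by (simp add: bij_betw_def)
qed

lemma bij_betw_pick:
  "bij_betw (pick I) {..<card {i. i < N \<and> i \<in> I}} {i. i < N \<and> i \<in> I}"
proof (rule bij_betw_byWitness[where f' = "rank I"])
  note bij = bij_betw_rank[of I N]
  have *: "\<exists>i. i < N \<and> i \<in> I \<and> rank I i = t" if "t < card {i. i < N \<and> i \<in> I}" for t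
  proof -
    from that have "t \<in> rank I ` {i. i < N \<and> i \<in> I}" using bij by (simp add: bij_betw_def)
    then show ?thesis by blast
  qed
  show "\<forall>a\<in>{..<card {i. i < N \<and> i \<in> I}}. rank I (pick I a) = a"
    using * pick_rank by fastforce
  show "\<forall>a'\<in>{i. i < N \<and> i \<in> I}. pick I (rank I a') = a'"
    using pick_rank by auto
  show "pick I ` {..<card {i. i < N \<and> i \<in> I}} \<subseteq> {i. i < N \<and> i \<in> I}"
    using * pick_rank by fastforce
  show "rank I ` {i. i < N \<and> i \<in> I} \<subseteq> {..<card {i. i < N \<and> i \<in> I}}"
    using bij by (auto simp: bij_betw_def)
qed

lemma card_rows_except: "x < d \<Longrightarrow> card {i. i < d \<and> i \<in> - {x}} = d - 1"
proof -
  assume "x < d"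
  moreover have "{i. i < d \<and> i \<in> - {x}} = {..<d} - {x}" by auto
  ultimately show ?thesis by (simp only:) (subst card_Diff_singleton; simp)
qed

lemma bij_betw_div_mod:
  "bij_betw (\<lambda>j. (j div b, j mod b)) {..<a * b} ({..<a} \<times> {..<b :: nat})"
proof (rule bij_betw_byWitness[where f' = "\<lambda>(u, v). u * b + v"])
  show "(\<lambda>j. (j div b, j mod b)) ` {..<a * b} \<subseteq> {..<a} \<times> {..<b}"
    by (auto simp: less_mult_imp_div_less) (metis gr0I less_nat_zero_code mod_less_divisor mult_0_right)
  show "(\<lambda>(u, v). u * b + v) ` ({..<a} \<times> {..<b}) \<subseteq> {..<a * b}"
  proof clarsimp
    fix u v assume "u < a" "v < b"
    then have "u * b + v < Suc u * b" by simp
    also have "\<dots> \<le> a * b" using \<open>u < a\<close> by (intro mult_le_mono1) simp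
    finally show "u * b + v < a * b" .
  qed
qed auto

text \<open>The columns of a 2-product up to order: the fibre product of the two column sets over
  the special entry.\<close>

definition matching_columns :: "real mat \<Rightarrow> nat \<Rightarrow> real mat \<Rightarrow> nat \<Rightarrow> (nat \<times> nat) set" where
  "matching_columns S1 x1 S2 y1 =
     {(u, v). u < dim_col S1 \<and> v < dim_col S2 \<and> S1 $$ (x1, u) = S2 $$ (y1, v)}"

lemma dim_special_part:
  assumes "x < dim_row S"
  shows "dim_row (special_part S x a) = dim_row S - 1"
    and "dim_col (special_part S x a) = card {j. j < dim_col S \<and> S $$ (x, j) = a}"
  using card_rows_except[OF assms] by (simp_all add: special_part_def dim_submatrix)

lemma index_special_part:
  assumes "x < dim_row S" "i < dim_row S - 1" "j < card {j. j < dim_col S \<and> S $$ (x, j) = a}"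
  shows "special_part S x a $$ (i, j) =
    S $$ (pick (- {x}) i, pick {j. j < dim_col S \<and> S $$ (x, j) = a} j)"
  unfolding special_part_def
  by (rule submatrix_index) (use assms card_rows_except[OF assms(1)] in simp_all)

lemma bij_betw_product_columns:
  fixes S1 S2 :: "real mat" and x1 y1 :: nat
  defines "J1 \<equiv> \<lambda>a. {j. j < dim_col S1 \<and> S1 $$ (x1, j) = a}"
    and "J2 \<equiv> \<lambda>a. {j. j < dim_col S2 \<and> S2 $$ (y1, j) = a}"
  shows "bij_betw (\<lambda>j. (pick (J1 a) (j div card (J2 a)), pick (J2 a) (j mod card (J2 a))))
           {..<card (J1 a) * card (J2 a)} (J1 a \<times> J2 a)"
proof -
  have "bij_betw (pick (J1 a)) {..<card (J1 a)} (J1 a)" "bij_betw (pick (J2 a)) {..<card (J2 a)} (J2 a)"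
    using bij_betw_pick[of "J1 a" "dim_col S1"] bij_betw_pick[of "J2 a" "dim_col S2"]
    by (simp_all add: J1_def J2_def)
  then have "bij_betw (map_prod (pick (J1 a)) (pick (J2 a))) ({..<card (J1 a)} \<times> {..<card (J2 a)}) (J1 a \<times> J2 a)"
    by (rule bij_betw_map_prod)
  from bij_betw_trans[OF bij_betw_div_mod this] show ?thesis by (simp add: o_def)
qed

text \<open>Interface that hides \<open>submatrix\<close>, \<open>one_product\<close> and the block
  matrix: from here on a 2-product is a bijection \<phi> onto matching pairs together with three
  groups of rows.\<close>

lemma two_product_layout:
  assumes x1: "special_row S1 x1" and y1: "special_row S2 y1"
  defines "P \<equiv> two_product S1 x1 S2 y1"
    and "R1 \<equiv> dim_row S1 - 1" and "R2 \<equiv> dim_row S2 - 1"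
  shows "dim_row P = R1 + R2 + 1"
    and "\<exists>\<phi>. bij_betw \<phi> {..<dim_col P} (matching_columns S1 x1 S2 y1)
          \<and> (\<forall>j<dim_col P. (\<forall>i<R1. P $$ (i, j) = S1 $$ (pick (- {x1}) i, fst (\<phi> j)))
               \<and> (\<forall>i<R2. P $$ (R1 + i, j) = S2 $$ (pick (- {y1}) i, snd (\<phi> j)))
               \<and> P $$ (R1 + R2, j) = S1 $$ (x1, fst (\<phi> j)))"
proof -
  have lt: "x1 < dim_row S1" "y1 < dim_row S2" using x1 y1 by (auto simp: special_row_def)
  define J1 where "J1 = (\<lambda>a. {j. j < dim_col S1 \<and> S1 $$ (x1, j) = a})"
  define J2 where "J2 = (\<lambda>a. {j. j < dim_col S2 \<and> S2 $$ (y1, j) = a})"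
  define N where "N = (\<lambda>a. card (J1 a) * card (J2 a))"
  define \<phi>' where "\<phi>' = (\<lambda>a j. (pick (J1 a) (j div card (J2 a)), pick (J2 a) (j mod card (J2 a))))"
  define \<phi> where "\<phi> = (\<lambda>j. if j < N 0 then \<phi>' 0 j else \<phi>' 1 (j - N 0))"
  define Q where "Q = (\<lambda>a. one_product (special_part S1 x1 a) (special_part S2 y1 a))"
  have dimQ: "dim_row (Q a) = R1 + R2" "dim_col (Q a) = N a" for a
    by (simp_all add: Q_def one_product_def dim_special_part lt R1_def R2_def N_def J1_def J2_def)
  have P: "P = four_block_mat (Q 0) (Q 1) (mat 1 (N 0) (\<lambda>_. 0)) (mat 1 (N 1) (\<lambda>_. 1))"
    by (simp add: P_def two_product_def Let_def dimQ(2)[symmetric]) (simp add: Q_def)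
  show dimP: "dim_row P = R1 + R2 + 1" by (simp add: P dimQ)
  have dimP': "dim_col P = N 0 + N 1" by (simp add: P dimQ)
  have bij': "bij_betw (\<phi>' a) {..<N a} (J1 a \<times> J2 a)" for a
    using bij_betw_product_columns[of S1 x1 a S2 y1] by (simp add: \<phi>'_def N_def J1_def J2_def)
  have "bij_betw \<phi> ({..<N 0} \<union> {N 0..<N 0 + N 1}) (J1 0 \<times> J2 0 \<union> J1 1 \<times> J2 1)"
  proof (rule bij_betw_combine)
    show "bij_betw \<phi> {..<N 0} (J1 0 \<times> J2 0)"
      using bij' by (subst bij_betw_cong[of _ _ "\<phi>' 0"]) (auto simp: \<phi>_def)
    have "bij_betw (\<lambda>j. j - N 0) {N 0..<N 0 + N 1} {..<N 1}"
      by (rule bij_betw_byWitness[where f' = "\<lambda>j. j + N 0"]) auto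
    from bij_betw_trans[OF this bij'] show "bij_betw \<phi> {N 0..<N 0 + N 1} (J1 1 \<times> J2 1)"
      by (subst bij_betw_cong[of _ _ "\<phi>' 1 \<circ> (\<lambda>j. j - N 0)"]) (auto simp: \<phi>_def)
    show "J1 0 \<times> J2 0 \<inter> J1 1 \<times> J2 1 = {}" by (auto simp: J1_def)
  qed
  moreover have "{..<N 0} \<union> {N 0..<N 0 + N 1} = {..<dim_col P}" by (auto simp: dimP')
  \<comment> \<open>Special entries are only 0 and 1, so the two blocks exhaust all matching
    pairs.\<close>
  moreover have "J1 0 \<times> J2 0 \<union> J1 1 \<times> J2 1 = matching_columns S1 x1 S2 y1"
    using x1 y1 by (auto simp: J1_def J2_def matching_columns_def special_row_def)
  ultimately have bij: "bij_betw \<phi> {..<dim_col P} (matching_columns S1 x1 S2 y1)" by simp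
  have Q_entry: "Q a $$ (i, j) = S1 $$ (pick (- {x1}) i, fst (\<phi>' a j))" if "i < R1" "j < N a" for a i j
  proof -
    have "j div card (J2 a) < card (J1 a)"
      using that(2) by (simp add: N_def less_mult_imp_div_less)
    then show ?thesis
      using that index_special_part[of x1 S1 i "j div card (J2 a)" a]
      by (simp add: Q_def one_product_def dim_special_part lt R1_def J1_def J2_def N_def \<phi>'_def)
  qed
  have Q_entry': "Q a $$ (R1 + i, j) = S2 $$ (pick (- {y1}) i, snd (\<phi>' a j))" if "i < R2" "j < N a" for a i j
  proof -
    have "j mod card (J2 a) < card (J2 a)"
      using that(2) by (intro mod_less_divisor) (auto simp: N_def intro!: Nat.gr0I)
    then show ?thesis
      using that index_special_part[of y1 S2 i "j mod card (J2 a)" a]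
      by (simp add: Q_def one_product_def dim_special_part lt R1_def R2_def J1_def J2_def N_def \<phi>'_def)
  qed
  have "(\<forall>i<R1. P $$ (i, j) = S1 $$ (pick (- {x1}) i, fst (\<phi> j)))
       \<and> (\<forall>i<R2. P $$ (R1 + i, j) = S2 $$ (pick (- {y1}) i, snd (\<phi> j)))
       \<and> P $$ (R1 + R2, j) = S1 $$ (x1, fst (\<phi> j))" if j: "j < dim_col P" for j
  proof (intro conjI allI impI)
    fix i assume "i < R1"
    then show "P $$ (i, j) = S1 $$ (pick (- {x1}) i, fst (\<phi> j))"
      using j dimP' by (auto simp: P dimQ \<phi>_def Q_entry)
  next
    fix i assume "i < R2"
    then show "P $$ (R1 + i, j) = S2 $$ (pick (- {y1}) i, snd (\<phi> j))"
      using j dimP' by (auto simp: P dimQ \<phi>_def Q_entry')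
  next
    \<comment> \<open>The constants 0 and 1 in the last row are the special entries of the columns
      used in the respective block.\<close>
    have "fst (\<phi> j) \<in> J1 (if j < N 0 then 0 else 1)"
    proof (cases "j < N 0")
      case True
      then have "\<phi>' 0 j \<in> J1 0 \<times> J2 0" using bij_betwE[OF bij'[of 0]] by simp
      with True show ?thesis by (simp add: \<phi>_def mem_Times_iff)
    next
      case False
      then have "j - N 0 \<in> {..<N 1}" using j dimP' by auto
      then have "\<phi>' 1 (j - N 0) \<in> J1 1 \<times> J2 1" using bij_betwE[OF bij'[of 1]] by simp
      with False show ?thesis by (simp add: \<phi>_def mem_Times_iff)
    qed
    then show "P $$ (R1 + R2, j) = S1 $$ (x1, fst (\<phi> j))"
      using j dimP' by (auto simp: P dimQ J1_def split: if_splits)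
  qed
  with bij show "\<exists>\<phi>. bij_betw \<phi> {..<dim_col P} (matching_columns S1 x1 S2 y1)
          \<and> (\<forall>j<dim_col P. (\<forall>i<R1. P $$ (i, j) = S1 $$ (pick (- {x1}) i, fst (\<phi> j)))
               \<and> (\<forall>i<R2. P $$ (R1 + i, j) = S2 $$ (pick (- {y1}) i, snd (\<phi> j)))
               \<and> P $$ (R1 + R2, j) = S1 $$ (x1, fst (\<phi> j)))" by blast
qed

text \<open>The row \<open>r\<close> of \<open>S\<close> corresponds to both special rows.\<close>

lemma isomorphic_two_productE:
  assumes x1: "special_row S1 x1" and y1: "special_row S2 y1"
    and iso: "isomorphic_mat S (two_product S1 x1 S2 y1)"
  obtains r A B \<alpha> \<beta> \<psi> where "A \<inter> B = {}" "r \<notin> A \<union> B" "insert r (A \<union> B) = {..<dim_row S}"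
    "bij_betw \<alpha> A ({..<dim_row S1} - {x1})" "bij_betw \<beta> B ({..<dim_row S2} - {y1})"
    "bij_betw \<psi> {..<dim_col S} (matching_columns S1 x1 S2 y1)"
    "\<And>i j. i \<in> A \<Longrightarrow> j < dim_col S \<Longrightarrow> S $$ (i, j) = S1 $$ (\<alpha> i, fst (\<psi> j))"
    "\<And>i j. i \<in> B \<Longrightarrow> j < dim_col S \<Longrightarrow> S $$ (i, j) = S2 $$ (\<beta> i, snd (\<psi> j))"
    "\<And>j. j < dim_col S \<Longrightarrow> S $$ (r, j) = S1 $$ (x1, fst (\<psi> j))"
proof -
  define P where "P = two_product S1 x1 S2 y1"
  define R1 where "R1 = dim_row S1 - 1"
  define R2 where "R2 = dim_row S2 - 1"
  have lt: "x1 < dim_row S1" "y1 < dim_row S2" using x1 y1 by (auto simp: special_row_def)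
  have dimP: "dim_row P = R1 + R2 + 1"
    unfolding P_def R1_def R2_def by (rule two_product_layout[OF x1 y1])
  obtain \<phi> where \<phi>: "bij_betw \<phi> {..<dim_col P} (matching_columns S1 x1 S2 y1)"
    and P1: "\<And>i j. j < dim_col P \<Longrightarrow> i < R1 \<Longrightarrow> P $$ (i, j) = S1 $$ (pick (- {x1}) i, fst (\<phi> j))"
    and P2: "\<And>i j. j < dim_col P \<Longrightarrow> i < R2 \<Longrightarrow> P $$ (R1 + i, j) = S2 $$ (pick (- {y1}) i, snd (\<phi> j))"
    and P3: "\<And>j. j < dim_col P \<Longrightarrow> P $$ (R1 + R2, j) = S1 $$ (x1, fst (\<phi> j))"
    using two_product_layout(2)[OF x1 y1] unfolding P_def R1_def R2_def by blast
  from iso obtain p q where p: "p permutes {..<dim_row P}" and q: "q permutes {..<dim_col P}"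
    and S: "S = mat (dim_row P) (dim_col P) (\<lambda>(i, j). P $$ (p i, q j))"
    unfolding isomorphic_mat_def P_def by blast
  have dimS: "dim_row S = R1 + R2 + 1" "dim_col S = dim_col P" by (simp_all add: S dimP)
  have p_bij: "bij_betw p {..<dim_row S} {..<R1 + R2 + 1}" and q_bij: "bij_betw q {..<dim_col S} {..<dim_col P}"
    using permutes_imp_bij[OF p] permutes_imp_bij[OF q] by (simp_all add: dimS dimP)
  have q_less: "q j < dim_col P" if "j < dim_col S" for j using q_bij that by (auto simp: bij_betw_def)
  have S_entry: "S $$ (i, j) = P $$ (p i, q j)" if "i < dim_row S" "j < dim_col S" for i j
    using that by (simp add: S)
  define A where "A = {i. i < dim_row S \<and> p i < R1}"
  define B where "B = {i. i < dim_row S \<and> R1 \<le> p i \<and> p i < R1 + R2}"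
  define r where "r = inv_into {..<dim_row S} p (R1 + R2)"
  have R: "R1 + R2 \<in> p ` {..<dim_row S}" using p_bij by (simp add: bij_betw_def)
  have r: "r < dim_row S" "p r = R1 + R2"
    using inv_into_into[OF R] f_inv_into_f[OF R] by (simp_all add: r_def)
  have "i \<in> insert r (A \<union> B)" if "i < dim_row S" for i
  proof -
    have "p i < R1 + R2 + 1" using p_bij that by (auto simp: bij_betw_def)
    moreover have "i = r" if "p i = R1 + R2"
      using p_bij r \<open>i < dim_row S\<close> that by (auto simp: bij_betw_def inj_on_def)
    ultimately show ?thesis using that by (cases "p i = R1 + R2") (auto simp: A_def B_def)
  qed
  then have ABr: "insert r (A \<union> B) = {..<dim_row S}"
    using r(1) by (auto simp: A_def B_def)
  have bij_part: "bij_betw p {i. i < dim_row S \<and> p i \<in> T} T" if "T \<subseteq> {..<R1 + R2 + 1}" for T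
    using p_bij that by (auto simp: bij_betw_def inj_on_def image_iff)
  have pick1: "bij_betw (pick (- {x1})) {..<R1} ({..<dim_row S1} - {x1})"
    using bij_betw_pick[of "- {x1}" "dim_row S1"] card_rows_except[OF lt(1)]
    by (simp add: R1_def set_diff_eq)
  have pick2: "bij_betw (pick (- {y1})) {..<R2} ({..<dim_row S2} - {y1})"
    using bij_betw_pick[of "- {y1}" "dim_row S2"] card_rows_except[OF lt(2)]
    by (simp add: R2_def set_diff_eq)
  have \<alpha>: "bij_betw (pick (- {x1}) \<circ> p) A ({..<dim_row S1} - {x1})"
    using bij_betw_trans[OF bij_part pick1] by (simp add: A_def subset_iff)
  have \<beta>: "bij_betw (pick (- {y1}) \<circ> (\<lambda>i. p i - R1)) B ({..<dim_row S2} - {y1})"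
  proof (rule bij_betw_trans[OF _ pick2])
    have "bij_betw (\<lambda>i. i - R1) {R1..<R1 + R2} {..<R2}"
      by (rule bij_betw_byWitness[where f' = "\<lambda>j. R1 + j"]) auto
    from bij_betw_trans[OF bij_part this] show "bij_betw (\<lambda>i. p i - R1) B {..<R2}"
      by (simp add: B_def o_def subset_iff)
  qed
  have \<psi>: "bij_betw (\<phi> \<circ> q) {..<dim_col S} (matching_columns S1 x1 S2 y1)"
    by (rule bij_betw_trans[OF q_bij \<phi>])
  show thesis
  proof (rule that[OF _ _ ABr \<alpha> \<beta> \<psi>])
    show "A \<inter> B = {}" "r \<notin> A \<union> B" using r by (auto simp: A_def B_def)
    show "S $$ (i, j) = S1 $$ ((pick (- {x1}) \<circ> p) i, fst ((\<phi> \<circ> q) j))" if "i \<in> A" "j < dim_col S" for i j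
      using that P1[OF q_less] by (simp add: A_def S_entry)
    show "S $$ (i, j) = S2 $$ ((pick (- {y1}) \<circ> (\<lambda>i. p i - R1)) i, snd ((\<phi> \<circ> q) j))"
      if "i \<in> B" "j < dim_col S" for i j
      using that P2[OF q_less, of j "p i - R1"] by (simp add: B_def S_entry less_diff_conv2 add.commute)
    show "S $$ (r, j) = S1 $$ (x1, fst ((\<phi> \<circ> q) j))" if "j < dim_col S" for j
      using that P3[OF q_less] r by (simp add: S_entry)
  qed
qed

text \<open>The bijections force \<open>S\<close> and the 2-product to have equal dimensions, and
  they determine both permutations.\<close>

lemma isomorphic_two_productI:
  assumes x1: "special_row S1 x1" and y1: "special_row S2 y1"
    and AB: "A \<inter> B = {}" "r \<notin> A \<union> B" "insert r (A \<union> B) = {..<dim_row S}"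
    and \<alpha>: "bij_betw \<alpha> A ({..<dim_row S1} - {x1})" and \<beta>: "bij_betw \<beta> B ({..<dim_row S2} - {y1})"
    and \<psi>: "bij_betw \<psi> {..<dim_col S} (matching_columns S1 x1 S2 y1)"
    and SA: "\<And>i j. i \<in> A \<Longrightarrow> j < dim_col S \<Longrightarrow> S $$ (i, j) = S1 $$ (\<alpha> i, fst (\<psi> j))"
    and SB: "\<And>i j. i \<in> B \<Longrightarrow> j < dim_col S \<Longrightarrow> S $$ (i, j) = S2 $$ (\<beta> i, snd (\<psi> j))"
    and Sr: "\<And>j. j < dim_col S \<Longrightarrow> S $$ (r, j) = S1 $$ (x1, fst (\<psi> j))"
  shows "isomorphic_mat S (two_product S1 x1 S2 y1)"
proof -
  define P where "P = two_product S1 x1 S2 y1"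
  define R1 where "R1 = dim_row S1 - 1"
  define R2 where "R2 = dim_row S2 - 1"
  have lt: "x1 < dim_row S1" "y1 < dim_row S2" using x1 y1 by (auto simp: special_row_def)
  have dimP: "dim_row P = R1 + R2 + 1"
    unfolding P_def R1_def R2_def by (rule two_product_layout[OF x1 y1])
  obtain \<phi> where \<phi>: "bij_betw \<phi> {..<dim_col P} (matching_columns S1 x1 S2 y1)"
    and P1: "\<And>i j. j < dim_col P \<Longrightarrow> i < R1 \<Longrightarrow> P $$ (i, j) = S1 $$ (pick (- {x1}) i, fst (\<phi> j))"
    and P2: "\<And>i j. j < dim_col P \<Longrightarrow> i < R2 \<Longrightarrow> P $$ (R1 + i, j) = S2 $$ (pick (- {y1}) i, snd (\<phi> j))"
    and P3: "\<And>j. j < dim_col P \<Longrightarrow> P $$ (R1 + R2, j) = S1 $$ (x1, fst (\<phi> j))"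
    using two_product_layout(2)[OF x1 y1] unfolding P_def R1_def R2_def by blast
  have rank1: "bij_betw (rank (- {x1})) ({..<dim_row S1} - {x1}) {..<R1}"
    using bij_betw_rank[of "- {x1}" "dim_row S1"] card_rows_except[OF lt(1)]
    by (simp add: R1_def set_diff_eq)
  have rank2: "bij_betw (rank (- {y1})) ({..<dim_row S2} - {y1}) {..<R2}"
    using bij_betw_rank[of "- {y1}" "dim_row S2"] card_rows_except[OF lt(2)]
    by (simp add: R2_def set_diff_eq)
  \<comment> \<open>\<open>permutes\<close> requires the identity outside the index range, hence the
    last branch here and in \<open>q\<close>.\<close>
  define p where "p = (\<lambda>i. if i \<in> A then rank (- {x1}) (\<alpha> i)
    else if i \<in> B then R1 + rank (- {y1}) (\<beta> i) else if i = r then R1 + R2 else i)"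
  define q where "q = (\<lambda>j. if j < dim_col S then inv_into {..<dim_col P} \<phi> (\<psi> j) else j)"
  have pA: "bij_betw p A {..<R1}"
    using bij_betw_trans[OF \<alpha> rank1] by (subst bij_betw_cong[of _ _ "rank (- {x1}) \<circ> \<alpha>"]) (auto simp: p_def)
  have "bij_betw (\<lambda>j. R1 + j) {..<R2} {R1..<R1 + R2}"
    by (rule bij_betw_byWitness[where f' = "\<lambda>j. j - R1"]) auto
  from bij_betw_trans[OF bij_betw_trans[OF \<beta> rank2] this] have pB: "bij_betw p B {R1..<R1 + R2}"
    using AB(1) by (subst bij_betw_cong[of _ _ "(\<lambda>j. R1 + j) \<circ> (rank (- {y1}) \<circ> \<beta>)"]) (auto simp: p_def)
  have pr: "bij_betw p {r} {R1 + R2}" using AB(2) by (simp add: p_def bij_betw_def)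
  have "bij_betw p (A \<union> B \<union> {r}) ({..<R1} \<union> {R1..<R1 + R2} \<union> {R1 + R2})"
    by (intro bij_betw_combine pA pB pr) auto
  moreover have "A \<union> B \<union> {r} = {..<dim_row S}" using AB(3) by auto
  moreover have "{..<R1} \<union> {R1..<R1 + R2} \<union> {R1 + R2} = {..<dim_row P}" by (auto simp: dimP)
  ultimately have p_bij: "bij_betw p {..<dim_row S} {..<dim_row P}" by simp
  have dim_row: "dim_row S = dim_row P" using bij_betw_same_card[OF p_bij] by simp
  have p: "p permutes {..<dim_row P}"
  proof (rule bij_imp_permutes)
    show "bij_betw p {..<dim_row P} {..<dim_row P}" using p_bij dim_row by simp
    show "p i = i" if "i \<notin> {..<dim_row P}" for i
      using that AB(3) dim_row by (auto simp: p_def)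
  qed
  have "bij_betw (inv_into {..<dim_col P} \<phi> \<circ> \<psi>) {..<dim_col S} {..<dim_col P}"
    by (rule bij_betw_trans[OF \<psi> bij_betw_inv_into[OF \<phi>]])
  then have q_bij: "bij_betw q {..<dim_col S} {..<dim_col P}"
    by (subst bij_betw_cong[of _ _ "inv_into {..<dim_col P} \<phi> \<circ> \<psi>"]) (auto simp: q_def)
  have dim_col: "dim_col S = dim_col P" using bij_betw_same_card[OF q_bij] by simp
  have q: "q permutes {..<dim_col P}"
    by (rule bij_imp_permutes) (use q_bij dim_col in \<open>auto simp: q_def\<close>)
  have \<phi>q: "\<phi> (q j) = \<psi> j" "q j < dim_col P" if "j < dim_col S" for j
  proof -
    have "\<psi> j \<in> \<phi> ` {..<dim_col P}" using \<psi> \<phi> that by (auto simp: bij_betw_def)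
    then show "\<phi> (q j) = \<psi> j" using that by (simp add: q_def f_inv_into_f)
    show "q j < dim_col P" using q_bij that by (auto simp: bij_betw_def)
  qed
  have "S = mat (dim_row P) (dim_col P) (\<lambda>(i, j). P $$ (p i, q j))"
  proof (rule eq_matI; clarsimp simp: dim_row dim_col)
    fix i j assume "i < dim_row P" and j: "j < dim_col P"
    then have "i \<in> A \<or> i \<in> B \<or> i = r" using AB(3) dim_row by auto
    moreover have "S $$ (i, j) = P $$ (p i, q j)" if "i \<in> A"
    proof -
      have "\<alpha> i \<in> {..<dim_row S1} - {x1}" using that \<alpha> by (auto simp: bij_betw_def)
      moreover from this have "rank (- {x1}) (\<alpha> i) < R1" using rank1 by (auto simp: bij_betw_def)
      ultimately show ?thesis using that j P1[of "q j" "p i"] \<phi>q[of j] SA[of i j]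
        by (simp add: dim_col p_def pick_rank)
    qed
    moreover have "S $$ (i, j) = P $$ (p i, q j)" if "i \<in> B"
    proof -
      have "\<beta> i \<in> {..<dim_row S2} - {y1}" using that \<beta> by (auto simp: bij_betw_def)
      moreover from this have "rank (- {y1}) (\<beta> i) < R2" using rank2 by (auto simp: bij_betw_def)
      moreover have "i \<notin> A" using that AB(1) by auto
      ultimately show ?thesis
        using that j P2[of "q j" "rank (- {y1}) (\<beta> i)"] \<phi>q[of j] SB[of i j]
        by (simp add: dim_col p_def pick_rank)
    qed
    moreover have "S $$ (r, j) = P $$ (p r, q j)"
      using AB(2) j P3[of "q j"] \<phi>q[of j] Sr[of j] by (simp add: dim_col p_def)
    ultimately show "S $$ (i, j) = P $$ (p i, q j)" by blast
  qed
  with p q show ?thesis unfolding isomorphic_mat_def P_def by blast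
qed

section \<open>Splittings and 2-products\<close>

text \<open>Bijections between fibres of equal label glue together, since the fibres partition
  \<open>X\<close> and \<open>Y\<close>. This turns equal counts into a matching of columns.\<close>

lemma bij_betw_matching_fibres:
  fixes f :: "'a \<Rightarrow> 'c" and g :: "'b \<Rightarrow> 'c"
  assumes "finite X" "finite Y" and card: "\<And>t. card {x \<in> X. f x = t} = card {y \<in> Y. g y = t}"
  obtains h where "bij_betw h X Y" "\<And>x. x \<in> X \<Longrightarrow> g (h x) = f x"
proof -
  have "\<exists>h. bij_betw h {x \<in> X. f x = t} {y \<in> Y. g y = t}" for t
    using assms by (intro finite_same_card_bij) auto
  then obtain h where h: "\<And>t. bij_betw (h t) {x \<in> X. f x = t} {y \<in> Y. g y = t}" by metis
  have h_in: "h (f x) x \<in> Y" "g (h (f x) x) = f x" if "x \<in> X" for x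
    using bij_betwE[OF h[of "f x"]] that by auto
  have "bij_betw (\<lambda>x. h (f x) x) X Y"
    unfolding bij_betw_def
  proof (intro conjI inj_onI equalityI subsetI)
    fix x x' assume x: "x \<in> X" "x' \<in> X" "h (f x) x = h (f x') x'"
    then have "f x = f x'" using h_in by metis
    with x show "x = x'" using bij_betw_imp_inj_on[OF h[of "f x"]] by (auto simp: inj_on_def)
  next
    fix y assume "y \<in> Y"
    then have "y \<in> h (g y) ` {x \<in> X. f x = g y}"
      using bij_betw_imp_surj_on[OF h[of "g y"]] by auto
    then obtain x where "x \<in> X" "y = h (f x) x" by auto
    then show "y \<in> (\<lambda>x. h (f x) x) ` X" by blast
  qed (use h_in in auto)
  with h_in show thesis by (intro that) auto
qed

text \<open>\<open>rank T\<close> numbers \<open>T\<close> from 0 to \<open>card T - 1\<close>, and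
  every \<open>d\<close>-th of these positions is taken, starting with 0.\<close>

lemma card_multiples_rank:
  assumes "finite T" "0 < d" "d dvd card T"
  shows "card {k \<in> T. d dvd rank T k} = card T div d"
proof -
  obtain N where "T \<subseteq> {..<N}" using assms(1) unfolding finite_nat_set_iff_bounded by auto
  then have "{i. i < N \<and> i \<in> T} = T" by auto
  then have bij: "bij_betw (rank T) T {..<card T}" using bij_betw_rank[of T N] by simp
  obtain q where q: "card T = q * d" using assms(3) by (metis dvdE mult.commute)
  have "rank T ` {k \<in> T. d dvd rank T k} = {t \<in> rank T ` T. d dvd t}" by auto
  also have "\<dots> = {t \<in> {..<q * d}. d dvd t}" using bij q by (simp add: bij_betw_def)
  also have "\<dots> = (\<lambda>s. s * d) ` {..<q}" using assms(2) by (auto elim!: dvdE)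
  finally have "card (rank T ` {k \<in> T. d dvd rank T k}) = card ((\<lambda>s. s * d) ` {..<q})" by simp
  moreover have "inj_on (rank T) {k \<in> T. d dvd rank T k}"
    by (rule inj_on_subset[OF bij_betw_imp_inj_on[OF bij]]) auto
  moreover have "inj_on (\<lambda>s. s * d) {..<q}" using assms(2) by (auto simp: inj_on_def)
  ultimately show ?thesis using assms(2) by (simp add: card_image q)
qed

section \<open>Column multiplicities of the two factors\<close>

context nat_table
begin

text \<open>For a fixed value of row \<open>r\<close>, the matrix of the numbers \<open>card (cls X k \<inter> cls Y l)\<close> has rank one. Dividing
  its row sums by their gcd gives the multiplicities of the columns of the first factor, and dividing its
  column sums by the sum of these gives those of the second factor. To reach these multiplicities, a
  column is kept iff its position within its class is a multiple of the divisor.\<close>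

definition common_mult :: "nat set \<Rightarrow> nat \<Rightarrow> nat" where
  "common_mult X k = Gcd ((\<lambda>c. card (cls X c)) ` cls {} k)"

definition keep :: "(nat \<Rightarrow> nat) \<Rightarrow> nat set \<Rightarrow> nat set" where
  "keep d X = {k. k < n \<and> d k dvd rank (cls X k) k}"

definition kept_size :: "nat set \<Rightarrow> nat \<Rightarrow> nat" where
  "kept_size X k = card (keep (common_mult X) X \<inter> cls {} k)"

text \<open>As \<open>d\<close> is constant on the class, \<open>keep\<close> thins the class out by
  exactly that factor.\<close>

lemma card_keep_cls:
  assumes k: "k < n" and d: "\<And>c. c \<in> cls X k \<Longrightarrow> d c = d k" "0 < d k" "d k dvd card (cls X k)"
  shows "card (keep d X \<inter> cls X k) * d k = card (cls X k)"
proof -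
  have "keep d X \<inter> cls X k = {c \<in> cls X k. d k dvd rank (cls X k) c}"
    using d(1) cls_eq[of _ X k] cls_subset[of X k] by (auto simp: keep_def)
  then show ?thesis using card_multiples_rank[OF _ d(2,3)] d(3) by simp
qed

lemma common_mult_cong: "c \<in> cls {} k \<Longrightarrow> common_mult X c = common_mult X k"
  by (simp add: common_mult_def cls_eq)

lemma kept_size_cong: "c \<in> cls {} k \<Longrightarrow> kept_size X c = kept_size X k"
  by (simp add: kept_size_def cls_eq)

lemma common_mult_dvd: "c \<in> cls {} k \<Longrightarrow> common_mult X k dvd card (cls X c)"
  unfolding common_mult_def by (rule Gcd_dvd) simp

lemma common_mult_pos:
  assumes "k < n"
  shows "0 < common_mult X k"
proof -
  have "common_mult X k dvd card (cls X k)" using assms by (intro common_mult_dvd cls_self) simp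
  moreover have "0 < card (cls X k)" using assms by (intro card_cls_pos) simp
  ultimately show ?thesis by (metis dvd_0_left_iff gr0I less_irrefl)
qed

lemma card_keep_common_mult:
  assumes "k < n"
  shows "card (keep (common_mult X) X \<inter> cls X k) * common_mult X k = card (cls X k)"
  using assms cls_mono[of "{}" X k] common_mult_cong common_mult_pos common_mult_dvd[OF cls_self]
  by (intro card_keep_cls) auto

text \<open>Each \<open>X\<close>-class inside \<open>cls {} k\<close> shrinks by the same factor,
  hence so does their union.\<close>

lemma kept_size_mult:
  assumes "k < n"
  shows "kept_size X k * common_mult X k = card (cls {} k)"
proof -
  have "card (keep (common_mult X) X \<inter> E) * common_mult X k = card E" if "E \<in> cls X ` cls {} k" for E
  proof -
    from that obtain c where c: "c \<in> cls {} k" "E = cls X c" by auto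
    with card_keep_common_mult[of c X] common_mult_cong[OF c(1)] cls_subset[of "{}" k]
    show ?thesis by auto
  qed
  then have "(\<Sum>E\<in>cls X ` cls {} k. card (E \<inter> keep (common_mult X) X) * common_mult X k)
      = (\<Sum>E\<in>cls X ` cls {} k. card E)"
    by (intro sum.cong refl) (simp add: inf_commute)
  then show ?thesis
    using card_cls_partition[of "{}" X k "keep (common_mult X) X"] card_cls_partition[of "{}" X k UNIV]
    by (simp add: kept_size_def sum_distrib_right inf_commute)
qed

lemma kept_size_pos: "k < n \<Longrightarrow> 0 < kept_size X k"
  using kept_size_mult[of k X] card_cls_pos[of k "{}"] by (metis lessThan_iff mult_is_0 neq0_conv)

text \<open>Integrality of the second factor. Independence makes \<open>card (cls {} k)\<close>
  divide the product of \<open>card (cls Y k)\<close> with every \<open>card (cls X c)\<close>,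
  hence with their gcd; by \<open>kept_size_mult\<close> the gcd cancels.\<close>

lemma kept_size_dvd:
  assumes ind: "cond_indep X Y" and k: "k < n"
  shows "kept_size X k dvd card (cls Y k)"
proof -
  have "card (cls {} k) dvd x" if x: "x \<in> (*) (card (cls Y k)) ` (\<lambda>c. card (cls X c)) ` cls {} k" for x
  proof -
    from x obtain c where c: "c \<in> cls {} k" "x = card (cls X c) * card (cls Y k)"
      by (auto simp: mult.commute)
    have "cls {} c = cls {} k" "c \<in> {..<n}" "k \<in> cls {} c"
      using c(1) cls_eq cls_subset k cls_self[of k "{}"] by blast+
    with ind have "card (cls X c \<inter> cls Y k) * card (cls {} k) = x"
      unfolding cond_indep_def c(2) by metis
    then show ?thesis by (metis dvd_triv_right)
  qed
  then have "card (cls {} k) dvd Gcd ((*) (card (cls Y k)) ` (\<lambda>c. card (cls X c)) ` cls {} k)"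
    by (rule Gcd_greatest)
  then have "kept_size X k * common_mult X k dvd card (cls Y k) * common_mult X k"
    by (simp add: Gcd_mult common_mult_def[symmetric] kept_size_mult[OF k])
  then show ?thesis using common_mult_pos[OF k, of X] by simp
qed

lemma card_keep_kept_size:
  assumes "cond_indep X Y" "k < n"
  shows "card (keep (kept_size X) Y \<inter> cls Y k) * kept_size X k = card (cls Y k)"
  using assms cls_mono[of "{}" Y k] kept_size_cong kept_size_pos kept_size_dvd
  by (intro card_keep_cls) auto

text \<open>An \<open>X\<close>-pattern and a \<open>Y\<close>-pattern with the same entry in row
  \<open>r\<close> occur together among the columns as often as among the matching kept pairs,
  because the divisors of the two classes multiply to the size of \<open>cls {} k\<close>.\<close>

lemma kept_columns_bij:
  assumes ind: "cond_indep X Y"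
  defines "K1 \<equiv> keep (common_mult X) X" and "K2 \<equiv> keep (kept_size X) Y"
  obtains h where "bij_betw h {..<n} {(k, l). k \<in> K1 \<and> l \<in> K2 \<and> M r k = M r l}"
    "\<And>j. j < n \<Longrightarrow> fst (h j) \<in> cls X j" "\<And>j. j < n \<Longrightarrow> snd (h j) \<in> cls Y j"
proof -
  let ?P = "{(k, l). k \<in> K1 \<and> l \<in> K2 \<and> M r k = M r l}"
  have K: "K1 \<subseteq> {..<n}" "K2 \<subseteq> {..<n}" by (auto simp: K1_def K2_def keep_def)
  have finP: "finite ?P"
    by (rule finite_subset[of _ "{..<n} \<times> {..<n}"]) (use K in auto)
  have eq_cls: "cls Z j = cls Z k \<longleftrightarrow> j \<in> cls Z k" if "j < n" for Z j k
    using that cls_eq[of j Z k] cls_self[of j Z] by auto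
  have cls_less: "j < n" if "j \<in> cls Z k" for Z j k using that cls_subset[of Z k] by auto
  have count: "card {j \<in> {..<n}. (cls X j, cls Y j) = (cls X k, cls Y l)} =
      card {p \<in> ?P. (case p of (k', l') \<Rightarrow> (cls X k', cls Y l')) = (cls X k, cls Y l)}"
    if k: "k < n" "l < n" "M r k = M r l" for k l
  proof -
    have lk: "l \<in> cls {} k" using k by (auto simp: cls_def)
    have "{j \<in> {..<n}. (cls X j, cls Y j) = (cls X k, cls Y l)} = cls X k \<inter> cls Y l" (is "?L = ?R")
    proof (rule Set.set_eqI)
      fix j show "j \<in> ?L \<longleftrightarrow> j \<in> ?R"
        using eq_cls[of j X k] eq_cls[of j Y l] cls_less[of j X k] by auto
    qed
    moreover have "{p \<in> ?P. (case p of (k', l') \<Rightarrow> (cls X k', cls Y l')) = (cls X k, cls Y l)}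
        = (K1 \<inter> cls X k) \<times> (K2 \<inter> cls Y l)" (is "?L = ?R")
    proof (rule Set.set_eqI)
      fix p :: "nat \<times> nat"
      obtain k' l' where p: "p = (k', l')" by (cases p)
      have "k' \<in> cls X k \<Longrightarrow> M r k' = M r k" "l' \<in> cls Y l \<Longrightarrow> M r l' = M r l"
        by (simp_all add: cls_def)
      then have "k' \<in> K1 \<and> l' \<in> K2 \<and> M r k' = M r l' \<and> cls X k' = cls X k \<and> cls Y l' = cls Y l \<longleftrightarrow>
          k' \<in> K1 \<and> l' \<in> K2 \<and> k' \<in> cls X k \<and> l' \<in> cls Y l"
        using eq_cls[of k' X k] eq_cls[of l' Y l] K k(3) by auto
      then show "p \<in> ?L \<longleftrightarrow> p \<in> ?R" by (auto simp: p)
    qed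
    moreover have "card (cls X k \<inter> cls Y l) = card (K1 \<inter> cls X k) * card (K2 \<inter> cls Y l)"
    proof -
      have N: "kept_size X k * common_mult X k = card (cls {} k)"
        by (rule kept_size_mult) (fact k)
      have "card (cls X k \<inter> cls Y l) * card (cls {} k) = card (cls X k) * card (cls Y l)"
        using ind k(1) lk unfolding cond_indep_def by simp
      also have "\<dots> = (card (K1 \<inter> cls X k) * common_mult X k) * (card (K2 \<inter> cls Y l) * kept_size X l)"
        unfolding K1_def K2_def by (simp add: card_keep_common_mult card_keep_kept_size[OF ind] k)
      \<comment> \<open>\<open>kept_size\<close> depends on its column only through row
        \<open>r\<close>, so its value at \<open>l\<close> is that at \<open>k\<close>.\<close>
      also have "\<dots> = card (K1 \<inter> cls X k) * card (K2 \<inter> cls Y l) * card (cls {} k)"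
        by (simp add: N[symmetric] kept_size_cong[OF lk])
      finally show ?thesis
        using card_cls_pos[of k "{}"] k by (metis lessThan_iff mult_cancel2 less_not_refl)
    qed
    ultimately show ?thesis by (simp add: card_cartesian_product)
  qed
  have "card {j \<in> {..<n}. (cls X j, cls Y j) = t} =
      card {p \<in> ?P. (case p of (k', l') \<Rightarrow> (cls X k', cls Y l')) = t}" for t
  proof (cases "\<exists>k l. k < n \<and> l < n \<and> M r k = M r l \<and> t = (cls X k, cls Y l)")
    case True
    then show ?thesis using count by blast
  next
    \<comment> \<open>Such a label has empty fibres on both sides: a column \<open>j\<close> with
      this label would give \<open>k = l = j\<close>.\<close>
    case False
    then have "{j \<in> {..<n}. (cls X j, cls Y j) = t} = {}" by blast
    moreover have "{p \<in> ?P. (case p of (k', l') \<Rightarrow> (cls X k', cls Y l')) = t} = {}"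
      using False K by auto
    ultimately show ?thesis by (simp only: card.empty)
  qed
  from bij_betw_matching_fibres[OF _ finP this] obtain h where h: "bij_betw h {..<n} ?P"
    and eq: "\<And>j. j \<in> {..<n} \<Longrightarrow> (case h j of (k', l') \<Rightarrow> (cls X k', cls Y l')) = (cls X j, cls Y j)"
    by blast
  show thesis
  proof (rule that[OF h])
    fix j assume j: "j < n"
    then have "h j \<in> ?P" using bij_betwE[OF h] by simp
    then have hn: "fst (h j) < n" "snd (h j) < n" using K by auto
    have "cls X (fst (h j)) = cls X j" "cls Y (snd (h j)) = cls Y j"
      using eq[of j] j by (auto split: prod.splits)
    then show "fst (h j) \<in> cls X j" "snd (h j) \<in> cls Y j" using hn cls_self by (metis lessThan_iff)+
  qed
qed

end

section \<open>From a 2-product to a splitting and back\<close>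

abbreviation columns_indep :: "real mat \<Rightarrow> nat \<Rightarrow> nat set \<Rightarrow> nat set \<Rightarrow> bool" where
  "columns_indep S \<equiv> table.cond_indep (\<lambda>i j. S $$ (i, j)) {..<dim_col S}"

text \<open>The second set keeps row \<open>r\<close>, which is harmless for \<open>cls\<close> and
  makes it the row set of the second factor. The condition on \<open>insert r X\<close> says that
  this factor has a further row.\<close>

definition splitting :: "real mat \<Rightarrow> nat \<Rightarrow> nat set \<Rightarrow> bool" where
  "splitting S r X \<longleftrightarrow> special_row S r \<and> X \<subseteq> {..<dim_row S} - {r} \<and> X \<noteq> {}
     \<and> insert r X \<noteq> {..<dim_row S} \<and> columns_indep S r X ({..<dim_row S} - X)"

text \<open>This symmetry allows the search to start from one fixed row: it lies on one side or the
  other.\<close>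

lemma splitting_complement:
  assumes "splitting S r X"
  shows "splitting S r ({..<dim_row S} - insert r X)"
proof -
  interpret table "\<lambda>i j. S $$ (i, j)" "{..<dim_col S}" r by unfold_locales simp
  have r: "r < dim_row S" and X: "X \<subseteq> {..<dim_row S} - {r}"
    using assms by (auto simp: splitting_def special_row_def)
  have "cond_indep ({..<dim_row S} - insert r X) ({..<dim_row S} - ({..<dim_row S} - insert r X))
      = cond_indep ({..<dim_row S} - X) X"
    using r X by (intro cond_indep_cong) auto
  with cond_indep_sym assms r X show ?thesis by (auto simp: splitting_def)
qed

text \<open>For a fixed special entry the matching pairs form a rectangle
  \<open>J1 \<times> J2\<close>, and the coordinates of a uniformly chosen element of a rectangle
  are independent.\<close>

lemma splitting_if_two_product:
  assumes "is_two_product S"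
  obtains r X where "splitting S r X"
proof -
  from assms obtain S1 x1 S2 y1 where w: "two_product_witness S S1 x1 S2 y1"
    unfolding is_two_product_def by blast
  then have x1: "special_row S1 x1" and y1: "special_row S2 y1"
    and iso: "isomorphic_mat S (two_product S1 x1 S2 y1)"
    and ne: "1 < dim_row S1" "1 < dim_row S2"
    by (auto simp: two_product_witness_def nonempty_mat_def special_row_def dim_special_part)
  obtain r A B \<alpha> \<beta> \<psi>
    where AB: "A \<inter> B = {}" "r \<notin> A \<union> B" "insert r (A \<union> B) = {..<dim_row S}"
    and \<alpha>: "bij_betw \<alpha> A ({..<dim_row S1} - {x1})" and \<beta>: "bij_betw \<beta> B ({..<dim_row S2} - {y1})"
    and \<psi>: "bij_betw \<psi> {..<dim_col S} (matching_columns S1 x1 S2 y1)"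
    and SA: "\<And>i j. i \<in> A \<Longrightarrow> j < dim_col S \<Longrightarrow> S $$ (i, j) = S1 $$ (\<alpha> i, fst (\<psi> j))"
    and SB: "\<And>i j. i \<in> B \<Longrightarrow> j < dim_col S \<Longrightarrow> S $$ (i, j) = S2 $$ (\<beta> i, snd (\<psi> j))"
    and Sr: "\<And>j. j < dim_col S \<Longrightarrow> S $$ (r, j) = S1 $$ (x1, fst (\<psi> j))"
    by (rule isomorphic_two_productE[OF x1 y1 iso]) (rule that; assumption)
  interpret table "\<lambda>i j. S $$ (i, j)" "{..<dim_col S}" r by unfold_locales simp
  have lt: "x1 < dim_row S1" "y1 < dim_row S2" using x1 y1 by (auto simp: special_row_def)
  have \<psi>_in: "\<psi> j \<in> matching_columns S1 x1 S2 y1" if "j < dim_col S" for j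
    using bij_betwE[OF \<psi>] that by simp
  have \<psi>_less: "fst (\<psi> j) < dim_col S1" "snd (\<psi> j) < dim_col S2"
      "S $$ (r, j) = S2 $$ (y1, snd (\<psi> j))" if "j < dim_col S" for j
    using \<psi>_in[OF that] Sr[OF that] by (auto simp: matching_columns_def)
  have rows1: "insert x1 (\<alpha> ` A) = {..<dim_row S1}" and rows2: "insert y1 (\<beta> ` B) = {..<dim_row S2}"
    using \<alpha> \<beta> lt by (auto simp: bij_betw_def)
  \<comment> \<open>The classes of \<open>A\<close> and \<open>B\<close> in \<open>S\<close> are the
    preimages of these sets under the two coordinates of \<psi>.\<close>
  define U where "U = (\<lambda>k. {u. u < dim_col S1 \<and> (\<forall>i\<in>{..<dim_row S1}. S1 $$ (i, u) = S1 $$ (i, fst (\<psi> k)))})"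
  define V where "V = (\<lambda>l. {v. v < dim_col S2 \<and> (\<forall>i\<in>{..<dim_row S2}. S2 $$ (i, v) = S2 $$ (i, snd (\<psi> l)))})"
  have clsA: "c \<in> cls A k \<longleftrightarrow> c < dim_col S \<and> fst (\<psi> c) \<in> U k" if "k < dim_col S" for c k
    using that \<psi>_less Sr SA unfolding cls_def U_def rows1[symmetric] by auto
  have clsB: "c \<in> cls B k \<longleftrightarrow> c < dim_col S \<and> snd (\<psi> c) \<in> V k" if "k < dim_col S" for c k
    using that \<psi>_less SB unfolding cls_def V_def rows2[symmetric] by auto
  have card_pre: "card {c. c < dim_col S \<and> \<psi> c \<in> Z} = card Z" if "Z \<subseteq> matching_columns S1 x1 S2 y1" for Z
  proof -
    have "\<psi> ` {c. c < dim_col S \<and> \<psi> c \<in> Z} = Z"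
    proof (intro equalityI subsetI)
      fix z assume "z \<in> Z"
      with that have "z \<in> \<psi> ` {..<dim_col S}" using bij_betw_imp_surj_on[OF \<psi>] by auto
      then obtain c where "c < dim_col S" "z = \<psi> c" by auto
      with \<open>z \<in> Z\<close> show "z \<in> \<psi> ` {c. c < dim_col S \<and> \<psi> c \<in> Z}" by simp
    qed auto
    then have "bij_betw \<psi> {c. c < dim_col S \<and> \<psi> c \<in> Z} Z"
      by (intro bij_betw_subset[OF \<psi>]) auto
    then show ?thesis by (rule bij_betw_same_card)
  qed
  have "cond_indep A B"
    unfolding cond_indep_def
  proof (intro ballI)
    fix k l assume "k \<in> {..<dim_col S}" "l \<in> cls {} k"
    then have k: "k < dim_col S" and l: "l < dim_col S" "S $$ (r, l) = S $$ (r, k)"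
      by (auto simp: cls_def)
    define J1 where "J1 = {u. u < dim_col S1 \<and> S1 $$ (x1, u) = S $$ (r, k)}"
    define J2 where "J2 = {v. v < dim_col S2 \<and> S2 $$ (y1, v) = S $$ (r, k)}"
    have sub: "U k \<subseteq> J1" "V l \<subseteq> J2"
      using lt Sr[OF k] \<psi>_less(3)[OF l(1)] l(2) by (auto simp: U_def V_def J1_def J2_def)
    have J: "c \<in> cls {} k \<longleftrightarrow> c < dim_col S \<and> fst (\<psi> c) \<in> J1"
      "c \<in> cls {} k \<longleftrightarrow> c < dim_col S \<and> snd (\<psi> c) \<in> J2" for c
      using \<psi>_less Sr by (auto simp: cls_def J1_def J2_def)
    have match: "J1 \<times> J2 \<subseteq> matching_columns S1 x1 S2 y1"
      by (auto simp: J1_def J2_def matching_columns_def)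
    have J12: "fst (\<psi> c) \<in> J1 \<longleftrightarrow> snd (\<psi> c) \<in> J2" if "c < dim_col S" for c
      using J that by blast
    have mem: "c \<in> cls {} k \<longleftrightarrow> c < dim_col S \<and> \<psi> c \<in> J1 \<times> J2"
      "c \<in> cls A k \<longleftrightarrow> c < dim_col S \<and> \<psi> c \<in> U k \<times> J2"
      "c \<in> cls B l \<longleftrightarrow> c < dim_col S \<and> \<psi> c \<in> J1 \<times> V l" for c
      using clsA[OF k, of c] clsB[OF l(1), of c] J[of c] J12[of c] sub by (auto simp: mem_Times_iff)
    have eq: "cls A k \<inter> cls B l = {c. c < dim_col S \<and> \<psi> c \<in> U k \<times> V l}"
      "cls {} k = {c. c < dim_col S \<and> \<psi> c \<in> J1 \<times> J2}"
      "cls A k = {c. c < dim_col S \<and> \<psi> c \<in> U k \<times> J2}"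
      "cls B l = {c. c < dim_col S \<and> \<psi> c \<in> J1 \<times> V l}"
      using sub by (auto simp: mem mem_Times_iff)
    have sub': "U k \<times> V l \<subseteq> matching_columns S1 x1 S2 y1" "U k \<times> J2 \<subseteq> matching_columns S1 x1 S2 y1"
      "J1 \<times> V l \<subseteq> matching_columns S1 x1 S2 y1"
      using match sub by blast+
    have "card (cls A k \<inter> cls B l) = card (U k) * card (V l)" "card (cls {} k) = card J1 * card J2"
      "card (cls A k) = card (U k) * card J2" "card (cls B l) = card J1 * card (V l)"
      using card_pre[OF sub'(1)] card_pre[OF match] card_pre[OF sub'(2)] card_pre[OF sub'(3)]
      by (simp_all only: eq[symmetric] card_cartesian_product)
    then show "card (cls A k \<inter> cls B l) * card (cls {} k) = card (cls A k) * card (cls B l)"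
      by simp
  qed
  \<comment> \<open>The complement of \<open>A\<close> is \<open>insert r B\<close>, and
    \<open>r\<close> makes no difference to \<open>cls\<close>.\<close>
  moreover have "cond_indep A ({..<dim_row S} - A) = cond_indep A B"
    using AB by (intro cond_indep_cong) auto
  moreover have "special_row S r"
  proof -
    have "\<exists>j<dim_col S. S $$ (r, j) = a" if a: "a \<in> {0, 1}" for a
    proof -
      obtain u v where "u < dim_col S1" "S1 $$ (x1, u) = a" "v < dim_col S2" "S2 $$ (y1, v) = a"
        using a x1 y1 by (auto simp: special_row_def)
      then have "(u, v) \<in> \<psi> ` {..<dim_col S}" using \<psi> by (auto simp: bij_betw_def matching_columns_def)
      then obtain j where "j < dim_col S" "\<psi> j = (u, v)" by auto
      then show ?thesis using Sr \<open>S1 $$ (x1, u) = a\<close> by auto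
    qed
    moreover have "S $$ (r, j) \<in> {0, 1}" if "j < dim_col S" for j
      using Sr \<psi>_less that x1 by (auto simp: special_row_def)
    ultimately show ?thesis using AB(3) by (auto simp: special_row_def)
  qed
  moreover have "A \<noteq> {}" "B \<noteq> {}"
    using ne bij_betw_same_card[OF \<alpha>] bij_betw_same_card[OF \<beta>] lt by auto
  ultimately have "splitting S r A"
    unfolding splitting_def using AB by auto
  then show thesis by (rule that)
qed

definition first_factor_columns :: "real mat \<Rightarrow> nat \<Rightarrow> nat set \<Rightarrow> nat set" where
  "first_factor_columns S r X =
     nat_table.keep (\<lambda>i j. S $$ (i, j)) (dim_col S) r
       (nat_table.common_mult (\<lambda>i j. S $$ (i, j)) (dim_col S) r X) X"

definition second_factor_columns :: "real mat \<Rightarrow> nat \<Rightarrow> nat set \<Rightarrow> nat set" where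
  "second_factor_columns S r X =
     nat_table.keep (\<lambda>i j. S $$ (i, j)) (dim_col S) r
       (nat_table.kept_size (\<lambda>i j. S $$ (i, j)) (dim_col S) r X) ({..<dim_row S} - X)"

lemma special_row_submatrix:
  assumes r: "special_row S r" "r \<in> I" and I: "I \<subseteq> {..<dim_row S}" "I \<noteq> {r}"
    and K: "K \<subseteq> {..<dim_col S}" "\<And>a. a \<in> {0, 1} \<Longrightarrow> \<exists>k\<in>K. S $$ (r, k) = a"
  shows "special_row (submatrix S I K) (rank I r)"
    and "a \<in> {0, 1} \<Longrightarrow> nonempty_mat (special_part (submatrix S I K) (rank I r) a)"
proof -
  let ?S1 = "submatrix S I K"
  have fin: "finite I" "finite K" using I(1) K(1) finite_subset by blast+
  have sets: "{i. i < dim_row S \<and> i \<in> I} = I" "{j. j < dim_col S \<and> j \<in> K} = K" using I K by auto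
  have dim: "dim_row ?S1 = card I" "dim_col ?S1 = card K" by (simp_all add: dim_submatrix sets)
  have bijI: "bij_betw (rank I) I {..<card I}" and bijK: "bij_betw (rank K) K {..<card K}"
    using bij_betw_rank[of I "dim_row S"] bij_betw_rank[of K "dim_col S"] by (simp_all add: sets)
  have entry: "?S1 $$ (rank I r, rank K k) = S $$ (r, k)" if "k \<in> K" for k
    unfolding rank_def by (rule submatrix_index_card) (use that r I K in auto)
  have x1: "rank I r < card I" using bij_betwE[OF bijI] r by simp
  have ex: "\<exists>j<card K. ?S1 $$ (rank I r, j) = a" if a: "a \<in> {0, 1}" for a
  proof -
    obtain k where k: "k \<in> K" "S $$ (r, k) = a" using K(2)[OF a] by blast
    then have "rank K k < card K" using bij_betwE[OF bijK] by simp
    with k entry show ?thesis by blast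
  qed
  have all: "?S1 $$ (rank I r, j) \<in> {0, 1}" if j: "j < card K" for j
  proof -
    have "j \<in> rank K ` K" using bijK j by (simp add: bij_betw_def)
    then obtain k where "k \<in> K" "j = rank K k" by auto
    then show ?thesis using entry r(1) K(1) by (auto simp: special_row_def)
  qed
  show "special_row ?S1 (rank I r)"
    unfolding special_row_def dim using x1 all ex by auto
  assume a: "a \<in> {0, 1}"
  have "card {j. j < card K \<and> ?S1 $$ (rank I r, j) = a} > 0"
    using ex[OF a] by (auto simp: card_gt_0_iff)
  moreover have "card I > 1"
  proof -
    obtain i where "i \<in> I" "i \<noteq> r" using r(2) I(2) by blast
    with r(2) have "card {r, i} \<le> card I" by (intro card_mono fin) auto
    with \<open>i \<noteq> r\<close> show ?thesis by simp
  qed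
  ultimately show "nonempty_mat (special_part ?S1 (rank I r) a)"
    using x1 by (simp add: nonempty_mat_def dim_special_part dim)
qed

text \<open>Both factors are submatrices of \<open>S\<close> with \<open>r\<close> as special row,
  so the algorithm only has to copy entries. The column bijection is that of
  \<open>kept_columns_bij\<close>, expressed in positions.\<close>

lemma two_product_witness_if_splitting:
  assumes split: "splitting S r X"
  defines "I1 \<equiv> insert r X" and "I2 \<equiv> {..<dim_row S} - X"
    and "K1 \<equiv> first_factor_columns S r X" and "K2 \<equiv> second_factor_columns S r X"
  shows "two_product_witness S (submatrix S I1 K1) (rank I1 r) (submatrix S I2 K2) (rank I2 r)"
proof -
  interpret nat_table "\<lambda>i j. S $$ (i, j)" "dim_col S" r "dim_row S" by unfold_locales simp
  let ?S1 = "submatrix S I1 K1" and ?S2 = "submatrix S I2 K2"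
  have r: "special_row S r" and X: "X \<subseteq> {..<dim_row S} - {r}" "X \<noteq> {}" "I1 \<noteq> {..<dim_row S}"
    and ind: "cond_indep X I2"
    using split by (auto simp: splitting_def I1_def I2_def)
  have r_less: "r < dim_row S" using r by (simp add: special_row_def)
  have I: "I1 \<subseteq> {..<dim_row S}" "I2 \<subseteq> {..<dim_row S}" "r \<in> I1" "r \<in> I2" "I1 \<noteq> {r}" "I2 \<noteq> {r}"
    using X r_less by (auto simp: I1_def I2_def)
  have K_eq: "K1 = keep (common_mult X) X" "K2 = keep (kept_size X) I2"
    by (simp_all add: K1_def K2_def first_factor_columns_def second_factor_columns_def I2_def)
  then have K: "K1 \<subseteq> {..<dim_col S}" "K2 \<subseteq> {..<dim_col S}" by (auto simp: keep_def)
  obtain h where h: "bij_betw h {..<dim_col S} {(k, l). k \<in> K1 \<and> l \<in> K2 \<and> S $$ (r, k) = S $$ (r, l)}"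
    and hX: "\<And>j. j < dim_col S \<Longrightarrow> fst (h j) \<in> cls X j"
    and hY: "\<And>j. j < dim_col S \<Longrightarrow> snd (h j) \<in> cls I2 j"
    by (rule kept_columns_bij[OF ind, folded K_eq]) (rule that; assumption)
  have hK: "fst (h j) \<in> K1" "snd (h j) \<in> K2" if "j < dim_col S" for j
    using bspec[OF bij_betwE[OF h], of j] that by auto
  have hS: "S $$ (i, fst (h j)) = S $$ (i, j)" if "i \<in> I1" "j < dim_col S" for i j
    using hX[OF that(2)] that(1) by (auto simp: cls_def I1_def)
  have hS': "S $$ (i, snd (h j)) = S $$ (i, j)" if "i \<in> I2" "j < dim_col S" for i j
    using hY[OF that(2)] that(1) by (auto simp: cls_def)
  have ex: "\<exists>k\<in>K1. S $$ (r, k) = a" "\<exists>k\<in>K2. S $$ (r, k) = a" if a: "a \<in> {0, 1}" for a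
  proof -
    obtain j where "j < dim_col S" "S $$ (r, j) = a" using a r by (auto simp: special_row_def)
    then have "S $$ (r, fst (h j)) = a" "S $$ (r, snd (h j)) = a" "fst (h j) \<in> K1" "snd (h j) \<in> K2"
      using hK hS hS' I(3,4) by auto
    then show "\<exists>k\<in>K1. S $$ (r, k) = a" "\<exists>k\<in>K2. S $$ (r, k) = a" by blast+
  qed
  have x1: "special_row ?S1 (rank I1 r)"
      "\<And>a. a \<in> {0, 1} \<Longrightarrow> nonempty_mat (special_part ?S1 (rank I1 r) a)"
    by (rule special_row_submatrix[OF r I(3,1,5) K(1) ex(1)]; assumption)+
  have y1: "special_row ?S2 (rank I2 r)"
      "\<And>a. a \<in> {0, 1} \<Longrightarrow> nonempty_mat (special_part ?S2 (rank I2 r) a)"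
    by (rule special_row_submatrix[OF r I(4,2,6) K(2) ex(2)]; assumption)+
  have sets: "{i. i < dim_row S \<and> i \<in> I1} = I1" "{i. i < dim_row S \<and> i \<in> I2} = I2"
    "{j. j < dim_col S \<and> j \<in> K1} = K1" "{j. j < dim_col S \<and> j \<in> K2} = K2" using I K by auto
  have dim: "dim_row ?S1 = card I1" "dim_row ?S2 = card I2" "dim_col ?S1 = card K1" "dim_col ?S2 = card K2"
    by (simp_all add: dim_submatrix sets)
  have bij: "bij_betw (rank I1) I1 {..<card I1}" "bij_betw (rank I2) I2 {..<card I2}"
    "bij_betw (rank K1) K1 {..<card K1}" "bij_betw (rank K2) K2 {..<card K2}"
    using bij_betw_rank[of I1 "dim_row S"] bij_betw_rank[of I2 "dim_row S"]
      bij_betw_rank[of K1 "dim_col S"] bij_betw_rank[of K2 "dim_col S"] by (simp_all only: sets)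
  have entry1: "?S1 $$ (rank I1 i, rank K1 k) = S $$ (i, k)" if "i \<in> I1" "k \<in> K1" for i k
    unfolding rank_def by (rule submatrix_index_card) (use that I K in auto)
  have entry2: "?S2 $$ (rank I2 i, rank K2 k) = S $$ (i, k)" if "i \<in> I2" "k \<in> K2" for i k
    unfolding rank_def by (rule submatrix_index_card) (use that I K in auto)
  define \<psi> where "\<psi> = map_prod (rank K1) (rank K2) \<circ> h"
  let ?P = "{(k, l). k \<in> K1 \<and> l \<in> K2 \<and> S $$ (r, k) = S $$ (r, l)}"
  have bij_prod: "bij_betw (map_prod (rank K1) (rank K2)) (K1 \<times> K2) ({..<card K1} \<times> {..<card K2})"
    by (rule bij_betw_map_prod) (fact bij)+
  have "map_prod (rank K1) (rank K2) ` ?P = matching_columns ?S1 (rank I1 r) ?S2 (rank I2 r)"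
  proof (intro equalityI subsetI)
    fix p assume "p \<in> map_prod (rank K1) (rank K2) ` ?P"
    then show "p \<in> matching_columns ?S1 (rank I1 r) ?S2 (rank I2 r)"
      using bij_betwE[OF bij(3)] bij_betwE[OF bij(4)]
      by (auto simp: matching_columns_def dim entry1 entry2 I)
  next
    fix p assume p: "p \<in> matching_columns ?S1 (rank I1 r) ?S2 (rank I2 r)"
    then have "p \<in> map_prod (rank K1) (rank K2) ` (K1 \<times> K2)"
      using bij_prod by (auto simp: matching_columns_def dim bij_betw_def)
    then obtain k l where "k \<in> K1" "l \<in> K2" "p = (rank K1 k, rank K2 l)" by auto
    moreover from this p have "S $$ (r, k) = S $$ (r, l)"
      by (auto simp: matching_columns_def entry1 entry2 I)
    ultimately show "p \<in> map_prod (rank K1) (rank K2) ` ?P" by (auto intro!: rev_image_eqI[of "(k, l)"])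
  qed
  then have "bij_betw (map_prod (rank K1) (rank K2)) ?P (matching_columns ?S1 (rank I1 r) ?S2 (rank I2 r))"
    by (intro bij_betw_subset[OF bij_prod]) auto
  from bij_betw_trans[OF h this] have \<psi>: "bij_betw \<psi> {..<dim_col S} (matching_columns ?S1 (rank I1 r) ?S2 (rank I2 r))"
    by (simp add: \<psi>_def)
  have rank_rows: "bij_betw (rank J) (J - {r}) ({..<card J} - {rank J r})"
    if "bij_betw (rank J) J {..<card J}" "r \<in> J" for J
    using that by (auto simp: bij_betw_def inj_on_def)
  have "isomorphic_mat S (two_product ?S1 (rank I1 r) ?S2 (rank I2 r))"
  proof (rule isomorphic_two_productI[where A = X and B = "I2 - {r}" and r = r
        and \<alpha> = "rank I1" and \<beta> = "rank I2" and \<psi> = \<psi>])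
    show "X \<inter> (I2 - {r}) = {}" "r \<notin> X \<union> (I2 - {r})" "insert r (X \<union> (I2 - {r})) = {..<dim_row S}"
      using X r_less by (auto simp: I2_def)
    have "I1 - {r} = X" using X by (auto simp: I1_def)
    with rank_rows[OF bij(1) I(3)] show "bij_betw (rank I1) X ({..<dim_row ?S1} - {rank I1 r})"
      by (simp add: dim)
    show "bij_betw (rank I2) (I2 - {r}) ({..<dim_row ?S2} - {rank I2 r})"
      using rank_rows[OF bij(2) I(4)] by (simp add: dim)
    show "S $$ (i, j) = ?S1 $$ (rank I1 i, fst (\<psi> j))" if "i \<in> X" "j < dim_col S" for i j
    proof -
      have "i \<in> I1" using that by (simp add: I1_def)
      with that hK hS show ?thesis by (simp add: \<psi>_def entry1)
    qed
    show "S $$ (i, j) = ?S2 $$ (rank I2 i, snd (\<psi> j))" if "i \<in> I2 - {r}" "j < dim_col S" for i j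
      using that hK hS' by (simp add: \<psi>_def entry2)
    show "S $$ (r, j) = ?S1 $$ (rank I1 r, fst (\<psi> j))" if "j < dim_col S" for j
      using that hK hS I by (simp add: \<psi>_def entry1)
  qed (fact x1(1) y1(1) \<psi>)+
  with x1 y1 show ?thesis by (simp add: two_product_witness_def)
qed

section \<open>Bounded loop programs on the real RAM\<close>

text \<open>Truth values are naturals, where every nonzero number is true. Loop bounds are the scalars \<open>m\<close> and
  \<open>n\<close>, which well-formed programs cannot change.\<close>

datatype expr =
    Num nat
  | Var string
  | Get string expr
  | Add expr expr
  | Sub expr expr
  | Ite expr expr expr
  | SEq expr expr
  | SIs expr expr
  | Sum string string expr

primrec ev :: "expr \<Rightarrow> (string \<Rightarrow> nat) \<Rightarrow> state \<Rightarrow> nat" where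
  "ev (Num k) env s = k"
| "ev (Var x) env s = env x"
| "ev (Get a e) env s = nats s a (ev e env s)"
| "ev (Add e f) env s = ev e env s + ev f env s"
| "ev (Sub e f) env s = ev e env s - ev f env s"
| "ev (Ite b e f) env s = (if ev b env s \<noteq> 0 then ev e env s else ev f env s)"
| "ev (SEq e f) env s = of_bool (reals s ''S'' (ev e env s) = reals s ''S'' (ev f env s))"
| "ev (SIs e f) env s = of_bool (reals s ''S'' (ev e env s) = real (ev f env s))"
| "ev (Sum x b e) env s = (\<Sum>i<nats s b 0. ev e (env(x := i)) s)"

datatype loop_prog =
    Upd string expr expr
  | UpdR string expr expr
  | Then loop_prog loop_prog
  | If expr loop_prog
  | For string string loop_prog

primrec run :: "loop_prog \<Rightarrow> (string \<Rightarrow> nat) \<Rightarrow> state \<Rightarrow> state" where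
  "run (Upd a e f) env s = nats_upd a (ev e env s) (ev f env s) s"
| "run (UpdR a e f) env s = reals_upd a (ev e env s) (reals s ''S'' (ev f env s)) s"
| "run (Then p q) env s = run q env (run p env s)"
| "run (If b p) env s = (if ev b env s \<noteq> 0 then run p env s else s)"
| "run (For x b p) env s = fold (\<lambda>i. run p (env(x := i))) [0..<nats s b 0] s"

text \<open>Without access to \<open>T\<close>, values do not depend on scratch memory; with bounds
  \<open>m\<close> and \<open>n\<close> only, every sum is short.\<close>

primrec wf_expr :: "expr \<Rightarrow> bool" where
  "wf_expr (Num k) \<longleftrightarrow> True"
| "wf_expr (Var x) \<longleftrightarrow> True"
| "wf_expr (Get a e) \<longleftrightarrow> a \<noteq> ''T'' \<and> wf_expr e"
| "wf_expr (Add e f) \<longleftrightarrow> wf_expr e \<and> wf_expr f"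
| "wf_expr (Sub e f) \<longleftrightarrow> wf_expr e \<and> wf_expr f"
| "wf_expr (Ite b e f) \<longleftrightarrow> wf_expr b \<and> wf_expr e \<and> wf_expr f"
| "wf_expr (SEq e f) \<longleftrightarrow> wf_expr e \<and> wf_expr f"
| "wf_expr (SIs e f) \<longleftrightarrow> wf_expr e \<and> wf_expr f"
| "wf_expr (Sum x b e) \<longleftrightarrow> b \<in> {''m'', ''n''} \<and> wf_expr e"

primrec wf_prog :: "loop_prog \<Rightarrow> bool" where
  "wf_prog (Upd a e f) \<longleftrightarrow> a \<notin> {''T'', ''m'', ''n''} \<and> wf_expr e \<and> wf_expr f"
| "wf_prog (UpdR a e f) \<longleftrightarrow> wf_expr e \<and> wf_expr f"
| "wf_prog (Then p q) \<longleftrightarrow> wf_prog p \<and> wf_prog q"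
| "wf_prog (If b p) \<longleftrightarrow> wf_expr b \<and> wf_prog p"
| "wf_prog (For x b p) \<longleftrightarrow> b \<in> {''m'', ''n''} \<and> wf_prog p"

abbreviation T :: "nat \<Rightarrow> nexp" where
  "T d \<equiv> NGet ''T'' (NConst d)"

abbreviation setT :: "nat \<Rightarrow> nexp \<Rightarrow> com" where
  "setT d e \<equiv> NSet ''T'' (NConst d) e"

text \<open>A stack discipline: the result goes to cell \<open>d\<close>, intermediate values above
  it. In \<open>Sum\<close> the counter in cell \<open>Suc d\<close> is never initialised; it relies
  on the cells above \<open>d\<close> being zero, which is why temporary cells are cleared after
  use.\<close>

primrec compile_expr :: "expr \<Rightarrow> (string \<Rightarrow> nat) \<Rightarrow> nat \<Rightarrow> com" where
  "compile_expr (Num k) cells d = setT d (NConst k)"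
| "compile_expr (Var x) cells d = setT d (T (cells x))"
| "compile_expr (Get a e) cells d = Seq (compile_expr e cells d) (setT d (NGet a (T d)))"
| "compile_expr (Add e f) cells d = Seq (compile_expr e cells d) (Seq (compile_expr f cells (Suc d))
     (Seq (setT d (NAdd (T d) (T (Suc d)))) (setT (Suc d) (NConst 0))))"
| "compile_expr (Sub e f) cells d = Seq (compile_expr e cells d) (Seq (compile_expr f cells (Suc d))
     (Seq (setT d (NSub (T d) (T (Suc d)))) (setT (Suc d) (NConst 0))))"
| "compile_expr (Ite b e f) cells d = Seq (compile_expr b cells d)
     (Cond (NEq (T d) (NConst 0)) (compile_expr f cells d) (compile_expr e cells d))"
| "compile_expr (SEq e f) cells d = Seq (compile_expr e cells d) (Seq (compile_expr f cells (Suc d))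
     (Seq (Cond (REq (RGet ''S'' (T d)) (RGet ''S'' (T (Suc d))))
        (setT d (NConst 1)) (setT d (NConst 0))) (setT (Suc d) (NConst 0))))"
| "compile_expr (SIs e f) cells d = Seq (compile_expr e cells d) (Seq (compile_expr f cells (Suc d))
     (Seq (Cond (REq (RGet ''S'' (T d)) (ROfNat (T (Suc d))))
        (setT d (NConst 1)) (setT d (NConst 0))) (setT (Suc d) (NConst 0))))"
| "compile_expr (Sum x b e) cells d = Seq (setT d (NConst 0)) (Seq
     (Loop (NLess (T (Suc d)) (NGet b (NConst 0)))
       (Seq (compile_expr e (cells(x := Suc d)) (Suc (Suc d)))
       (Seq (setT d (NAdd (T d) (T (Suc (Suc d)))))
       (Seq (setT (Suc (Suc d)) (NConst 0))
            (setT (Suc d) (NAdd (T (Suc d)) (NConst 1)))))))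
     (setT (Suc d) (NConst 0)))"

text \<open>Cell \<open>d\<close> is the counter of a \<open>For\<close> loop and must be zero on
  entry, so \<open>If\<close> clears it before the body; if the test fails, it is zero
  already.\<close>

primrec compile_prog :: "loop_prog \<Rightarrow> (string \<Rightarrow> nat) \<Rightarrow> nat \<Rightarrow> com" where
  "compile_prog (Upd a e f) cells d = Seq (compile_expr e cells d) (Seq (compile_expr f cells (Suc d))
     (Seq (NSet a (T d) (T (Suc d))) (Seq (setT (Suc d) (NConst 0)) (setT d (NConst 0)))))"
| "compile_prog (UpdR a e f) cells d = Seq (compile_expr e cells d) (Seq (compile_expr f cells (Suc d))
     (Seq (RSet a (T d) (RGet ''S'' (T (Suc d)))) (Seq (setT (Suc d) (NConst 0)) (setT d (NConst 0)))))"
| "compile_prog (Then p q) cells d = Seq (compile_prog p cells d) (compile_prog q cells d)"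
| "compile_prog (If b p) cells d = Seq (compile_expr b cells d)
     (Cond (NEq (T d) (NConst 0)) Skip (Seq (setT d (NConst 0)) (compile_prog p cells d)))"
| "compile_prog (For x b p) cells d = Seq
     (Loop (NLess (T d) (NGet b (NConst 0)))
       (Seq (compile_prog p (cells(x := d)) (Suc d)) (setT d (NAdd (T d) (NConst 1)))))
     (setT d (NConst 0))"

text \<open>Branches are added instead of maximised and loop bounds replaced by \<open>K\<close>, so
  that only sums and multiples of \<open>K\<close> arise.\<close>

primrec expr_cost :: "expr \<Rightarrow> nat \<Rightarrow> nat" where
  "expr_cost (Num k) K = 1"
| "expr_cost (Var x) K = 1"
| "expr_cost (Get a e) K = expr_cost e K + 1"
| "expr_cost (Add e f) K = expr_cost e K + expr_cost f K + 2"
| "expr_cost (Sub e f) K = expr_cost e K + expr_cost f K + 2"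
| "expr_cost (Ite b e f) K = expr_cost b K + expr_cost e K + expr_cost f K + 1"
| "expr_cost (SEq e f) K = expr_cost e K + expr_cost f K + 3"
| "expr_cost (SIs e f) K = expr_cost e K + expr_cost f K + 3"
| "expr_cost (Sum x b e) K = K * (expr_cost e K + 4) + 3"

primrec prog_cost :: "loop_prog \<Rightarrow> nat \<Rightarrow> nat" where
  "prog_cost (Upd a e f) K = expr_cost e K + expr_cost f K + 3"
| "prog_cost (UpdR a e f) K = expr_cost e K + expr_cost f K + 3"
| "prog_cost (Then p q) K = prog_cost p K + prog_cost q K"
| "prog_cost (If b p) K = expr_cost b K + prog_cost p K + 2"
| "prog_cost (For x b p) K = K * (prog_cost p K + 2) + 2"

lemma nats_nats_upd [simp]:
  "nats (nats_upd a i v s) b j = (if a = b \<and> i = j then v else nats s b j)"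
  by (auto simp: nats_upd_def)

lemma reals_nats_upd [simp]: "reals (nats_upd a i v s) = reals s"
  by (simp add: nats_upd_def)

lemma nats_reals_upd [simp]: "nats (reals_upd a i v s) = nats s"
  by (simp add: reals_upd_def)

lemma reals_reals_upd [simp]:
  "reals (reals_upd a i v s) b j = (if a = b \<and> i = j then v else reals s b j)"
  by (auto simp: reals_upd_def)

lemma state_eqI:
  fixes s s' :: state
  assumes "\<And>a i. nats s a i = nats s' a i" and "\<And>a i. reals s a i = reals s' a i"
  shows "s = s'"
  using assms by (intro state.equality) (auto simp: fun_eq_iff)

text \<open>Upper bounds instead of exact step counts let branches and iterations of different
  length combine.\<close>

definition runs :: "com \<Rightarrow> state \<Rightarrow> nat \<Rightarrow> state \<Rightarrow> bool" where
  "runs c s B s' \<longleftrightarrow> (\<exists>t\<le>B. exec c s t s')"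

lemma runs_Skip: "runs Skip s 1 s"
  unfolding runs_def using exec.Skip by blast

lemma runs_NSet: "s' = nats_upd a (nval e s) (nval f s) s \<Longrightarrow> runs (NSet a e f) s 1 s'"
  unfolding runs_def using exec.NSet by blast

lemma runs_RSet: "s' = reals_upd a (nval e s) (rval f s) s \<Longrightarrow> runs (RSet a e f) s 1 s'"
  unfolding runs_def using exec.RSet by blast

lemma runs_Seq:
  assumes "runs c s A s'" and "runs d s' B s''"
  shows "runs (Seq c d) s (A + B) s''"
  using assms exec.Seq unfolding runs_def by (meson add_mono)

lemma runs_Cond:
  assumes "bval b s \<Longrightarrow> runs c s A s'" and "\<not> bval b s \<Longrightarrow> runs d s B s'"
  shows "runs (Cond b c d) s (max A B + 1) s'"
proof (cases "bval b s")
  case True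
  with assms obtain t where "t \<le> A" "exec c s t s'" unfolding runs_def by blast
  with True exec.CondTrue[OF True this(2), of d] show ?thesis
    unfolding runs_def by (intro exI[of _ "t + 1"]) auto
next
  case False
  with assms obtain t where "t \<le> B" "exec d s t s'" unfolding runs_def by blast
  with False exec.CondFalse[OF False this(2), of c] show ?thesis
    unfolding runs_def by (intro exI[of _ "t + 1"]) auto
qed

lemma runs_weaken: "runs c s A s' \<Longrightarrow> A \<le> B \<Longrightarrow> runs c s B s'"
  unfolding runs_def by (meson order_trans)

text \<open>\<open>f i\<close> is the state after \<open>i\<close> iterations; the induction is over
  the number of iterations left.\<close>

lemma runs_Loop:
  assumes "\<And>i. i < N \<Longrightarrow> bval b (f i)" and "\<And>i. i < N \<Longrightarrow> runs c (f i) B (f (Suc i))"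
    and "\<not> bval b (f N)"
  shows "runs (Loop b c) (f 0) (N * (B + 1) + 1) (f N)"
proof -
  have "runs (Loop b c) (f (N - k)) (k * (B + 1) + 1) (f N)" if "k \<le> N" for k
    using that
  proof (induction k)
    case 0
    then show ?case using exec.LoopFalse[OF assms(3)] unfolding runs_def by auto
  next
    case (Suc k)
    define i where "i = N - Suc k"
    have i: "i < N" "Suc i = N - k" using Suc.prems by (auto simp: i_def)
    from assms(2)[OF i(1)] obtain t where t: "t \<le> B" "exec c (f i) t (f (Suc i))"
      unfolding runs_def by blast
    from Suc obtain u where u: "u \<le> k * (B + 1) + 1" "exec (Loop b c) (f (Suc i)) u (f N)"
      unfolding runs_def i(2) by auto
    from exec.LoopTrue[OF assms(1)[OF i(1)] t(2) u(2)] t(1) u(1) show ?case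
      unfolding runs_def i_def[symmetric] by (intro exI[of _ "t + u + 1"]) auto
  qed
  from this[of N] show ?thesis by simp
qed

lemma ev_upd_T [simp]: "wf_expr e \<Longrightarrow> ev e env (nats_upd ''T'' i v s) = ev e env s"
  by (induction e arbitrary: env) (auto simp del: of_bool_eq_iff)

definition mat_size :: "state \<Rightarrow> nat" where
  "mat_size s = nats s ''m'' 0 + nats s ''n'' 0 + 1"

lemma mat_size_upd [simp]: "a \<notin> {''m'', ''n''} \<Longrightarrow> mat_size (nats_upd a i v s) = mat_size s"
  by (auto simp: mat_size_def)

lemma bound_le_mat_size: "b \<in> {''m'', ''n''} \<Longrightarrow> nats s b 0 \<le> mat_size s"
  by (auto simp: mat_size_def)

text \<open>Scratch memory is the array \<open>T\<close>: a cell below \<open>d\<close> may hold a variable, and the cells above \<open>d\<close> are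
  zero before and after the evaluation.\<close>

definition fits :: "(string \<Rightarrow> nat) \<Rightarrow> (string \<Rightarrow> nat) \<Rightarrow> nat \<Rightarrow> state \<Rightarrow> bool" where
  "fits cells env d s \<longleftrightarrow> (\<forall>x. cells x < d \<and> nats s ''T'' (cells x) = env x) \<and> (\<forall>i>d. nats s ''T'' i = 0)"

lemma fits_upd: "fits cells env d s \<Longrightarrow> fits cells env d (nats_upd ''T'' d v s)"
  by (auto simp: fits_def dest: less_imp_neq)

lemma fits_Suc: "fits cells env d s \<Longrightarrow> fits cells env (Suc d) s"
  by (auto simp: fits_def intro: less_SucI)

lemma fits_zero: "fits cells env d s \<Longrightarrow> d < i \<Longrightarrow> nats s ''T'' i = 0"
  by (auto simp: fits_def)

lemma runs_binary:
  assumes e: "runs (compile_expr e cells d) s A (nats_upd ''T'' d (ev e env s) s)"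
    and f: "runs (compile_expr f cells (Suc d)) (nats_upd ''T'' d (ev e env s) s) B
              (nats_upd ''T'' (Suc d) (ev f env s) (nats_upd ''T'' d (ev e env s) s))"
    and c: "runs c (nats_upd ''T'' (Suc d) (ev f env s) (nats_upd ''T'' d (ev e env s) s)) D
              (nats_upd ''T'' (Suc d) (ev f env s) (nats_upd ''T'' d v s))"
    and z: "nats s ''T'' (Suc d) = 0"
  shows "runs (Seq (compile_expr e cells d) (Seq (compile_expr f cells (Suc d)) (Seq c (setT (Suc d) (NConst 0)))))
           s (A + (B + (D + 1))) (nats_upd ''T'' d v s)"
proof (intro runs_Seq)
  show "runs (setT (Suc d) (NConst 0)) (nats_upd ''T'' (Suc d) (ev f env s) (nats_upd ''T'' d v s)) 1
     (nats_upd ''T'' d v s)"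
    by (rule runs_NSet, rule state_eqI) (use z in auto)
qed (fact e f c)+

lemma runs_compile_expr:
  "wf_expr e \<Longrightarrow> fits cells env d s \<Longrightarrow>
     runs (compile_expr e cells d) s (expr_cost e (mat_size s)) (nats_upd ''T'' d (ev e env s) s)"
proof (induction e arbitrary: cells env d s)
  case (Num k)
  show ?case by (simp add: runs_NSet flip: One_nat_def)
next
  case (Var x)
  then show ?case by (auto intro!: runs_NSet simp: fits_def simp flip: One_nat_def)
next
  case (Get a e)
  have "runs (setT d (NGet a (T d))) (nats_upd ''T'' d (ev e env s) s) 1
          (nats_upd ''T'' d (ev (Get a e) env s) s)"
    by (rule runs_NSet, rule state_eqI) (use Get.prems in auto)
  from runs_Seq[OF Get.IH[of cells env d s] this] Get.prems show ?case by simp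
next
  case (Add e f)
  have "runs (setT d (NAdd (T d) (T (Suc d))))
          (nats_upd ''T'' (Suc d) (ev f env s) (nats_upd ''T'' d (ev e env s) s)) 1
          (nats_upd ''T'' (Suc d) (ev f env s) (nats_upd ''T'' d (ev e env s + ev f env s) s))"
    by (rule runs_NSet, rule state_eqI) auto
  from runs_binary[OF _ _ this] Add.IH(1)[of cells env d s]
    Add.IH(2)[of cells env "Suc d" "nats_upd ''T'' d (ev e env s) s"] Add.prems
  show ?case by (simp add: fits_upd fits_Suc fits_zero add.assoc)
next
  case (Sub e f)
  have "runs (setT d (NSub (T d) (T (Suc d))))
          (nats_upd ''T'' (Suc d) (ev f env s) (nats_upd ''T'' d (ev e env s) s)) 1
          (nats_upd ''T'' (Suc d) (ev f env s) (nats_upd ''T'' d (ev e env s - ev f env s) s))"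
    by (rule runs_NSet, rule state_eqI) auto
  from runs_binary[OF _ _ this] Sub.IH(1)[of cells env d s]
    Sub.IH(2)[of cells env "Suc d" "nats_upd ''T'' d (ev e env s) s"] Sub.prems
  show ?case by (simp add: fits_upd fits_Suc fits_zero add.assoc)
next
  case (Ite b e f)
  let ?r = "nats_upd ''T'' d (ev b env s) s"
  have *: "nats_upd ''T'' d v ?r = nats_upd ''T'' d v s" for v
    by (rule state_eqI) auto
  have "runs (Cond (NEq (T d) (NConst 0)) (compile_expr f cells d) (compile_expr e cells d)) ?r
     (max (expr_cost f (mat_size s)) (expr_cost e (mat_size s)) + 1) (nats_upd ''T'' d (ev (Ite b e f) env s) s)"
    using Ite.IH(2,3)[of cells env d ?r] Ite.prems
    by (intro runs_Cond) (auto simp: fits_upd *)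
  from runs_Seq[OF Ite.IH(1)[of cells env d s] this] Ite.prems
  have "runs (compile_expr (Ite b e f) cells d) s
      (expr_cost b (mat_size s) + (max (expr_cost f (mat_size s)) (expr_cost e (mat_size s)) + 1))
      (nats_upd ''T'' d (ev (Ite b e f) env s) s)"
    by simp
  then show ?case by (rule runs_weaken) simp
next
  case (SEq e f)
  have "runs (Cond (REq (RGet ''S'' (T d)) (RGet ''S'' (T (Suc d))))
        (setT d (NConst 1)) (setT d (NConst 0)))
          (nats_upd ''T'' (Suc d) (ev f env s) (nats_upd ''T'' d (ev e env s) s)) (max 1 1 + 1)
          (nats_upd ''T'' (Suc d) (ev f env s) (nats_upd ''T'' d (ev (SEq e f) env s) s))"
    by (rule runs_Cond; rule runs_NSet; rule state_eqI) auto
  from runs_binary[OF _ _ this] SEq.IH(1)[of cells env d s]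
    SEq.IH(2)[of cells env "Suc d" "nats_upd ''T'' d (ev e env s) s"] SEq.prems
  show ?case by (simp add: fits_upd fits_Suc fits_zero add.assoc numeral_eq_Suc split del: split_of_bool)
next
  case (SIs e f)
  have "runs (Cond (REq (RGet ''S'' (T d)) (ROfNat (T (Suc d))))
        (setT d (NConst 1)) (setT d (NConst 0)))
          (nats_upd ''T'' (Suc d) (ev f env s) (nats_upd ''T'' d (ev e env s) s)) (max 1 1 + 1)
          (nats_upd ''T'' (Suc d) (ev f env s) (nats_upd ''T'' d (ev (SIs e f) env s) s))"
    by (rule runs_Cond; rule runs_NSet; rule state_eqI) auto
  from runs_binary[OF _ _ this] SIs.IH(1)[of cells env d s]
    SIs.IH(2)[of cells env "Suc d" "nats_upd ''T'' d (ev e env s) s"] SIs.prems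
  show ?case by (simp add: fits_upd fits_Suc fits_zero add.assoc numeral_eq_Suc split del: split_of_bool)
next
  case (Sum x b e)
  let ?N = "nats s b 0"
  have b: "b \<noteq> ''T''" using Sum.prems by auto
  define g where "g = (\<lambda>i. ev e (env(x := i)) s)"
  \<comment> \<open>Machine state before iteration \<open>i\<close>: the counter in cell
    \<open>Suc d\<close>, the partial sum in cell \<open>d\<close>.\<close>
  define f where "f = (\<lambda>i. nats_upd ''T'' (Suc d) i (nats_upd ''T'' d (sum g {..<i}) s))"
  have init: "runs (setT d (NConst 0)) s 1 (f 0)"
    by (rule runs_NSet, rule state_eqI) (use Sum.prems in \<open>auto simp: f_def fits_zero\<close>)
  have step: "runs (Seq (compile_expr e (cells(x := Suc d)) (Suc (Suc d)))
       (Seq (setT d (NAdd (T d) (T (Suc (Suc d)))))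
       (Seq (setT (Suc (Suc d)) (NConst 0))
            (setT (Suc d) (NAdd (T (Suc d)) (NConst 1)))))) (f i)
      (expr_cost e (mat_size s) + (1 + (1 + 1))) (f (Suc i))" for i
  proof (intro runs_Seq)
    have "cells y < d" "cells y \<noteq> d" "cells y \<noteq> Suc d" for y
      using Sum.prems(2) by (auto simp: fits_def dest: spec[where x = y])
    note this [simp] and this(2-) [symmetric, simp]
    have "fits (cells(x := Suc d)) (env(x := i)) (Suc (Suc d)) (f i)"
      using Sum.prems by (auto simp: fits_def f_def less_SucI)
    with Sum.IH[of "cells(x := Suc d)" "env(x := i)" "Suc (Suc d)" "f i"] Sum.prems
    show "runs (compile_expr e (cells(x := Suc d)) (Suc (Suc d))) (f i) (expr_cost e (mat_size s))
       (nats_upd ''T'' (Suc (Suc d)) (g i) (f i))"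
      by (simp add: f_def g_def del: fun_upd_apply)
    show "runs (setT d (NAdd (T d) (T (Suc (Suc d))))) (nats_upd ''T'' (Suc (Suc d)) (g i) (f i)) 1
       (nats_upd ''T'' d (sum g {..<Suc i}) (nats_upd ''T'' (Suc (Suc d)) (g i) (f i)))"
      by (rule runs_NSet) (auto simp: f_def)
    show "runs (setT (Suc (Suc d)) (NConst 0))
       (nats_upd ''T'' d (sum g {..<Suc i}) (nats_upd ''T'' (Suc (Suc d)) (g i) (f i))) 1
       (nats_upd ''T'' d (sum g {..<Suc i}) (f i))"
      by (rule runs_NSet, rule state_eqI) (use Sum.prems in \<open>auto simp: f_def fits_zero\<close>)
    show "runs (setT (Suc d) (NAdd (T (Suc d)) (NConst 1))) (nats_upd ''T'' d (sum g {..<Suc i}) (f i)) 1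
       (f (Suc i))"
      by (rule runs_NSet, rule state_eqI) (auto simp: f_def)
  qed
  have "runs (Loop (NLess (T (Suc d)) (NGet b (NConst 0)))
       (Seq (compile_expr e (cells(x := Suc d)) (Suc (Suc d)))
       (Seq (setT d (NAdd (T d) (T (Suc (Suc d)))))
       (Seq (setT (Suc (Suc d)) (NConst 0))
            (setT (Suc d) (NAdd (T (Suc d)) (NConst 1))))))) (f 0)
      (?N * (expr_cost e (mat_size s) + (1 + (1 + 1)) + 1) + 1) (f ?N)"
    by (rule runs_Loop, use b in \<open>simp add: f_def\<close>, rule step, use b in \<open>simp add: f_def\<close>)
  moreover have "runs (setT (Suc d) (NConst 0)) (f ?N) 1 (nats_upd ''T'' d (ev (Sum x b e) env s) s)"
    by (rule runs_NSet, rule state_eqI) (use Sum.prems in \<open>auto simp: f_def g_def fits_zero\<close>)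
  ultimately have "runs (compile_expr (Sum x b e) cells d) s
      (1 + (?N * (expr_cost e (mat_size s) + (1 + (1 + 1)) + 1) + 1 + 1)) (nats_upd ''T'' d (ev (Sum x b e) env s) s)"
    unfolding compile_expr.simps by (intro runs_Seq[OF init] runs_Seq)
  then show ?case
  proof (rule runs_weaken)
    have "?N \<le> mat_size s" using Sum.prems by (intro bound_le_mat_size) auto
    then have "?N * (expr_cost e (mat_size s) + 4) \<le> mat_size s * (expr_cost e (mat_size s) + 4)"
      by (rule mult_le_mono1)
    then show "1 + (?N * (expr_cost e (mat_size s) + (1 + (1 + 1)) + 1) + 1 + 1) \<le> expr_cost (Sum x b e) (mat_size s)"
      by (simp add: numeral_eq_Suc)
  qed
qed

lemma run_preserves:
  "wf_prog p \<Longrightarrow> a \<in> {''m'', ''n'', ''T''} \<Longrightarrow> nats (run p env s) a = nats s a"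
proof (induction p arbitrary: env s)
  case (For x b p)
  have "nats (fold (\<lambda>i. run p (env(x := i))) is s) a = nats s a" for "is"
    using For by (induction "is" arbitrary: s) auto
  then show ?case by simp
qed (auto simp: fun_eq_iff)

lemma mat_size_run: "wf_prog p \<Longrightarrow> mat_size (run p env s) = mat_size s"
  by (simp add: mat_size_def run_preserves)

lemma fits_run: "wf_prog p \<Longrightarrow> fits cells env d s \<Longrightarrow> fits cells env d (run p env' s)"
  by (simp add: fits_def run_preserves)

lemma runs_assign:
  assumes ef: "wf_expr e" "wf_expr f" and s: "fits cells env d s" "nats s ''T'' d = 0"
    and c: "runs c (nats_upd ''T'' (Suc d) (ev f env s) (nats_upd ''T'' d (ev e env s) s)) 1
              (nats_upd ''T'' (Suc d) (ev f env s) (nats_upd ''T'' d (ev e env s) s'))"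
    and s': "nats s' ''T'' = nats s ''T''"
  shows "runs (Seq (compile_expr e cells d) (Seq (compile_expr f cells (Suc d))
     (Seq c (Seq (setT (Suc d) (NConst 0)) (setT d (NConst 0)))))) s
      (expr_cost e (mat_size s) + (expr_cost f (mat_size s) + (1 + (1 + 1)))) s'"
proof (intro runs_Seq)
  show "runs (compile_expr e cells d) s (expr_cost e (mat_size s)) (nats_upd ''T'' d (ev e env s) s)"
    by (rule runs_compile_expr) (fact assms)+
  show "runs (compile_expr f cells (Suc d)) (nats_upd ''T'' d (ev e env s) s) (expr_cost f (mat_size s))
     (nats_upd ''T'' (Suc d) (ev f env s) (nats_upd ''T'' d (ev e env s) s))"
    using runs_compile_expr[of f cells env "Suc d" "nats_upd ''T'' d (ev e env s) s"] assms
    by (simp add: fits_upd fits_Suc)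
  show "runs (setT (Suc d) (NConst 0)) (nats_upd ''T'' (Suc d) (ev f env s) (nats_upd ''T'' d (ev e env s) s')) 1
     (nats_upd ''T'' d (ev e env s) s')"
    by (rule runs_NSet, rule state_eqI) (use s s' in \<open>auto simp: fits_zero\<close>)
  show "runs (setT d (NConst 0)) (nats_upd ''T'' d (ev e env s) s') 1 s'"
    by (rule runs_NSet, rule state_eqI) (use s s' in \<open>auto simp: fits_zero\<close>)
qed (fact c)

lemma runs_compile_prog:
  "wf_prog p \<Longrightarrow> fits cells env d s \<Longrightarrow> nats s ''T'' d = 0 \<Longrightarrow>
     runs (compile_prog p cells d) s (prog_cost p (mat_size s)) (run p env s)"
proof (induction p arbitrary: cells env d s)
  case (Upd a e f)
  have "runs (NSet a (T d) (T (Suc d)))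
     (nats_upd ''T'' (Suc d) (ev f env s) (nats_upd ''T'' d (ev e env s) s)) 1
     (nats_upd ''T'' (Suc d) (ev f env s) (nats_upd ''T'' d (ev e env s) (run (Upd a e f) env s)))"
    by (rule runs_NSet, rule state_eqI) (use Upd.prems in auto)
  from runs_assign[OF _ _ _ _ this] Upd.prems show ?case
    by (auto simp: fun_eq_iff numeral_eq_Suc)
next
  case (UpdR a e f)
  have "runs (RSet a (T d) (RGet ''S'' (T (Suc d))))
     (nats_upd ''T'' (Suc d) (ev f env s) (nats_upd ''T'' d (ev e env s) s)) 1
     (nats_upd ''T'' (Suc d) (ev f env s) (nats_upd ''T'' d (ev e env s) (run (UpdR a e f) env s)))"
    by (rule runs_RSet, rule state_eqI) (use UpdR.prems in auto)
  from runs_assign[OF _ _ _ _ this] UpdR.prems show ?case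
    by (auto simp: fun_eq_iff numeral_eq_Suc)
next
  case (Then p q)
  then have "runs (compile_prog q cells d) (run p env s) (prog_cost q (mat_size s)) (run q env (run p env s))"
    using Then.IH(2)[of cells env d "run p env s"] by (simp add: mat_size_run fits_run run_preserves)
  with Then show ?case by (auto intro!: runs_Seq)
next
  case (If b p)
  let ?r = "nats_upd ''T'' d (ev b env s) s"
  have "runs (setT d (NConst 0)) ?r 1 s"
    by (rule runs_NSet, rule state_eqI) (use If.prems in auto)
  moreover have "?r = s" if "ev b env s = 0"
    by (rule state_eqI) (use If.prems that in auto)
  ultimately have "runs (Cond (NEq (T d) (NConst 0)) Skip (Seq (setT d (NConst 0)) (compile_prog p cells d)))
     ?r (max 1 (1 + prog_cost p (mat_size s)) + 1) (run (If b p) env s)"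
    using If.IH[of cells env d s] If.prems runs_Skip[of s]
    by (intro runs_Cond) (auto intro!: runs_Seq[of _ _ 1, simplified])
  from runs_Seq[OF runs_compile_expr[of b cells env d s] this] If.prems
  have "runs (compile_prog (If b p) cells d) s
      (expr_cost b (mat_size s) + (max 1 (1 + prog_cost p (mat_size s)) + 1)) (run (If b p) env s)"
    by simp
  then show ?case by (rule runs_weaken) simp
next
  case (For x b p)
  let ?N = "nats s b 0"
  have b: "b \<noteq> ''T''" "b \<in> {''m'', ''n''}" using For.prems by auto
  \<comment> \<open>\<open>g\<close> follows the source program, \<open>f\<close> the machine, which
    carries the loop counter in addition.\<close>
  define g where "g = (\<lambda>i. fold (\<lambda>i. run p (env(x := i))) [0..<i] s)"
  define f where "f = (\<lambda>i. nats_upd ''T'' d i (g i))"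
  have g_pres: "nats (g i) a = nats s a" if "a \<in> {''m'', ''n'', ''T''}" for a i
    by (induction i) (use that For.prems in \<open>auto simp: g_def run_preserves\<close>)
  have gb: "nats (g i) b 0 = ?N" for i using b(2) g_pres by auto
  have Kg: "mat_size (g i) = mat_size s" for i by (simp add: mat_size_def g_pres)
  have f0: "f 0 = s"
    by (rule state_eqI) (use For.prems in \<open>auto simp: f_def g_def\<close>)
  \<comment> \<open>The counter is present while the body runs, so running the body has to commute
    with changes to scratch memory.\<close>
  have run_upd: "run p env' (nats_upd ''T'' d i s') = nats_upd ''T'' d i (run p env' s')" for env' i s'
  proof -
    have "wf_prog p" using For.prems by simp
    then show ?thesis
    proof (induction p arbitrary: env' s')
      case (For x b p)
      have "fold (\<lambda>i. run p (env'(x := i))) is (nats_upd ''T'' d i s') =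
        nats_upd ''T'' d i (fold (\<lambda>i. run p (env'(x := i))) is s')" for "is"
        using For by (induction "is" arbitrary: s') auto
      with For.prems show ?case by auto
    qed (auto intro!: state_eqI)
  qed
  have step: "runs (Seq (compile_prog p (cells(x := d)) (Suc d)) (setT d (NAdd (T d) (NConst 1)))) (f i)
     (prog_cost p (mat_size s) + 1) (f (Suc i))" for i
  proof (rule runs_Seq)
    have "cells y < d" "cells y \<noteq> d" for y
      using For.prems(2) by (auto simp: fits_def dest: spec[where x = y])
    note this [simp] and this(2-) [symmetric, simp]
    have "fits (cells(x := d)) (env(x := i)) (Suc d) (f i)"
      using For.prems by (auto simp: fits_def f_def g_pres less_SucI)
    moreover have "nats (f i) ''T'' (Suc d) = 0"
      using For.prems by (auto simp: f_def g_pres fits_zero)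
    moreover have Kf: "mat_size (f i) = mat_size s" by (simp add: f_def Kg)
    moreover have run_f: "run p (env(x := i)) (f i) = nats_upd ''T'' d i (g (Suc i))"
      by (simp add: f_def run_upd g_def)
    ultimately have "runs (compile_prog p (cells(x := d)) (Suc d)) (f i) (prog_cost p (mat_size (f i))) (run p (env(x := i)) (f i))"
      using For.prems(1) by (intro For.IH) (simp_all del: fun_upd_apply)
    then show "runs (compile_prog p (cells(x := d)) (Suc d)) (f i) (prog_cost p (mat_size s)) (nats_upd ''T'' d i (g (Suc i)))"
      using Kf run_f by simp
    show "runs (setT d (NAdd (T d) (NConst 1))) (nats_upd ''T'' d i (g (Suc i))) 1 (f (Suc i))"
      by (rule runs_NSet, rule state_eqI) (auto simp: f_def)
  qed
  have "runs (Loop (NLess (T d) (NGet b (NConst 0)))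
       (Seq (compile_prog p (cells(x := d)) (Suc d)) (setT d (NAdd (T d) (NConst 1))))) (f 0)
      (?N * (prog_cost p (mat_size s) + 1 + 1) + 1) (f ?N)"
    by (rule runs_Loop, use b gb in \<open>simp add: f_def g_pres\<close>, rule step,
        use b gb in \<open>simp add: f_def g_pres\<close>)
  moreover have "runs (setT d (NConst 0)) (f ?N) 1 (g ?N)"
    by (rule runs_NSet, rule state_eqI) (use For.prems in \<open>auto simp: f_def g_pres\<close>)
  ultimately have "runs (compile_prog (For x b p) cells d) s (?N * (prog_cost p (mat_size s) + 1 + 1) + 1 + 1) (run (For x b p) env s)"
    unfolding compile_prog.simps f0 by (auto simp: g_def intro!: runs_Seq[of _ _ "Suc _" _ _ 1, simplified])
  then show ?case
  proof (rule runs_weaken)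
    have "?N * (prog_cost p (mat_size s) + 2) \<le> mat_size s * (prog_cost p (mat_size s) + 2)"
      using bound_le_mat_size[OF b(2)] by (rule mult_le_mono1)
    then show "?N * (prog_cost p (mat_size s) + 1 + 1) + 1 + 1 \<le> prog_cost (For x b p) (mat_size s)"
      by (simp add: numeral_eq_Suc)
  qed
qed

section \<open>Polynomial bounds for the costs\<close>

definition poly_bounded :: "(nat \<Rightarrow> nat) \<Rightarrow> bool" where
  "poly_bounded f \<longleftrightarrow> (\<exists>c d. \<forall>N. f N \<le> c * (N + 1) ^ d)"

lemma poly_bounded_const: "poly_bounded (\<lambda>_. k)"
  unfolding poly_bounded_def by (intro exI[of _ k] exI[of _ 0]) simp

lemma poly_bounded_add:
  assumes "poly_bounded f" "poly_bounded g"
  shows "poly_bounded (\<lambda>N. f N + g N)"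
proof -
  obtain a d b e where *: "\<And>N. f N \<le> a * (N + 1) ^ d" "\<And>N. g N \<le> b * (N + 1) ^ e"
    using assms unfolding poly_bounded_def by blast
  have "f N + g N \<le> (a + b) * (N + 1) ^ (d + e)" for N
  proof -
    have "f N \<le> a * (N + 1) ^ (d + e)"
      by (rule order_trans[OF *(1)]) (intro mult_le_mono2 power_increasing; simp)
    moreover have "g N \<le> b * (N + 1) ^ (d + e)"
      by (rule order_trans[OF *(2)]) (intro mult_le_mono2 power_increasing; simp)
    ultimately show ?thesis by (simp add: distrib_right)
  qed
  then show ?thesis unfolding poly_bounded_def by blast
qed

lemma poly_bounded_mult_id:
  assumes "poly_bounded f"
  shows "poly_bounded (\<lambda>N. N * f N)"
proof -
  obtain a d where *: "\<And>N. f N \<le> a * (N + 1) ^ d"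
    using assms unfolding poly_bounded_def by blast
  have "N * f N \<le> a * (N + 1) ^ (d + 1)" for N
    using mult_le_mono[of N "N + 1" "f N", OF _ *[of N]] by (simp add: mult.left_commute mult.commute)
  then show ?thesis unfolding poly_bounded_def by blast
qed

lemmas poly_bounded_intros = poly_bounded_const poly_bounded_add poly_bounded_mult_id

lemma poly_bounded_expr_cost: "poly_bounded (expr_cost e)"
proof (induction e)
qed (simp_all only: expr_cost.simps[abs_def], (intro poly_bounded_intros; assumption)+)

lemma poly_bounded_prog_cost: "poly_bounded (prog_cost p)"
proof (induction p)
qed (simp_all only: prog_cost.simps[abs_def],
   (intro poly_bounded_intros poly_bounded_expr_cost; assumption)+)

theorem compiled_polynomial_time:
  assumes "wf_prog p"
  obtains prog c d where
    "\<And>m n S. S \<in> carrier_mat m n \<Longrightarrow>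
       \<exists>t. exec prog (input_state S) t (run p (\<lambda>_. 0) (input_state S)) \<and> t \<le> c * (m + n + 1) ^ d"
proof -
  obtain c d where cd: "\<And>N. prog_cost p N \<le> c * (N + 1) ^ d"
    using poly_bounded_prog_cost[of p] unfolding poly_bounded_def by blast
  show thesis
  proof
    fix m n and S :: "real mat" assume S: "S \<in> carrier_mat m n"
    \<comment> \<open>At the start every variable is assigned cell 0, which holds 0 like the initial
      environment; depth 1 keeps this cell free of other uses.\<close>
    have "fits (\<lambda>_. 0) (\<lambda>_. 0) 1 (input_state S)"
      by (auto simp: fits_def input_state_def)
    from runs_compile_prog[OF assms this] obtain t
      where t: "t \<le> prog_cost p (mat_size (input_state S))"
        "exec (compile_prog p (\<lambda>_. 0) 1) (input_state S) t (run p (\<lambda>_. 0) (input_state S))"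
      by (auto simp: runs_def input_state_def)
    have "mat_size (input_state S) = m + n + 1" using S by (auto simp: mat_size_def input_state_def)
    \<comment> \<open>\<open>mat_size\<close> contains one summand 1 and the polynomial bound adds
      another; the factor \<open>2 ^ d\<close> absorbs it.\<close>
    with t(1) have "t \<le> c * (m + n + 1 + 1) ^ d" using cd[of "m + n + 1"] by simp
    also have "\<dots> \<le> c * (2 * (m + n + 1)) ^ d" by (intro mult_le_mono2 power_mono) auto
    also have "\<dots> = c * 2 ^ d * (m + n + 1) ^ d" by (simp only: power_mult_distrib mult.assoc)
    finally have "t \<le> c * 2 ^ d * (m + n + 1) ^ d" .
    with t(2) show "\<exists>t. exec (compile_prog p (\<lambda>_. 0) 1) (input_state S) t (run p (\<lambda>_. 0) (input_state S)) \<and>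
        t \<le> c * 2 ^ d * (m + n + 1) ^ d" by blast
  qed
qed

section \<open>Expressions for the tests\<close>

definition tt :: "expr \<Rightarrow> (string \<Rightarrow> nat) \<Rightarrow> state \<Rightarrow> bool" where
  "tt e env s \<longleftrightarrow> ev e env s \<noteq> 0"

lemma ev_pos: "0 < ev e env s \<longleftrightarrow> tt e env s"
  by (simp add: tt_def)

definition neg :: "expr \<Rightarrow> expr" where "neg e = Ite e (Num 0) (Num 1)"
definition conj :: "expr \<Rightarrow> expr \<Rightarrow> expr" where "conj e f = Ite e f (Num 0)"
definition disj :: "expr \<Rightarrow> expr \<Rightarrow> expr" where "disj e f = Ite e (Num 1) f"
definition imp :: "expr \<Rightarrow> expr \<Rightarrow> expr" where "imp e f = Ite e f (Num 1)"
text \<open>Truncated subtraction is nonzero exactly on strict inequality; \<open>eq\<close> tests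
  that it vanishes in both directions.\<close>

definition lt :: "expr \<Rightarrow> expr \<Rightarrow> expr" where "lt e f = Sub f e"
definition eq :: "expr \<Rightarrow> expr \<Rightarrow> expr" where "eq e f = neg (Add (Sub e f) (Sub f e))"
definition count :: "string \<Rightarrow> string \<Rightarrow> expr \<Rightarrow> expr" where "count x b e = Sum x b (Ite e (Num 1) (Num 0))"
definition exi :: "string \<Rightarrow> string \<Rightarrow> expr \<Rightarrow> expr" where "exi x b e = Sum x b e"
definition all :: "string \<Rightarrow> string \<Rightarrow> expr \<Rightarrow> expr" where "all x b e = neg (exi x b (neg e))"

lemma sum_if_const: "(\<Sum>i<N. if P i then c else 0) = card {i. i < N \<and> P i} * (c :: nat)" for N :: nat
proof -
  have "(\<Sum>i<N. if P i then c else 0) = (\<Sum>i\<in>{i. i < N \<and> P i}. c)"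
    by (intro sum.mono_neutral_cong_right) auto
  then show ?thesis by simp
qed

lemma tt_simps [simp]:
  "tt (Num k) env s \<longleftrightarrow> k \<noteq> 0"
  "tt (neg e) env s \<longleftrightarrow> \<not> tt e env s"
  "tt (conj e f) env s \<longleftrightarrow> tt e env s \<and> tt f env s"
  "tt (disj e f) env s \<longleftrightarrow> tt e env s \<or> tt f env s"
  "tt (imp e f) env s \<longleftrightarrow> (tt e env s \<longrightarrow> tt f env s)"
  "tt (lt e f) env s \<longleftrightarrow> ev e env s < ev f env s"
  "tt (Ite c e f) env s \<longleftrightarrow> (if tt c env s then tt e env s else tt f env s)"
  "tt (eq e f) env s \<longleftrightarrow> ev e env s = ev f env s"
  "tt (exi x b e) env s \<longleftrightarrow> (\<exists>i<nats s b 0. tt e (env(x := i)) s)"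
  "tt (all x b e) env s \<longleftrightarrow> (\<forall>i<nats s b 0. tt e (env(x := i)) s)"
  "tt (Get a e) env s \<longleftrightarrow> nats s a (ev e env s) \<noteq> 0"
  "tt (SEq e f) env s \<longleftrightarrow> reals s ''S'' (ev e env s) = reals s ''S'' (ev f env s)"
  "tt (SIs e f) env s \<longleftrightarrow> reals s ''S'' (ev e env s) = real (ev f env s)"
  by (auto simp: tt_def neg_def conj_def disj_def imp_def lt_def eq_def exi_def all_def)

lemma ev_eq [simp]: "ev (eq e f) env s = of_bool (ev e env s = ev f env s)"
  by (auto simp: eq_def neg_def)

lemma ev_count [simp]: "ev (count x b e) env s = card {i. i < nats s b 0 \<and> tt e (env(x := i)) s}"
  by (simp add: count_def ev_pos sum_if_const cong: if_cong)

text \<open>Products have to be written as repeated sums, so one factor must be at most the number of rows. The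
  analogous restriction in \<open>dvd_expr\<close> is that the dividend is at most the number of columns.\<close>

definition times :: "expr \<Rightarrow> expr \<Rightarrow> expr" where
  "times e f = Sum ''h'' ''m'' (Ite (lt (Var ''h'') e) f (Num 0))"

text \<open>A product of two column counts is obtained as a number of pairs, because neither factor
  need be bounded by the number of rows as \<open>times\<close> demands.\<close>

definition count_pairs :: "expr \<Rightarrow> expr \<Rightarrow> expr" where
  "count_pairs P Q = Sum ''c'' ''n'' (Ite P (count ''d'' ''n'' Q) (Num 0))"

definition dvd_expr :: "expr \<Rightarrow> expr \<Rightarrow> expr" where
  "dvd_expr d N = disj (eq N (Num 0))
     (exi ''q'' ''n'' (eq (Sum ''h'' ''n'' (Ite (lt (Var ''q'') (Var ''h'')) (Num 0) d)) N))"

text \<open>Evaluating both arguments under every value of \<open>h\<close> expresses that the bound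
  variable captures nothing in them.\<close>

lemma ev_times:
  assumes "\<And>i. ev e (env(''h'' := i)) s = E" "\<And>i. ev f (env(''h'' := i)) s = F" "E \<le> nats s ''m'' 0"
  shows "ev (times e f) env s = E * F"
proof -
  have "{i. i < nats s ''m'' 0 \<and> i < E} = {..<E}" using assms(3) by auto
  then show ?thesis
    using assms(1,2) by (simp add: times_def sum_if_const ev_pos cong: if_cong)
qed

lemma ev_count_pairs:
  assumes P: "\<And>a. a < nats s ''n'' 0 \<Longrightarrow> tt P (env(''c'' := a)) s \<longleftrightarrow> a \<in> P'"
    and Q: "\<And>a b. b < nats s ''n'' 0 \<Longrightarrow> tt Q (env(''c'' := a, ''d'' := b)) s \<longleftrightarrow> b \<in> Q'"
    and sub: "P' \<subseteq> {..<nats s ''n'' 0}" "Q' \<subseteq> {..<nats s ''n'' 0}"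
  shows "ev (count_pairs P Q) env s = card P' * card Q'"
proof -
  have eqs: "{a. a < nats s ''n'' 0 \<and> tt P (env(''c'' := a)) s} = P'"
    "{b. b < nats s ''n'' 0 \<and> tt Q (env(''c'' := a, ''d'' := b)) s} = Q'" for a
    using P Q sub by auto
  show ?thesis
    by (simp add: count_pairs_def ev_pos sum_if_const eqs del: fun_upd_apply cong: if_cong)
qed

lemma tt_dvd_expr:
  assumes d: "\<And>q h. ev d (env(''q'' := q, ''h'' := h)) s = D"
    and N: "ev N env s = N'" "\<And>q. ev N (env(''q'' := q)) s = N'" "N' \<le> nats s ''n'' 0"
  shows "tt (dvd_expr d N) env s \<longleftrightarrow> D dvd N'"
proof -
  have sum: "(\<Sum>h<nats s ''n'' 0. if q < h then 0 else D) = Suc q * D" if "q < nats s ''n'' 0" for q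
  proof -
    have "(\<Sum>h<nats s ''n'' 0. if q < h then 0 else D) = (\<Sum>h<nats s ''n'' 0. if h \<le> q then D else 0)"
      by (intro sum.cong) auto
    also have "{i. i < nats s ''n'' 0 \<and> i \<le> q} = {..q}" using that by auto
    then have "(\<Sum>h<nats s ''n'' 0. if h \<le> q then D else 0) = Suc q * D" by (simp add: sum_if_const)
    finally show ?thesis .
  qed
  \<comment> \<open>The multiplier found is \<open>Suc q\<close> with \<open>q\<close> below the
    number of columns; quotient 0 is covered by the case of a zero dividend.\<close>
  have "tt (dvd_expr d N) env s \<longleftrightarrow> N' = 0 \<or> (\<exists>q<nats s ''n'' 0. Suc q * D = N')"
    using sum by (simp add: dvd_expr_def d N ev_pos cong: if_cong conj_cong)
  also have "\<dots> \<longleftrightarrow> D dvd N'"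
  proof
    assume "D dvd N'"
    then obtain q where q: "N' = q * D" by (metis dvdE mult.commute)
    show "N' = 0 \<or> (\<exists>q<nats s ''n'' 0. Suc q * D = N')"
    proof (cases "N' = 0")
      case False
      with q have "q \<le> N'" "q \<noteq> 0" by auto
      with N(3) q show ?thesis by (intro disjI2 exI[of _ "q - 1"] conjI) (linarith, simp)
    qed simp
  qed auto
  finally show ?thesis .
qed

abbreviation rr :: expr where "rr \<equiv> Get ''r'' (Num 0)"

text \<open>Nothing prevents capture, so nested expressions have to use different bound variables.\<close>

definition addr :: "expr \<Rightarrow> string \<Rightarrow> expr" where
  "addr e k = Add (times e (Get ''n'' (Num 0))) (Var k)"

text \<open>Sets of rows are given by conditions on the variable \<open>i\<close>;
  \<open>Num 0\<close> stands for the empty set, so that \<open>agree (Num 0)\<close> compares row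
  \<open>r\<close> only.\<close>

definition agree :: "expr \<Rightarrow> string \<Rightarrow> string \<Rightarrow> expr" where
  "agree e k l = all ''i'' ''m'' (imp (disj (eq (Var ''i'') rr) e)
     (SEq (addr (Var ''i'') k) (addr (Var ''i'') l)))"

definition indep :: "expr \<Rightarrow> expr \<Rightarrow> expr" where
  "indep e f = all ''k'' ''n'' (all ''l'' ''n'' (imp (agree (Num 0) ''l'' ''k'')
     (eq (count_pairs (conj (agree e ''c'' ''k'') (agree f ''c'' ''l'')) (agree (Num 0) ''d'' ''k''))
         (count_pairs (agree e ''c'' ''k'') (agree f ''d'' ''l'')))))"

definition inA :: expr where "inA = Get ''A'' (Var ''i'')"
definition before :: expr where "before = conj (neg (lt (Var ''j'') (Var ''i''))) (neg inA)"

definition obstacle_expr :: expr where "obstacle_expr = count ''j'' ''m'' (indep inA before)"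

definition special_expr :: expr where
  "special_expr = conj (all ''k'' ''n'' (disj (SIs (addr rr ''k'') (Num 0)) (SIs (addr rr ''k'') (Num 1))))
     (conj (exi ''k'' ''n'' (SIs (addr rr ''k'') (Num 0))) (exi ''k'' ''n'' (SIs (addr rr ''k'') (Num 1))))"

definition splitting_expr :: expr where
  "splitting_expr = conj special_expr (conj (neg (Get ''A'' rr)) (conj (exi ''i'' ''m'' inA)
     (conj (exi ''i'' ''m'' (neg (disj (eq (Var ''i'') rr) inA))) (indep inA (neg inA)))))"

text \<open>The gcd as a count: a number \<open>e\<close> is below the gcd exactly if some common
  divisor \<open>g + 1\<close> exceeds it.\<close>

definition gcd_expr :: "string \<Rightarrow> expr" where
  "gcd_expr k = count ''e'' ''n'' (exi ''g'' ''n'' (conj (neg (lt (Var ''g'') (Var ''e'')))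
     (all ''c'' ''n'' (imp (agree (Num 0) ''c'' k)
        (dvd_expr (Add (Var ''g'') (Num 1)) (count ''d'' ''n'' (agree inA ''d'' ''c'')))))))"

definition rank_expr :: "expr \<Rightarrow> string \<Rightarrow> expr" where
  "rank_expr e k = count ''c'' ''n'' (conj (lt (Var ''c'') (Var k)) (agree e ''c'' k))"

definition keep1 :: "string \<Rightarrow> expr" where
  "keep1 k = dvd_expr (gcd_expr k) (rank_expr inA k)"

definition size_expr :: "string \<Rightarrow> expr" where
  "size_expr k = count ''f'' ''n'' (conj (keep1 ''f'') (agree (Num 0) ''f'' k))"

definition keep2 :: "string \<Rightarrow> expr" where
  "keep2 k = dvd_expr (size_expr k) (rank_expr (neg inA) k)"

section \<open>Meaning of the expressions in a state that stores \<open>S\<close>, \<open>r\<close>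
  and \<open>A\<close>\<close>

locale search_state = nat_table "\<lambda>i j. S $$ (i, j)" "dim_col S" r "dim_row S"
  for S :: "real mat" and r +
  fixes s :: state and A :: "nat set"
  assumes m [simp]: "nats s ''m'' 0 = dim_row S" and n [simp]: "nats s ''n'' 0 = dim_col S"
    and S_cells: "\<And>i j. i < dim_row S \<Longrightarrow> j < dim_col S \<Longrightarrow> reals s ''S'' (i * dim_col S + j) = S $$ (i, j)"
    and r [simp]: "nats s ''r'' 0 = r" and r_less [simp]: "r < dim_row S"
    and A: "A = {i. i < dim_row S \<and> nats s ''A'' i \<noteq> 0}"
begin

lemma S_addr:
  assumes "\<And>h. ev e (env(''h'' := h)) s = i" "i < dim_row S" "env k < dim_col S"
  shows "reals s ''S'' (ev (addr e k) env s) = S $$ (i, env k)"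
proof -
  have "ev (times e (Get ''n'' (Num 0))) env s = i * dim_col S"
    using assms by (intro ev_times) auto
  with assms show ?thesis by (simp add: addr_def S_cells)
qed

text \<open>The value of \<open>j\<close> is fixed while all other variables are arbitrary:
  \<open>before\<close> depends on \<open>j\<close>, and the evaluation of \<open>indep\<close>
  changes the rest.\<close>

definition denotes :: "expr \<Rightarrow> nat \<Rightarrow> nat set \<Rightarrow> bool" where
  "denotes e j X \<longleftrightarrow> X \<subseteq> {..<dim_row S} \<and>
     (\<forall>env. env ''j'' = j \<longrightarrow> env ''i'' < dim_row S \<longrightarrow> (tt e env s \<longleftrightarrow> env ''i'' \<in> X))"

lemma denotes_basic:
  "denotes (Num 0) j {}" "denotes inA j A" "denotes (neg inA) j ({..<dim_row S} - A)"
  by (auto simp: denotes_def inA_def A)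

lemma denotes_before: "j < dim_row S \<Longrightarrow> denotes before j {i. i \<le> j \<and> i \<notin> A}"
  by (auto simp: denotes_def before_def inA_def A)

lemma tt_agree:
  assumes "denotes e (env ''j'') X" "k \<notin> {''h'', ''i''}" "l \<notin> {''h'', ''i''}"
    "env k < dim_col S" "env l < dim_col S"
  shows "tt (agree e k l) env s \<longleftrightarrow> env k \<in> cls X (env l)"
proof -
  have "tt (agree e k l) env s \<longleftrightarrow> (\<forall>i<dim_row S. i = r \<or> i \<in> X \<longrightarrow> S $$ (i, env k) = S $$ (i, env l))"
    using assms by (auto simp: agree_def denotes_def S_addr)
  also have "\<dots> \<longleftrightarrow> env k \<in> cls X (env l)"
    using assms r_less by (auto simp: cls_def denotes_def dest: spec[where x = r])
  finally show ?thesis .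
qed

lemma tt_indep:
  assumes "denotes e (env ''j'') X" "denotes f (env ''j'') Y"
  shows "tt (indep e f) env s \<longleftrightarrow> cond_indep X Y"
proof -
  have cls_Collect: "{a. a < dim_col S \<and> a \<in> cls Z k} = cls Z k"
     "{a. a < dim_col S \<and> a \<in> cls Z k \<and> a \<in> cls Z' l} = cls Z k \<inter> cls Z' l" for Z Z' k l
    using cls_subset by auto
  have "tt (indep e f) env s \<longleftrightarrow>
     (\<forall>k<dim_col S. \<forall>l<dim_col S. l \<in> cls {} k \<longrightarrow>
        card (cls X k \<inter> cls Y l) * card (cls {} k) = card (cls X k) * card (cls Y l))"
    (is "_ \<longleftrightarrow> (\<forall>k<_. \<forall>l<_. ?L k l)")
    unfolding indep_def tt_simps m n
  proof (intro all_cong imp_cong refl)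
    fix k l assume k: "k < dim_col S" "l < dim_col S"
    let ?env = "env(''k'' := k, ''l'' := l)"
    show "tt (agree (Num 0) ''l'' ''k'') ?env s \<longleftrightarrow> l \<in> cls {} k"
      using k by (subst tt_agree) (auto simp: denotes_basic)
    have sub: "cls Z k' \<subseteq> {..<nats s ''n'' 0}" "cls Z k' \<inter> cls Z' l' \<subseteq> {..<nats s ''n'' 0}" for Z Z' k' l'
      using cls_subset by auto
    have "ev (count_pairs (conj (agree e ''c'' ''k'') (agree f ''c'' ''l'')) (agree (Num 0) ''d'' ''k'')) ?env s
        = card (cls X k \<inter> cls Y l) * card (cls {} k)"
      by (intro ev_count_pairs sub) (use k assms in \<open>auto simp: tt_agree tt_agree[OF denotes_basic(1)]\<close>)
    moreover have "ev (count_pairs (agree e ''c'' ''k'') (agree f ''d'' ''l'')) ?env s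
        = card (cls X k) * card (cls Y l)"
      by (intro ev_count_pairs sub) (use k assms in \<open>auto simp: tt_agree\<close>)
    ultimately show "ev (count_pairs (conj (agree e ''c'' ''k'') (agree f ''c'' ''l'')) (agree (Num 0) ''d'' ''k'')) ?env s
        = ev (count_pairs (agree e ''c'' ''k'') (agree f ''d'' ''l'')) ?env s \<longleftrightarrow>
       card (cls X k \<inter> cls Y l) * card (cls {} k) = card (cls X k) * card (cls Y l)"
      by simp
  qed
  moreover have "l < dim_col S" if "l \<in> cls {} k" for k l using that cls_subset by blast
  ultimately show ?thesis unfolding cond_indep_def by auto
qed

lemma ev_obstacle: "ev obstacle_expr env s = obstacle A"
  unfolding obstacle_expr_def obstacle_def ev_count m
  by (intro arg_cong[where f = card] Collect_cong conj_cong refl tt_indep denotes_basic)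
     (simp add: denotes_before)

lemma tt_splitting: "tt splitting_expr env s \<longleftrightarrow> splitting S r A"
proof -
  have special: "tt special_expr env s \<longleftrightarrow> special_row S r"
    by (auto simp: special_expr_def special_row_def S_addr)
  have indep: "tt (indep inA (neg inA)) env s \<longleftrightarrow> cond_indep A ({..<dim_row S} - A)"
    by (intro tt_indep denotes_basic)
  have "tt splitting_expr env s \<longleftrightarrow> special_row S r \<and> r \<notin> A \<and> (\<exists>i<dim_row S. i \<in> A)
      \<and> (\<exists>i<dim_row S. i \<noteq> r \<and> i \<notin> A) \<and> cond_indep A ({..<dim_row S} - A)"
    unfolding splitting_expr_def tt_simps(2-4,8,9) special indep by (simp add: inA_def A cong: conj_cong)
  moreover have "A \<subseteq> {..<dim_row S}" by (auto simp: A)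
  then have "A \<subseteq> {..<dim_row S} - {r} \<longleftrightarrow> r \<notin> A" "A \<noteq> {} \<longleftrightarrow> (\<exists>i<dim_row S. i \<in> A)"
    "insert r A \<noteq> {..<dim_row S} \<longleftrightarrow> (\<exists>i<dim_row S. i \<noteq> r \<and> i \<notin> A)"
    using r_less by auto
  ultimately show ?thesis by (simp only: splitting_def)
qed

lemma card_cls_le: "card (cls X k) \<le> dim_col S"
  using card_mono[OF _ cls_subset[of X k]] by simp

text \<open>Class sizes are at most the number of columns, so every common divisor is within the
  range of the bounded search. The excluded names are bound inside the expression.\<close>

lemma ev_gcd:
  assumes "k \<notin> {''c'', ''d'', ''e'', ''g'', ''h'', ''i''}" "env k < dim_col S"
  shows "ev (gcd_expr k) env s = common_mult A (env k)"
proof -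
  let ?G = "common_mult A (env k)"
  have G: "?G \<le> dim_col S" "0 < ?G"
    using common_mult_dvd[of "env k" "env k" A] card_cls_le[of A "env k"] cls_self[of "env k" "{}"]
      card_cls_pos[of "env k" A] common_mult_pos[OF assms(2)] assms(2)
    by (auto dest!: dvd_imp_le)
  have ev_card: "ev (count ''d'' ''n'' (agree inA ''d'' ''c'')) env' s = card (cls A (env' ''c''))"
    if "env' ''c'' < dim_col S" for env'
  proof -
    have "{d. d < dim_col S \<and> tt (agree inA ''d'' ''c'') (env'(''d'' := d)) s} = cls A (env' ''c'')"
      using that cls_subset[of A "env' ''c''"] by (auto simp: tt_agree[OF denotes_basic(2)])
    then show ?thesis by simp
  qed
  have dvd: "tt (all ''c'' ''n'' (imp (agree (Num 0) ''c'' k)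
        (dvd_expr (Add (Var ''g'') (Num 1)) (count ''d'' ''n'' (agree inA ''d'' ''c'')))))
      (env(''e'' := e, ''g'' := g)) s \<longleftrightarrow> Suc g dvd ?G" for e g
  proof -
    have "tt (dvd_expr (Add (Var ''g'') (Num 1)) (count ''d'' ''n'' (agree inA ''d'' ''c'')))
      (env(''e'' := e, ''g'' := g, ''c'' := c)) s \<longleftrightarrow> Suc g dvd card (cls A c)" if "c < dim_col S" for c
      by (rule tt_dvd_expr) (use that in \<open>simp_all add: ev_card card_cls_le del: ev_count\<close>)
    then have "tt (all ''c'' ''n'' (imp (agree (Num 0) ''c'' k)
        (dvd_expr (Add (Var ''g'') (Num 1)) (count ''d'' ''n'' (agree inA ''d'' ''c'')))))
      (env(''e'' := e, ''g'' := g)) s \<longleftrightarrow> (\<forall>c<dim_col S. c \<in> cls {} (env k) \<longrightarrow> Suc g dvd card (cls A c))"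
      using assms by (simp add: tt_agree[OF denotes_basic(1)])
    also have "\<dots> \<longleftrightarrow> Suc g dvd ?G"
      using cls_subset[of "{}" "env k"] by (auto simp: common_mult_def dvd_Gcd_iff)
    finally show ?thesis .
  qed
  have "{e. e < dim_col S \<and> (\<exists>g<dim_col S. e \<le> g \<and> Suc g dvd ?G)} = {..<?G}"
  proof (intro equalityI subsetI)
    fix e assume "e \<in> {..<?G}"
    with G have "e \<le> ?G - 1" "?G - 1 < dim_col S" "Suc (?G - 1) dvd ?G" by auto
    then show "e \<in> {e. e < dim_col S \<and> (\<exists>g<dim_col S. e \<le> g \<and> Suc g dvd ?G)}"
      by (auto intro: le_less_trans)
  qed (use G(2) in \<open>auto dest!: dvd_imp_le\<close>)
  then show ?thesis
    by (simp only: gcd_expr_def ev_count n tt_simps(2,3,6,9) dvd) (simp add: not_less)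
qed

lemma ev_rank:
  assumes "denotes e (env ''j'') X" "k \<notin> {''c'', ''h'', ''i''}" "env k < dim_col S"
  shows "ev (rank_expr e k) env s = rank (cls X (env k)) (env k)"
proof -
  have "{c. c < dim_col S \<and> tt (conj (lt (Var ''c'') (Var k)) (agree e ''c'' k)) (env(''c'' := c)) s}
      = {c \<in> cls X (env k). c < env k}"
    using assms cls_subset[of X "env k"] by (auto simp: tt_agree[of e _ X])
  then show ?thesis by (simp only: rank_expr_def rank_def ev_count n)
qed

lemma rank_le: "rank (cls X k) l \<le> dim_col S"
  unfolding rank_def using card_mono[of "{..<dim_col S}" "{a \<in> cls X k. a < l}"] cls_subset[of X k] by auto

lemma tt_keep1:
  assumes "k \<notin> {''c'', ''d'', ''e'', ''g'', ''h'', ''i'', ''q''}" "env k < dim_col S"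
  shows "tt (keep1 k) env s \<longleftrightarrow> env k \<in> keep (common_mult A) A"
proof -
  have "tt (keep1 k) env s \<longleftrightarrow> common_mult A (env k) dvd rank (cls A (env k)) (env k)"
    unfolding keep1_def
    by (rule tt_dvd_expr) (use assms in \<open>simp_all add: ev_gcd ev_rank[OF denotes_basic(2)] rank_le\<close>)
  with assms show ?thesis by (simp add: keep_def)
qed

lemma ev_size:
  assumes "k \<notin> {''c'', ''d'', ''e'', ''f'', ''g'', ''h'', ''i'', ''q''}" "env k < dim_col S"
  shows "ev (size_expr k) env s = kept_size A (env k)"
proof -
  have "{f. f < dim_col S \<and> tt (keep1 ''f'') (env(''f'' := f)) s \<and> tt (agree (Num 0) ''f'' k) (env(''f'' := f)) s}
      = keep (common_mult A) A \<inter> cls {} (env k)"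
    using assms by (auto simp: tt_keep1 tt_agree[OF denotes_basic(1)] keep_def)
  then show ?thesis by (simp add: size_expr_def kept_size_def)
qed

lemma tt_keep2:
  assumes "k \<notin> {''c'', ''d'', ''e'', ''f'', ''g'', ''h'', ''i'', ''q''}" "env k < dim_col S"
  shows "tt (keep2 k) env s \<longleftrightarrow> env k \<in> keep (kept_size A) ({..<dim_row S} - A)"
proof -
  have "tt (keep2 k) env s \<longleftrightarrow> kept_size A (env k) dvd rank (cls ({..<dim_row S} - A) (env k)) (env k)"
    unfolding keep2_def
    by (rule tt_dvd_expr) (use assms in \<open>simp_all add: ev_size ev_rank[OF denotes_basic(3)] rank_le\<close>)
  with assms show ?thesis by (simp add: keep_def)
qed

end

section \<open>The recognition algorithm\<close>

text \<open>\<open>A\<close> is a characteristic vector. Initially it contains row 1 if \<open>r = 0\<close>, and row 0 otherwise. If there is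
  no obstacle, \<open>obstacle_expr\<close> evaluates to \<open>m\<close> and only the unused cell with this index is set.\<close>

definition candidate :: loop_prog where
  "candidate = Then (Upd ''r'' (Num 0) (Var ''t''))
     (Then (For ''i'' ''m'' (Upd ''A'' (Var ''i'') (eq (Var ''i'') (eq rr (Num 0)))))
     (Then (For ''u'' ''m'' (Upd ''A'' obstacle_expr (Num 1)))
     (If splitting_expr (Upd ''found'' (Num 0) (Num 1)))))"

text \<open>The guard skips all later rows after a success, so that \<open>r\<close> and
  \<open>A\<close> survive for the output.\<close>

definition search :: loop_prog where
  "search = For ''t'' ''m'' (If (neg (Get ''found'' (Num 0))) candidate)"

definition sel1 :: "string \<Rightarrow> expr" where "sel1 x = disj (eq (Var x) rr) (Get ''A'' (Var x))"
definition sel2 :: "string \<Rightarrow> expr" where "sel2 x = neg (Get ''A'' (Var x))"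

text \<open>The target cell is the row-major position in the submatrix, with both ranks computed by
  counting earlier selected rows and columns. Cell \<open>c\<close> must already hold the number of
  columns.\<close>

definition write_entries :: "string \<Rightarrow> string \<Rightarrow> (string \<Rightarrow> expr) \<Rightarrow> (string \<Rightarrow> expr) \<Rightarrow> loop_prog" where
  "write_entries a c sel keep = For ''u'' ''m'' (For ''v'' ''n'' (If (conj (sel ''u'') (keep ''v''))
     (UpdR a (Add (times (count ''i'' ''m'' (conj (lt (Var ''i'') (Var ''u'')) (sel ''i''))) (Get c (Num 0)))
               (count ''k'' ''n'' (conj (lt (Var ''k'') (Var ''v'')) (keep ''k''))))
       (addr (Var ''u'') ''v''))))"

definition write_factor ::
    "string \<Rightarrow> string \<Rightarrow> string \<Rightarrow> string \<Rightarrow> (string \<Rightarrow> expr) \<Rightarrow> (string \<Rightarrow> expr) \<Rightarrow> loop_prog" where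
  "write_factor a b c x sel keep =
     Then (Upd b (Num 0) (count ''i'' ''m'' (sel ''i'')))
     (Then (Upd c (Num 0) (count ''k'' ''n'' (keep ''k'')))
     (Then (Upd x (Num 0) (count ''i'' ''m'' (conj (lt (Var ''i'') rr) (sel ''i''))))
     (write_entries a c sel keep)))"

definition main :: loop_prog where
  "main = Then search (If (Get ''found'' (Num 0))
     (Then (write_factor ''S1'' ''m1'' ''n1'' ''x1'' sel1 keep1)
           (write_factor ''S2'' ''m2'' ''n2'' ''y1'' sel2 keep2)))"

lemma wf_main: "wf_prog main"
  by (simp add: main_def search_def candidate_def write_factor_def write_entries_def sel1_def sel2_def
      keep1_def keep2_def size_expr_def rank_expr_def gcd_expr_def splitting_expr_def special_expr_def obstacle_expr_def
      before_def inA_def indep_def agree_def addr_def dvd_expr_def count_pairs_def times_def all_def exi_def count_def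
      eq_def lt_def imp_def disj_def conj_def neg_def)

section \<open>Correctness of the search\<close>

lemma fold_invariant:
  assumes "I 0 s" "\<And>i s. i < N \<Longrightarrow> I i s \<Longrightarrow> I (Suc i) (f i s)"
  shows "I N (fold f [0..<N] s)"
  using assms by (induction N) auto

lemma nats_nats_upd_other: "a \<noteq> b \<Longrightarrow> nats (nats_upd a i v s) b = nats s b"
  by (auto simp: nats_upd_def)

lemma reals_reals_upd_other: "a \<noteq> b \<Longrightarrow> reals (reals_upd a i v s) b = reals s b"
  by (auto simp: reals_upd_def)

definition stores_matrix :: "real mat \<Rightarrow> state \<Rightarrow> bool" where
  "stores_matrix S s \<longleftrightarrow> nats s ''m'' 0 = dim_row S \<and> nats s ''n'' 0 = dim_col S \<and>
     (\<forall>i<dim_row S. \<forall>j<dim_col S. reals s ''S'' (i * dim_col S + j) = S $$ (i, j))"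

lemma search_state_iff:
  "search_state S r s A \<longleftrightarrow> stores_matrix S s \<and> nats s ''r'' 0 = r \<and> r < dim_row S \<and>
     A = {i. i < dim_row S \<and> nats s ''A'' i \<noteq> 0}"
  by (auto simp: search_state_def search_state_axioms_def nat_table_def table_def stores_matrix_def)

lemma stores_matrix_input_state: "stores_matrix S (input_state S)"
proof -
  have "i * dim_col S + j < dim_row S * dim_col S" if "i < dim_row S" "j < dim_col S" for i j
  proof -
    have "i * dim_col S + j < Suc i * dim_col S" using that by simp
    also have "\<dots> \<le> dim_row S * dim_col S" using that by (intro mult_le_mono1) simp
    finally show ?thesis .
  qed
  then show ?thesis by (auto simp: stores_matrix_def input_state_def)
qed

text \<open>The start row lies in \<open>X\<close> or in the complementary side, and growing never
  leaves that side. So the grown set still avoids \<open>r\<close> and a row of the other side, and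
  after \<open>m\<close> steps it is independent of the rest.\<close>

lemma splitting_grow_iterate:
  assumes "splitting S r X"
  defines "g \<equiv> nat_table.grow (\<lambda>i j. S $$ (i, j)) (dim_col S) r (dim_row S)"
  shows "splitting S r ((g ^^ dim_row S) ({of_bool (r = 0)} \<inter> {..<dim_row S}))"
proof -
  interpret nat_table "\<lambda>i j. S $$ (i, j)" "dim_col S" r "dim_row S" by unfold_locales simp
  let ?p = "of_bool (r = 0) :: nat"
  let ?A = "(g ^^ dim_row S) {?p}"
  \<comment> \<open>The intersection in the statement covers a one-row matrix, where the start row
    is missing; a splitting rules this out.\<close>
  have p: "?p < dim_row S" "?p \<noteq> r"
  proof -
    obtain x where "x < dim_row S" "x \<noteq> r" using assms(1) by (auto simp: splitting_def)
    then show "?p < dim_row S" by (cases "r = 0") auto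
  qed simp
  obtain X' where X': "splitting S r X'" "?p \<in> X'"
  proof (cases "?p \<in> X")
    case True
    with assms(1) show thesis by (rule that)
  next
    case False
    with p splitting_complement[OF assms(1)] show thesis by (intro that) auto
  qed
  then have sub: "?A \<subseteq> X'"
    unfolding g_def by (intro grow_iterate_subset) (auto simp: splitting_def)
  have "{?p} \<subseteq> (g ^^ t) {?p}" for t
    by (induction t) (auto simp: g_def grow_def)
  then have "?p \<in> ?A" by blast
  moreover have "cond_indep ?A ({..<dim_row S} - ?A)"
    unfolding g_def by (rule grow_iterate_cond_indep) (use p in auto)
  moreover have "?A \<subseteq> {..<dim_row S} - {r}" "insert r ?A \<noteq> {..<dim_row S}" "special_row S r"
  proof -
    have "X' \<subseteq> {..<dim_row S} - {r}" "insert r X' \<noteq> {..<dim_row S}" "special_row S r"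
      using X'(1) by (simp_all add: splitting_def)
    then show "?A \<subseteq> {..<dim_row S} - {r}" "special_row S r" using sub by (blast, simp)
    obtain i where "i < dim_row S" "i \<noteq> r" "i \<notin> X'"
      using \<open>X' \<subseteq> _\<close> \<open>insert r X' \<noteq> _\<close> \<open>special_row S r\<close> by (auto simp: special_row_def)
    then have "i \<in> {..<dim_row S}" "i \<notin> insert r ?A" using sub by auto
    then show "insert r ?A \<noteq> {..<dim_row S}" by blast
  qed
  ultimately have "splitting S r ?A" by (auto simp: splitting_def)
  moreover have "{?p} \<inter> {..<dim_row S} = {?p}" using p by auto
  ultimately show ?thesis by simp
qed

lemma run_candidate:
  fixes env :: "string \<Rightarrow> nat"
  assumes s: "stores_matrix S s" and r: "env ''t'' < dim_row S" "nats s ''found'' 0 = 0"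
  defines "s' \<equiv> run candidate env s"
  shows "stores_matrix S s'"
    and "nats s' ''found'' 0 = 0 \<Longrightarrow> \<not> splitting S (env ''t'') X"
    and "nats s' ''found'' 0 \<noteq> 0 \<Longrightarrow> \<exists>A. search_state S (env ''t'') s' A \<and> splitting S (env ''t'') A"
proof -
  let ?r = "env ''t''"
  let ?A0 = "{of_bool (?r = 0)} \<inter> {..<dim_row S}"
  interpret T: nat_table "\<lambda>i j. S $$ (i, j)" "dim_col S" ?r "dim_row S" by unfold_locales simp
  define s1 where "s1 = nats_upd ''r'' 0 ?r s"
  define s2 where "s2 = run (For ''i'' ''m'' (Upd ''A'' (Var ''i'') (eq (Var ''i'') (eq rr (Num 0))))) env s1"
  define s3 where "s3 = run (For ''u'' ''m'' (Upd ''A'' obstacle_expr (Num 1))) env s2"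
  have s': "s' = run (If splitting_expr (Upd ''found'' (Num 0) (Num 1))) env s3"
    by (simp add: s'_def candidate_def s1_def s2_def s3_def)
  have s1: "stores_matrix S s1" "nats s1 ''r'' 0 = ?r" "nats s1 ''found'' 0 = 0"
    using s r by (simp_all add: s1_def stores_matrix_def)
  define I where "I = (\<lambda>i s. stores_matrix S s \<and> nats s ''r'' 0 = ?r \<and> nats s ''found'' 0 = 0 \<and>
     (\<forall>i'<i. nats s ''A'' i' = of_bool (i' = of_bool (?r = 0))))"
  have "I (nats s1 ''m'' 0) s2"
    unfolding s2_def run.simps
  proof (rule fold_invariant)
    show "I 0 s1" using s1 by (simp add: I_def)
    show "I (Suc i) (nats_upd ''A'' (ev (Var ''i'') (env(''i'' := i)) s)
         (ev (eq (Var ''i'') (eq rr (Num 0))) (env(''i'' := i)) s) s)" if "I i s" for i s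
      using that by (auto simp: I_def stores_matrix_def less_Suc_eq split: if_splits)
  qed
  then have "search_state S ?r s2 ?A0" and found2: "nats s2 ''found'' 0 = 0"
    using s1 r by (auto simp: I_def search_state_iff stores_matrix_def split: if_splits)
  define I' where "I' = (\<lambda>t s. search_state S ?r s ((T.grow ^^ t) ?A0) \<and> nats s ''found'' 0 = 0)"
  have "I' (nats s2 ''m'' 0) s3"
    unfolding s3_def run.simps
  proof (rule fold_invariant)
    show "I' 0 s2" using \<open>search_state S ?r s2 ?A0\<close> found2 by (simp add: I'_def)
    fix t s assume I': "I' t s"
    then interpret search_state S ?r s "(T.grow ^^ t) ?A0" by (simp add: I'_def)
    show "I' (Suc t) (nats_upd ''A'' (ev obstacle_expr (env(''u'' := t)) s) (ev (Num 1) (env(''u'' := t)) s) s)"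
      using I' by (auto simp: I'_def search_state_iff stores_matrix_def ev_obstacle T.grow_def)
  qed
  then have s3: "search_state S ?r s3 ((T.grow ^^ dim_row S) ?A0)" and found3: "nats s3 ''found'' 0 = 0"
    using \<open>search_state S ?r s2 ?A0\<close> by (auto simp: I'_def search_state_iff stores_matrix_def)
  then interpret search_state S ?r s3 "(T.grow ^^ dim_row S) ?A0" by simp
  show "stores_matrix S s'" using s3 by (simp add: s' search_state_iff stores_matrix_def)
  \<comment> \<open>If any set split at this row, the grown set would; so its failure excludes every
    \<open>X\<close>.\<close>
  show "nats s' ''found'' 0 = 0 \<Longrightarrow> \<not> splitting S ?r X"
    using splitting_grow_iterate[of S ?r X] by (auto simp: s' tt_def[symmetric] ev_pos tt_splitting split: if_splits)
  assume "nats s' ''found'' 0 \<noteq> 0"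
  then have "splitting S ?r ((T.grow ^^ dim_row S) ?A0)"
    using found3 by (auto simp: s' tt_def[symmetric] ev_pos tt_splitting split: if_splits)
  moreover have "search_state S ?r s' ((T.grow ^^ dim_row S) ?A0)"
    using s3 by (simp add: s' search_state_iff stores_matrix_def)
  ultimately show "\<exists>A. search_state S ?r s' A \<and> splitting S ?r A" by blast
qed

lemma run_search:
  fixes env :: "string \<Rightarrow> nat"
  assumes s: "stores_matrix S s" "nats s ''found'' 0 = 0"
  defines "s' \<equiv> run search env s"
  shows "nats s' ''found'' 0 = 0 \<Longrightarrow> \<not> is_two_product S"
    and "nats s' ''found'' 0 \<noteq> 0 \<Longrightarrow> \<exists>r A. search_state S r s' A \<and> splitting S r A"
proof -
  \<comment> \<open>After a success the invariant speaks of the row \<open>r\<close> stored at that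
    time, not of the loop variable.\<close>
  define I where "I = (\<lambda>t s. stores_matrix S s \<and> (if nats s ''found'' 0 = 0 then \<forall>r<t. \<forall>X. \<not> splitting S r X
     else \<exists>r A. search_state S r s A \<and> splitting S r A))"
  have "I (nats s ''m'' 0) s'"
    unfolding s'_def search_def run.simps
  proof (rule fold_invariant)
    show "I 0 s" using s by (simp add: I_def)
    fix t s0 assume t: "t < nats s ''m'' 0" and I: "I t s0"
    show "I (Suc t) (if ev (neg (Get ''found'' (Num 0))) (env(''t'' := t)) s0 \<noteq> 0
        then run candidate (env(''t'' := t)) s0 else s0)"
    proof (cases "nats s0 ''found'' 0 = 0")
      case True
      have "t < dim_row S" using t s(1) by (simp add: stores_matrix_def)
      with True I run_candidate[of S s0 "env(''t'' := t)"] show ?thesis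
        by (auto simp: I_def tt_def[symmetric] ev_pos less_Suc_eq split: if_splits)
    next
      case False
      with I show ?thesis by (auto simp: I_def tt_def[symmetric] ev_pos)
    qed
  qed
  then have I: "I (dim_row S) s'" using s(1) by (simp add: stores_matrix_def)
  show "nats s' ''found'' 0 = 0 \<Longrightarrow> \<not> is_two_product S"
  proof
    assume *: "nats s' ''found'' 0 = 0" "is_two_product S"
    from splitting_if_two_product[OF *(2)] obtain r X where "splitting S r X" .
    moreover from this have "r < dim_row S" by (simp add: splitting_def special_row_def)
    ultimately show False using I *(1) by (auto simp: I_def)
  qed
  show "nats s' ''found'' 0 \<noteq> 0 \<Longrightarrow> \<exists>r A. search_state S r s' A \<and> splitting S r A"
    using I by (auto simp: I_def)
qed

section \<open>Correctness of the output\<close>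

lemma search_state_cong:
  assumes "search_state S r s A" and "\<And>a. a \<in> {''m'', ''n'', ''r'', ''A''} \<Longrightarrow> nats s' a = nats s a"
    and "reals s' ''S'' = reals s ''S''"
  shows "search_state S r s' A"
  using assms by (simp add: search_state_iff stores_matrix_def)

text \<open>Quantified over all states because the output phase changes the state between
  evaluations.\<close>

definition selects_rows :: "real mat \<Rightarrow> nat \<Rightarrow> nat set \<Rightarrow> (string \<Rightarrow> expr) \<Rightarrow> nat set \<Rightarrow> bool" where
  "selects_rows S r A sel I \<longleftrightarrow> (\<forall>s env x. search_state S r s A \<longrightarrow> env x < dim_row S \<longrightarrow>
     (tt (sel x) env s \<longleftrightarrow> env x \<in> I))"

text \<open>Only the names \<open>k\<close> and \<open>v\<close> are passed by the output phase;
  other names could be captured inside \<open>keep1\<close> and \<open>keep2\<close>.\<close>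

definition selects_columns :: "real mat \<Rightarrow> nat \<Rightarrow> nat set \<Rightarrow> (string \<Rightarrow> expr) \<Rightarrow> nat set \<Rightarrow> bool" where
  "selects_columns S r A keep K \<longleftrightarrow> (\<forall>s env k. search_state S r s A \<longrightarrow> k \<in> {''k'', ''v''} \<longrightarrow>
     env k < dim_col S \<longrightarrow> (tt (keep k) env s \<longleftrightarrow> env k \<in> K))"

text \<open>Distinct selected entries have distinct positions, by division with remainder, so no
  written entry is overwritten; and the target differs from \<open>S\<close>, so what is read stays
  intact.\<close>

lemma run_write_entries:
  fixes env :: "string \<Rightarrow> nat"
  assumes st: "search_state S r s A"
    and sel: "selects_rows S r A sel I" and keep: "selects_columns S r A keep K"
    and I: "I \<subseteq> {..<dim_row S}" and K: "K \<subseteq> {..<dim_col S}" and a: "a \<noteq> ''S''"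
    and c: "nats s c 0 = card K"
  defines "s' \<equiv> run (write_entries a c sel keep) env s"
  shows "nats s' = nats s" and "\<And>b. b \<noteq> a \<Longrightarrow> reals s' b = reals s b"
    and "\<And>u v. u \<in> I \<Longrightarrow> v \<in> K \<Longrightarrow> reals s' a (rank I u * card K + rank K v) = S $$ (u, v)"
proof -
  note sel_iff = sel[unfolded selects_rows_def, rule_format]
  note keep_iff = keep[unfolded selects_columns_def, rule_format]
  define frame where "frame = (\<lambda>s' :: state. nats s' = nats s \<and> (\<forall>b. b \<noteq> a \<longrightarrow> reals s' b = reals s b))"
  define pos where "pos = (\<lambda>u v. rank I u * card K + rank K v)"
  have sets: "{i. i < dim_row S \<and> i \<in> I} = I" "{k. k < dim_col S \<and> k \<in> K} = K" using I K by auto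
  have bijI: "bij_betw (rank I) I {..<card I}" and bijK: "bij_betw (rank K) K {..<card K}"
    using bij_betw_rank[of I "dim_row S"] bij_betw_rank[of K "dim_col S"] by (simp_all only: sets)
  have pos_inj: "u = u' \<and> v = v'" if "u \<in> I" "u' \<in> I" "v \<in> K" "v' \<in> K" "pos u v = pos u' v'" for u u' v v'
  proof -
    have less: "rank K v < card K" "rank K v' < card K" using bij_betwE[OF bijK] that by auto
    have "pos u v div card K = rank I u" "pos u v mod card K = rank K v"
      "pos u' v' div card K = rank I u'" "pos u' v' mod card K = rank K v'"
      using less by (simp_all add: pos_def)
    with that(5) have "rank I u = rank I u'" "rank K v = rank K v'" by simp_all
    with that bijI bijK show ?thesis by (auto simp: bij_betw_def inj_on_def)
  qed
  have frame_state: "search_state S r s' A" if "frame s'" for s'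
    using that a by (intro search_state_cong[OF st]) (auto simp: frame_def)
  let ?upd = "If (conj (sel ''u'') (keep ''v''))
     (UpdR a (Add (times (count ''i'' ''m'' (conj (lt (Var ''i'') (Var ''u'')) (sel ''i''))) (Get c (Num 0)))
               (count ''k'' ''n'' (conj (lt (Var ''k'') (Var ''v'')) (keep ''k''))))
       (addr (Var ''u'') ''v''))"
  have step: "run ?upd (env(''u'' := u, ''v'' := v)) s' =
      (if u \<in> I \<and> v \<in> K then reals_upd a (pos u v) (S $$ (u, v)) s' else s')"
    if "frame s'" "u < dim_row S" "v < dim_col S" for s' u v
  proof -
    let ?env = "env(''u'' := u, ''v'' := v)"
    interpret search_state S r s' A by (rule frame_state) fact
    have "{i. i < dim_row S \<and> i < u \<and> tt (sel ''i'') (env'(''i'' := i)) s'} = {i \<in> I. i < u}" for env'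
      using sel_iff[OF frame_state[OF that(1)]] I by auto
    then have ev_u: "ev (count ''i'' ''m'' (conj (lt (Var ''i'') (Var ''u'')) (sel ''i''))) env' s' = rank I u"
      if "env' ''u'' = u" for env'
      using that by (simp add: rank_def)
    have "{k. k < dim_col S \<and> k < v \<and> tt (keep ''k'') (?env(''k'' := k)) s'} = {k \<in> K. k < v}"
      using keep_iff[OF frame_state[OF that(1)], of "''k''"] K by auto
    then have ev_v: "ev (count ''k'' ''n'' (conj (lt (Var ''k'') (Var ''v'')) (keep ''k''))) ?env s' = rank K v"
      by (simp add: rank_def)
    have "rank I u \<le> dim_row S"
      unfolding rank_def using card_mono[of "{..<dim_row S}" "{a \<in> I. a < u}"] I by auto
    moreover have "nats s' c 0 = card K" using that(1) c by (simp add: frame_def)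
    ultimately have "ev (times (count ''i'' ''m'' (conj (lt (Var ''i'') (Var ''u'')) (sel ''i''))) (Get c (Num 0))) ?env s'
        = rank I u * card K"
      by (intro ev_times) (simp_all add: ev_u del: ev_count)
    moreover have "tt (sel ''u'') ?env s' \<longleftrightarrow> u \<in> I" "tt (keep ''v'') ?env s' \<longleftrightarrow> v \<in> K"
      using that sel_iff[OF frame_state[OF that(1)], of ?env "''u''"] keep_iff[OF frame_state[OF that(1)], of "''v''" ?env]
      by simp_all
    moreover have "reals s' ''S'' (ev (addr (Var ''u'') ''v'') ?env s') = S $$ (u, v)"
      by (subst S_addr[of _ _ u]) (use that in simp_all)
    ultimately show ?thesis
      by (simp add: ev_pos ev_v pos_def del: ev_count fun_upd_apply)
  qed
  define J where "J = (\<lambda>u v s'. frame s' \<and>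
     (\<forall>i\<in>I. \<forall>j\<in>K. i < u \<or> i = u \<and> j < v \<longrightarrow> reals s' a (pos i j) = S $$ (i, j)))"
  have "J (nats s ''m'' 0) 0 s'"
    unfolding s'_def write_entries_def run.simps(5)
  proof (rule fold_invariant)
    show "J 0 0 s" by (simp add: J_def frame_def)
    fix u s1 assume u: "u < nats s ''m'' 0" and J: "J u 0 s1"
    have dims: "nats s ''m'' 0 = dim_row S" "nats s1 ''n'' 0 = dim_col S"
      using st J by (auto simp: search_state_iff stores_matrix_def J_def frame_def)
    have "J u (nats s1 ''n'' 0) (fold (\<lambda>v. run ?upd (env(''u'' := u, ''v'' := v))) [0..<nats s1 ''n'' 0] s1)"
    proof (rule fold_invariant)
      fix v s2 assume v: "v < nats s1 ''n'' 0" and J2: "J u v s2"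
      then have "frame s2" by (simp add: J_def)
      then have eq: "run ?upd (env(''u'' := u, ''v'' := v)) s2 =
         (if u \<in> I \<and> v \<in> K then reals_upd a (pos u v) (S $$ (u, v)) s2 else s2)"
        using u v dims by (intro step) auto
      have frame: "frame (run ?upd (env(''u'' := u, ''v'' := v)) s2)"
        unfolding eq using \<open>frame s2\<close> by (auto simp: frame_def reals_reals_upd_other)
      have "reals (run ?upd (env(''u'' := u, ''v'' := v)) s2) a (pos i j) = S $$ (i, j)"
        if ij: "i \<in> I" "j \<in> K" "i < u \<or> i = u \<and> j < Suc v" for i j
      proof (cases "i = u \<and> j = v")
        case True
        with ij show ?thesis unfolding eq by simp
      next
        case False
        with ij J2 have "reals s2 a (pos i j) = S $$ (i, j)" by (auto simp: J_def less_Suc_eq)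
        then show ?thesis unfolding eq using False pos_inj[of u i v j] ij by auto
      qed
      with frame show "J u (Suc v) (run ?upd (env(''u'' := u, ''v'' := v)) s2)" unfolding J_def by blast
    qed (fact J)
    \<comment> \<open>Having finished all columns of row \<open>u\<close> is the same as standing at
      column 0 of row \<open>Suc u\<close>, as \<open>K\<close> contains only columns of
      \<open>S\<close>.\<close>
    then show "J (Suc u) 0 (fold (\<lambda>v. run ?upd (env(''u'' := u, ''v'' := v))) [0..<nats s1 ''n'' 0] s1)"
      using K by (auto simp: J_def dims less_Suc_eq)
  qed
  then have J: "J (dim_row S) 0 s'" using st by (simp add: search_state_iff stores_matrix_def)
  then show "nats s' = nats s" "\<And>b. b \<noteq> a \<Longrightarrow> reals s' b = reals s b" by (auto simp: J_def frame_def)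
  show "reals s' a (rank I u * card K + rank K v) = S $$ (u, v)" if "u \<in> I" "v \<in> K" for u v
    using J that I by (auto simp: J_def pos_def)
qed

text \<open>The sizes are written before the entries because \<open>write_entries\<close> reads
  \<open>c\<close> to compute addresses. Distinct names protect the dimensions of \<open>S\<close>,
  \<open>r\<close> and \<open>A\<close>.\<close>

lemma run_write_factor:
  fixes env :: "string \<Rightarrow> nat"
  assumes st: "search_state S r s A"
    and sel: "selects_rows S r A sel I" and keep: "selects_columns S r A keep K"
    and I: "I \<subseteq> {..<dim_row S}" and K: "K \<subseteq> {..<dim_col S}" and a: "a \<noteq> ''S''"
    and names: "distinct [''m'', ''n'', ''r'', ''A'', b, c, x]"
  defines "s' \<equiv> run (write_factor a b c x sel keep) env s"
  shows "search_state S r s' A"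
    and "\<And>y. y \<notin> {b, c, x} \<Longrightarrow> nats s' y = nats s y" and "\<And>y. y \<noteq> a \<Longrightarrow> reals s' y = reals s y"
    and "nats s' x 0 = rank I r"
    and "read_mat a (nats s' b 0) (nats s' c 0) s' = submatrix S I K"
proof -
  note sel_iff = sel[unfolded selects_rows_def, rule_format]
  note keep_iff = keep[unfolded selects_columns_def, rule_format]
  have sets: "{i. i < dim_row S \<and> i \<in> I} = I" "{k. k < dim_col S \<and> k \<in> K} = K" using I K by auto
  have bijI: "bij_betw (rank I) I {..<card I}" and bijK: "bij_betw (rank K) K {..<card K}"
    using bij_betw_rank[of I "dim_row S"] bij_betw_rank[of K "dim_col S"] by (simp_all only: sets)
  define s1 where "s1 = nats_upd b 0 (card I) s"
  define s2 where "s2 = nats_upd c 0 (card K) s1"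
  define s3 where "s3 = nats_upd x 0 (rank I r) s2"
  have st1: "search_state S r s1 A"
    by (rule search_state_cong[OF st]) (use names in \<open>auto simp: s1_def nats_nats_upd_other\<close>)
  have st2: "search_state S r s2 A"
    by (rule search_state_cong[OF st1]) (use names in \<open>auto simp: s2_def nats_nats_upd_other\<close>)
  have st3: "search_state S r s3 A"
    by (rule search_state_cong[OF st2]) (use names in \<open>auto simp: s3_def nats_nats_upd_other\<close>)
  have "{i. i < dim_row S \<and> tt (sel ''i'') (env(''i'' := i)) s} = I" using sel_iff[OF st] I by auto
  then have run1: "run (Upd b (Num 0) (count ''i'' ''m'' (sel ''i''))) env s = s1"
    using st by (simp add: s1_def search_state_iff stores_matrix_def del: fun_upd_apply)
  have "{k. k < dim_col S \<and> tt (keep ''k'') (env(''k'' := k)) s1} = K"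
    using keep_iff[OF st1, of "''k''"] K by auto
  then have run2: "run (Upd c (Num 0) (count ''k'' ''n'' (keep ''k''))) env s1 = s2"
    using st1 by (simp add: s2_def search_state_iff stores_matrix_def del: fun_upd_apply)
  have "{i. i < dim_row S \<and> i < r \<and> tt (sel ''i'') (env(''i'' := i)) s2} = {i \<in> I. i < r}"
    using sel_iff[OF st2] I by auto
  then have run3: "run (Upd x (Num 0) (count ''i'' ''m'' (conj (lt (Var ''i'') rr) (sel ''i'')))) env s2 = s3"
    using st2 by (simp add: s3_def rank_def search_state_iff stores_matrix_def)
  have s': "s' = run (write_entries a c sel keep) env s3"
    by (simp only: s'_def write_factor_def run.simps(3) run1 run2 run3)
  have c3: "nats s3 c 0 = card K" using names by (auto simp: s3_def s2_def)
  note w = run_write_entries[OF st3 sel keep I K a c3, where env = env, folded s']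
  show "search_state S r s' A"
    by (rule search_state_cong[OF st3]) (use w a in auto)
  show "nats s' y = nats s y" if "y \<notin> {b, c, x}" for y
    using that by (auto simp: w(1) s3_def s2_def s1_def fun_eq_iff)
  show "reals s' y = reals s y" if "y \<noteq> a" for y
    using that by (simp add: w(2) s3_def s2_def s1_def)
  show "nats s' x 0 = rank I r" by (simp add: w(1) s3_def)
  have dims: "nats s' b 0 = card I" "nats s' c 0 = card K"
    using names by (auto simp: w(1) s3_def s2_def s1_def)
  show "read_mat a (nats s' b 0) (nats s' c 0) s' = submatrix S I K"
  proof (rule eq_matI; clarsimp simp: dims read_mat_def dim_submatrix sets)
    fix i j assume "i < card I" "j < card K"
    then have "i \<in> rank I ` I" "j \<in> rank K ` K" using bijI bijK by (simp_all add: bij_betw_def)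
    then obtain u v where uv: "u \<in> I" "i = rank I u" "v \<in> K" "j = rank K v" by blast
    then show "reals s' a (i * card K + j) = submatrix S I K $$ (i, j)"
      using w(3)[OF uv(1,3)] submatrix_index_card[of u S v I K] subsetD[OF I, of u] subsetD[OF K, of v]
      by (simp add: rank_def)
  qed
qed

theorem theorem12:
  shows "\<exists>(prog :: com) (c :: nat) (d :: nat). \<forall>(m :: nat) (n :: nat). \<forall>S \<in> carrier_mat m n.
    \<exists>t s. exec prog (input_state S) t s \<and> t \<le> c * (m + n + 1) ^ d \<and>
      (if is_two_product S
       then \<exists>S1 x1 S2 y1. answer s = Some (S1, x1, S2, y1) \<and> two_product_witness S S1 x1 S2 y1
       else answer s = None)"
proof -
  obtain prog c d where prog: "\<And>m n S. S \<in> carrier_mat m n \<Longrightarrow>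
       \<exists>t. exec prog (input_state S) t (run main (\<lambda>_. 0) (input_state S)) \<and> t \<le> c * (m + n + 1) ^ d"
    by (rule compiled_polynomial_time[OF wf_main]) (rule that; assumption)
  have correct: "if is_two_product S
       then \<exists>S1 x1 S2 y1. answer s = Some (S1, x1, S2, y1) \<and> two_product_witness S S1 x1 S2 y1
       else answer s = None" if s: "s = run main (\<lambda>_. 0) (input_state S)" for S s
  proof -
    let ?env = "\<lambda>_ :: string. 0 :: nat"
    define s0 where "s0 = run search ?env (input_state S)"
    have "nats (input_state S) ''found'' 0 = 0" by (simp add: input_state_def)
    note search = run_search[OF stores_matrix_input_state this, where env = ?env, folded s0_def]
    show ?thesis
    proof (cases "nats s0 ''found'' 0 = 0")
      case True
      then have "s = s0" by (simp add: s main_def s0_def tt_def[symmetric])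
      with True search(1) show ?thesis by (simp add: answer_def)
    next
      case False
      with search(2) obtain r A where st: "search_state S r s0 A" and split: "splitting S r A" by blast
      let ?I1 = "insert r A" and ?I2 = "{..<dim_row S} - A"
      let ?K1 = "first_factor_columns S r A" and ?K2 = "second_factor_columns S r A"
      interpret T: nat_table "\<lambda>i j. S $$ (i, j)" "dim_col S" r "dim_row S" by unfold_locales simp
      define s1 where "s1 = run (write_factor ''S1'' ''m1'' ''n1'' ''x1'' sel1 keep1) ?env s0"
      have s_eq: "s = run (write_factor ''S2'' ''m2'' ''n2'' ''y1'' sel2 keep2) ?env s1"
        using False by (simp add: s main_def s0_def s1_def)
      have r: "r < dim_row S" "A \<subseteq> {..<dim_row S}" "r \<notin> A"
        using split by (auto simp: splitting_def special_row_def)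
      have K: "?K1 \<subseteq> {..<dim_col S}" "?K2 \<subseteq> {..<dim_col S}"
        by (auto simp: first_factor_columns_def second_factor_columns_def T.keep_def)
      have sel1: "selects_rows S r A sel1 ?I1" and sel2: "selects_rows S r A sel2 ?I2"
        by (auto simp: selects_rows_def sel1_def sel2_def search_state_iff)
      have keep1: "selects_columns S r A keep1 ?K1"
        unfolding selects_columns_def
      proof (intro allI impI)
        fix s k and env :: "string \<Rightarrow> nat"
        assume "search_state S r s A" and k: "k \<in> {''k'', ''v''}" "env k < dim_col S"
        then interpret search_state S r s A by simp
        show "tt (keep1 k) env s \<longleftrightarrow> env k \<in> ?K1"
          using k tt_keep1[of k env] by (auto simp: first_factor_columns_def)
      qed
      have keep2: "selects_columns S r A keep2 ?K2"
        unfolding selects_columns_def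
      proof (intro allI impI)
        fix s k and env :: "string \<Rightarrow> nat"
        assume "search_state S r s A" and k: "k \<in> {''k'', ''v''}" "env k < dim_col S"
        then interpret search_state S r s A by simp
        show "tt (keep2 k) env s \<longleftrightarrow> env k \<in> ?K2"
          using k tt_keep2[of k env] by (auto simp: second_factor_columns_def)
      qed
      have "?I1 \<subseteq> {..<dim_row S}" "''S1'' \<noteq> ''S''"
          "distinct [''m'', ''n'', ''r'', ''A'', ''m1'', ''n1'', ''x1'']"
        using r by auto
      note w1 = run_write_factor[OF st sel1 keep1 this(1) K(1) this(2,3), where env = ?env, folded s1_def]
      have "?I2 \<subseteq> {..<dim_row S}" "''S2'' \<noteq> ''S''"
          "distinct [''m'', ''n'', ''r'', ''A'', ''m2'', ''n2'', ''y1'']"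
        using r by auto
      note w2 = run_write_factor[OF w1(1) sel2 keep2 this(1) K(2) this(2,3), where env = ?env, folded s_eq]
      \<comment> \<open>The second pass starts in the state left by the first, whose outputs survive
        because all names differ.\<close>
      have "read_mat ''S1'' (nats s ''m1'' 0) (nats s ''n1'' 0) s = submatrix S ?I1 ?K1"
        using w1(5) w2(2,3) by (simp add: read_mat_def)
      moreover have "nats s ''x1'' 0 = rank ?I1 r" "nats s ''found'' 0 \<noteq> 0"
        using w1(2,4) w2(2) False by simp_all
      ultimately have "answer s = Some (submatrix S ?I1 ?K1, rank ?I1 r, submatrix S ?I2 ?K2, rank ?I2 r)"
        using w2(4,5) by (simp add: answer_def)
      moreover have "two_product_witness S (submatrix S ?I1 ?K1) (rank ?I1 r) (submatrix S ?I2 ?K2) (rank ?I2 r)"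
        by (rule two_product_witness_if_splitting) (fact split)
      ultimately show ?thesis by (auto simp: is_two_product_def)
    qed
  qed
  show ?thesis
  proof (rule exI[of _ prog], rule exI[of _ c], rule exI[of _ d], intro allI ballI)
    fix m n :: nat and S :: "real mat" assume "S \<in> carrier_mat m n"
    from prog[OF this] obtain t where "exec prog (input_state S) t (run main (\<lambda>_. 0) (input_state S))"
      "t \<le> c * (m + n + 1) ^ d" by blast
    with correct[OF refl, of S] show "\<exists>t s. exec prog (input_state S) t s \<and> t \<le> c * (m + n + 1) ^ d \<and>
      (if is_two_product S
       then \<exists>S1 x1 S2 y1. answer s = Some (S1, x1, S2, y1) \<and> two_product_witness S S1 x1 S2 y1
       else answer s = None)"
      by (intro exI conjI)
  qed
qed

end
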